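(* Let $N\geq 2$, let $\Omega\subset\mathbb{R}^N$ be an open set and let $u:\Omega\to\mathbb{R}^N$ be Lebesgue measurable with $|u|=1$ a.e. in $\Omega$. Then $$u(x)=\frac{1}{V_{N-1}}\int_{\mathbb{S}^{N-1}}\xi\,\chi(x,\xi)\,d\mathcal{H}^{N-1}(\xi)\quad\text{for a.e. }x\in\Omega,$$ where $V_{N-1}$ is the volume of the unit ball in $\mathbb{R}^{N-1}$. Moreover, if $u$ satisfies the kinetic formulation $$v\cdot\nabla_x\chi(\cdot,\xi)=0\quad\text{distributionally in }\Omega,\ \text{ for every }\xi\in\mathbb{S}^{N-1}\text{ and every }v\in\xi^\perp,$$ then $\nabla\times u=0$ distributionally in $\Omega$.
   Context: $\mathbb{S}^{N-1}$ is the unit sphere of $\mathbb{R}^N$ and $\mathcal{H}^{k}$ is the $k$-dimensional Hausdorff measure. For $\xi\in\mathbb{S}^{N-1}$, $\xi^\perp=\{v\in\mathbb{R}^N:v\cdot\xi=0\}$, and $\chi(\cdot,\xi):\Omega\to\{0,1\}$ is defined from $u$ by $\chi(x,\xi)=1$ if $u(x)\cdot\xi>0$ and $\chi(x,\xi)=0$ if $u(x)\cdot\xi\leq 0$. The condition $\nabla\times u=0$ means $\partial_j u_k=\partial_k u_j$ for all $1\leq j,k\leq N$. *)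

theory Defs
  imports "HOL-Analysis.Analysis"
begin

section \<open>Hausdorff measure\<close>

text \<open>The normalisation is the usual one for which the $k$-dimensional Hausdorff measure of
  \<open>\<real>\<^sup>k\<close> is Lebesgue measure: a covering set of diameter $d$ contributes the volume of a
  $k$-dimensional ball of diameter $d$. The empty set contributes 0 for every \<open>k\<close> (the formula
  would give 1 if \<open>k = 0\<close>). The library's \<open>diameter\<close> is a junk value on unbounded sets, hence
  the explicit boundedness of the covering sets; over no admissible covering the infimum is \<open>\<infinity>\<close>.\<close>

definition hausdorff_weight :: "nat \<Rightarrow> 'a::metric_space set \<Rightarrow> ennreal" where
  "hausdorff_weight k C =
     (if C = {} then 0 else ennreal (unit_ball_vol (real k) * (diameter C / 2) ^ k))"

definition hausdorff_content :: "nat \<Rightarrow> real \<Rightarrow> 'a::metric_space set \<Rightarrow> ennreal" where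
  "hausdorff_content k \<delta> A =
     (INF C \<in> {C :: nat \<Rightarrow> 'a set. A \<subseteq> (\<Union>i. C i) \<and> (\<forall>i. bounded (C i) \<and> diameter (C i) \<le> \<delta>)}.
        \<Sum>i. hausdorff_weight k (C i))"

definition hausdorff_outer_measure :: "nat \<Rightarrow> 'a::metric_space set \<Rightarrow> ennreal" where
  "hausdorff_outer_measure k A = (SUP \<delta> \<in> {0<..}. hausdorff_content k \<delta> A)"

definition hausdorff_measure :: "nat \<Rightarrow> 'a::metric_space measure" where
  "hausdorff_measure k = measure_of UNIV (sets borel) (hausdorff_outer_measure k)"

lemma space_hausdorff_measure [simp]: "space (hausdorff_measure k) = UNIV"
  by (simp add: hausdorff_measure_def space_measure_of_conv)

lemma sets_hausdorff_measure [simp, measurable_cong]: "sets (hausdorff_measure k) = sets borel"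
  unfolding hausdorff_measure_def
  using sets.sets_measure_of_eq[of borel "hausdorff_outer_measure k"] by simp

text \<open>\<open>measure_of\<close> yields the zero measure if its argument is not countably additive; the rest of
  this section shows that this is not the case, by Caratheodory's criterion for metric
  outer measures.\<close>

lemma hausdorff_weight_mono:
  assumes "C \<subseteq> D" "bounded D"
  shows "hausdorff_weight k C \<le> hausdorff_weight k D"
  using assms diameter_subset[OF assms] diameter_ge_0[OF bounded_subset[OF assms(2,1)]]
  by (auto simp: hausdorff_weight_def intro!: ennreal_leI mult_left_mono power_mono)

lemma hausdorff_content_mono: "A \<subseteq> B \<Longrightarrow> hausdorff_content k \<delta> A \<le> hausdorff_content k \<delta> B"
  unfolding hausdorff_content_def by (rule INF_superset_mono) auto

lemma hausdorff_content_antimono: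
  "\<delta> \<le> \<epsilon> \<Longrightarrow> hausdorff_content k \<epsilon> A \<le> hausdorff_content k \<delta> A"
  unfolding hausdorff_content_def by (rule INF_superset_mono) (auto intro: order_trans)

lemma hausdorff_content_le:
  "A \<subseteq> (\<Union>i. C i) \<Longrightarrow> (\<And>i. bounded (C i)) \<Longrightarrow> (\<And>i. diameter (C i) \<le> \<delta>)
    \<Longrightarrow> hausdorff_content k \<delta> A \<le> (\<Sum>i. hausdorff_weight k (C i))"
  unfolding hausdorff_content_def by (rule INF_lower) auto

lemma hausdorff_content_empty: "\<delta> > 0 \<Longrightarrow> hausdorff_content k \<delta> {} = 0"
  using hausdorff_content_le[of "{}" "\<lambda>_. {}" \<delta> k] by (simp add: hausdorff_weight_def)

lemma hausdorff_content_close: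
  "hausdorff_content k \<delta> A < e \<Longrightarrow> \<exists>C. A \<subseteq> (\<Union>i. C i) \<and>
    (\<forall>i. bounded (C i) \<and> diameter (C i) \<le> \<delta>) \<and> (\<Sum>i. hausdorff_weight k (C i)) < e"
  unfolding hausdorff_content_def INF_less_iff by auto

lemma hausdorff_content_UN_le:
  assumes "\<delta> > 0"
  shows "hausdorff_content k \<delta> (\<Union>n. A n) \<le> (\<Sum>n::nat. hausdorff_content k \<delta> (A n))"
proof (rule ennreal_le_epsilon)
  fix e :: real
  assume e: "0 < e" and fin: "(\<Sum>n. hausdorff_content k \<delta> (A n)) < top"
  then have "hausdorff_content k \<delta> (A n) < hausdorff_content k \<delta> (A n) + e * (1/2)^Suc n" for n
    by (auto simp add: less_top dest!: ennreal_suminf_lessD)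
  then have "\<exists>C. A n \<subseteq> (\<Union>i. C i) \<and> (\<forall>i. bounded (C i) \<and> diameter (C i) \<le> \<delta>) \<and>
      (\<Sum>i. hausdorff_weight k (C i)) < hausdorff_content k \<delta> (A n) + e * (1/2)^Suc n" for n
    by (rule hausdorff_content_close)
  then have "\<exists>C. \<forall>n. A n \<subseteq> (\<Union>i. C n i) \<and> (\<forall>i. bounded (C n i) \<and> diameter (C n i) \<le> \<delta>) \<and>
      (\<Sum>i. hausdorff_weight k (C n i)) < hausdorff_content k \<delta> (A n) + e * (1/2)^Suc n"
    by (intro choice allI)
  then obtain C where C: "\<And>n. A n \<subseteq> (\<Union>i. C n i)" "\<And>n i. bounded (C n i)"
      "\<And>n i. diameter (C n i) \<le> \<delta>"
      "\<And>n. (\<Sum>i. hausdorff_weight k (C n i)) < hausdorff_content k \<delta> (A n) + e * (1/2)^Suc n"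
    by blast
  define D where "D = case_prod C o prod_decode"
  have "(\<Union>n. A n) \<subseteq> (\<Union>i. D i)"
    using C(1) by (auto simp add: D_def subset_eq) (metis prod.case prod_encode_inverse)
  then have "hausdorff_content k \<delta> (\<Union>n. A n) \<le> (\<Sum>i. hausdorff_weight k (D i))"
    using C(2,3) by (intro hausdorff_content_le) (auto simp: D_def split_def)
  also have "\<dots> = (\<Sum>n. \<Sum>i. hausdorff_weight k (C n i))"
    unfolding D_def comp_def by (intro suminf_ennreal_2dimen) auto
  also have "\<dots> \<le> (\<Sum>n. hausdorff_content k \<delta> (A n) + e * (1/2) ^ Suc n)"
    using C(4) by (intro suminf_le less_imp_le) auto
  also have "\<dots> = (\<Sum>n. hausdorff_content k \<delta> (A n)) + (\<Sum>n. ennreal e * ennreal ((1/2) ^ Suc n))"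
    using e by (subst suminf_add[symmetric])
      (auto simp del: ennreal_suminf_cmult simp add: ennreal_mult[symmetric])
  also have "\<dots> = (\<Sum>n. hausdorff_content k \<delta> (A n)) + e"
    unfolding ennreal_suminf_cmult
    by (subst suminf_ennreal_eq[OF zero_le_power power_half_series]) auto
  finally show "hausdorff_content k \<delta> (\<Union>n. A n) \<le> (\<Sum>n. hausdorff_content k \<delta> (A n)) + e" .
qed

lemma hausdorff_outer_measure_empty: "hausdorff_outer_measure k {} = 0"
proof -
  have "hausdorff_outer_measure k {} = (SUP \<delta> \<in> {0::real<..}. (0::ennreal))"
    unfolding hausdorff_outer_measure_def by (rule SUP_cong) (auto simp: hausdorff_content_empty)
  then show ?thesis by simp
qed

lemma hausdorff_outer_measure_mono:
  "A \<subseteq> B \<Longrightarrow> hausdorff_outer_measure k A \<le> hausdorff_outer_measure k B"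
  unfolding hausdorff_outer_measure_def by (intro SUP_mono) (blast intro: hausdorff_content_mono)

lemma hausdorff_outer_measure_UN_le:
  "hausdorff_outer_measure k (\<Union>n. A n) \<le> (\<Sum>n::nat. hausdorff_outer_measure k (A n))"
  unfolding hausdorff_outer_measure_def[of k "\<Union>n. A n"]
proof (rule SUP_least)
  fix \<delta> :: real assume \<delta>: "\<delta> \<in> {0<..}"
  then have "hausdorff_content k \<delta> (\<Union>n. A n) \<le> (\<Sum>n::nat. hausdorff_content k \<delta> (A n))"
    by (intro hausdorff_content_UN_le) simp
  also have "\<dots> \<le> (\<Sum>n. hausdorff_outer_measure k (A n))"
    using \<delta> unfolding hausdorff_outer_measure_def by (intro suminf_le SUP_upper) auto
  finally show "hausdorff_content k \<delta> (\<Union>n. A n) \<le> (\<Sum>n. hausdorff_outer_measure k (A n))" .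
qed

lemma outer_measure_space_hausdorff:
  "outer_measure_space (Pow UNIV) (hausdorff_outer_measure k)"
  unfolding outer_measure_space_def positive_def increasing_def countably_subadditive_def
  by (auto simp: hausdorff_outer_measure_empty hausdorff_outer_measure_mono
      hausdorff_outer_measure_UN_le)

lemma hausdorff_outer_measure_Un_le:
  "hausdorff_outer_measure k (A \<union> B) \<le> hausdorff_outer_measure k A + hausdorff_outer_measure k B"
proof -
  have "hausdorff_outer_measure k (A \<union> B) = hausdorff_outer_measure k (\<Union>n. binaryset A B n)"
    by (simp add: UN_binaryset_eq)
  also have "\<dots> \<le> (\<Sum>n. hausdorff_outer_measure k (binaryset A B n))"
    by (rule hausdorff_outer_measure_UN_le)
  also have "\<dots> = hausdorff_outer_measure k A + hausdorff_outer_measure k B"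
    by (rule suminf_binaryset_eq) (rule hausdorff_outer_measure_empty)
  finally show ?thesis .
qed

lemma hausdorff_outer_measure_separated:
  assumes d: "d > 0" and sep: "\<And>x y. x \<in> A \<Longrightarrow> y \<in> B \<Longrightarrow> d \<le> dist x y"
  shows "hausdorff_outer_measure k A + hausdorff_outer_measure k B
    \<le> hausdorff_outer_measure k (A \<union> B)"
proof -
  have *: "hausdorff_content k \<delta> A + hausdorff_content k \<delta> B \<le> hausdorff_content k \<delta> (A \<union> B)"
    if \<delta>: "\<delta> < d" for \<delta>
    unfolding hausdorff_content_def[of k \<delta> "A \<union> B"]
  proof (rule INF_greatest)
    fix C :: "nat \<Rightarrow> 'a set"
    assume "C \<in> {C. A \<union> B \<subseteq> (\<Union>i. C i) \<and> (\<forall>i. bounded (C i) \<and> diameter (C i) \<le> \<delta>)}"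
    then have C: "A \<union> B \<subseteq> (\<Union>i. C i)" "\<And>i. bounded (C i)" "\<And>i. diameter (C i) \<le> \<delta>"
      by auto
    have le: "hausdorff_content k \<delta> X \<le> (\<Sum>i. hausdorff_weight k (C i \<inter> X))"
      if "X \<subseteq> A \<union> B" for X
    proof (rule hausdorff_content_le)
      show "X \<subseteq> (\<Union>i. C i \<inter> X)" using C(1) that by auto
      show "bounded (C i \<inter> X)" for i using C(2) bounded_subset by blast
      show "diameter (C i \<inter> X) \<le> \<delta>" for i
        using C(3) diameter_subset[OF _ C(2), of "C i \<inter> X" i] by (auto intro: order_trans)
    qed
    have w: "hausdorff_weight k (C i \<inter> A) + hausdorff_weight k (C i \<inter> B) \<le> hausdorff_weight k (C i)"
      for i
    proof -
      have "C i \<inter> A = {} \<or> C i \<inter> B = {}"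
      proof (rule ccontr)
        assume "\<not> ?thesis"
        then obtain x y where xy: "x \<in> C i" "x \<in> A" "y \<in> C i" "y \<in> B" by blast
        then have "d \<le> diameter (C i)"
          using sep diameter_bounded_bound[OF C(2)] by (meson order_trans)
        with C(3)[of i] \<delta> show False by linarith
      qed
      moreover have "hausdorff_weight k (C i \<inter> X) \<le> hausdorff_weight k (C i)" for X
        using C(2) by (intro hausdorff_weight_mono) auto
      moreover have "hausdorff_weight k ({} :: 'a set) = 0"
        by (simp add: hausdorff_weight_def)
      ultimately show ?thesis by auto
    qed
    have "hausdorff_content k \<delta> A + hausdorff_content k \<delta> B
      \<le> (\<Sum>i. hausdorff_weight k (C i \<inter> A)) + (\<Sum>i. hausdorff_weight k (C i \<inter> B))"
      by (intro add_mono le) auto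
    also have "\<dots> = (\<Sum>i. hausdorff_weight k (C i \<inter> A) + hausdorff_weight k (C i \<inter> B))"
      by (rule suminf_add) auto
    also have "\<dots> \<le> (\<Sum>i. hausdorff_weight k (C i))"
      by (intro suminf_le w) auto
    finally show "hausdorff_content k \<delta> A + hausdorff_content k \<delta> B
      \<le> (\<Sum>i. hausdorff_weight k (C i))" .
  qed
  have **: "hausdorff_content k \<delta> A + hausdorff_content k \<epsilon> B \<le> hausdorff_outer_measure k (A \<union> B)"
    if "\<delta> \<in> {0<..}" "\<epsilon> \<in> {0<..}" for \<delta> \<epsilon>
  proof -
    define r where "r = min (d/2) (min \<delta> \<epsilon>)"
    have r: "0 < r" "r < d" "r \<le> \<delta>" "r \<le> \<epsilon>" using d that by (auto simp: r_def)
    have "hausdorff_content k \<delta> A + hausdorff_content k \<epsilon> B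
      \<le> hausdorff_content k r A + hausdorff_content k r B"
      using r by (intro add_mono hausdorff_content_antimono)
    also have "\<dots> \<le> hausdorff_content k r (A \<union> B)" by (rule *) fact
    also have "\<dots> \<le> hausdorff_outer_measure k (A \<union> B)"
      unfolding hausdorff_outer_measure_def by (rule SUP_upper) (use r in simp)
    finally show ?thesis .
  qed
  have ne: "{0::real<..} \<noteq> {}" by auto
  have "(SUP \<delta>\<in>{0<..}. hausdorff_content k \<delta> A) + (SUP \<epsilon>\<in>{0<..}. hausdorff_content k \<epsilon> B)
    \<le> hausdorff_outer_measure k (A \<union> B)"
    unfolding ennreal_SUP_add_left[OF ne, symmetric]
    unfolding ennreal_SUP_add_right[OF ne]
    by (intro SUP_least **)
  then show ?thesis
    by (simp only: hausdorff_outer_measure_def[of k A] hausdorff_outer_measure_def[of k B])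
qed

lemma closed_in_lambda_system_hausdorff:
  fixes F :: "'a::metric_space set"
  assumes "closed F"
  shows "F \<in> lambda_system UNIV (Pow UNIV) (hausdorff_outer_measure k)"
proof -
  let ?\<mu> = "hausdorff_outer_measure k :: 'a set \<Rightarrow> ennreal"
  have le: "?\<mu> (A \<inter> F) + ?\<mu> (A - F) \<le> ?\<mu> A" if fin: "?\<mu> A \<noteq> top" and ne: "F \<noteq> {}" for A
  proof -
    define T where "T n = {x \<in> A. 1 / (real n + 1) < infdist x F}" for n
    define R where "R n = {x \<in> A. 1 / (real n + 2) < infdist x F \<and> infdist x F \<le> 1 / (real n + 1)}" for n
    have half: "(\<Sum>i<m. ?\<mu> (R (2 * i + c))) \<le> ?\<mu> (\<Union>i<m. R (2 * i + c))" for m c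
    proof (induction m)
      case (Suc m)
      show ?case
      proof (cases "m = 0")
        case False
        have "(\<Sum>i<Suc m. ?\<mu> (R (2 * i + c)))
            \<le> ?\<mu> (\<Union>i<m. R (2 * i + c)) + ?\<mu> (R (2 * m + c))"
          using Suc.IH by (simp add: add_right_mono)
        also have "\<dots> \<le> ?\<mu> ((\<Union>i<m. R (2 * i + c)) \<union> R (2 * m + c))"
        proof (rule hausdorff_outer_measure_separated)
          show "0 < 1 / real (2 * m + c) - 1 / (real (2 * m + c) + 1)"
            using False frac_less2[of 1 1 "real (2 * m + c)" "real (2 * m + c) + 1"] by simp
          fix x y assume x: "x \<in> (\<Union>i<m. R (2 * i + c))" and y: "y \<in> R (2 * m + c)"
          then obtain i where i: "i < m" "1 / (real (2 * i + c) + 2) < infdist x F"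
            by (auto simp: R_def)
          have "1 / real (2 * m + c) \<le> 1 / (real (2 * i + c) + 2)"
            using i(1) by (intro divide_left_mono) auto
          moreover have "infdist y F \<le> 1 / (real (2 * m + c) + 1)"
            using y by (simp add: R_def)
          ultimately show "1 / real (2 * m + c) - 1 / (real (2 * m + c) + 1) \<le> dist x y"
            using i(2) infdist_triangle[of x F y] by linarith
        qed
        also have "(\<Union>i<m. R (2 * i + c)) \<union> R (2 * m + c) = (\<Union>i<Suc m. R (2 * i + c))"
          by (auto simp: less_Suc_eq)
        finally show ?thesis .
      qed (simp add: lessThan_Suc)
    qed simp
    have half': "(\<Sum>i<m. ?\<mu> (R (2 * i + c))) \<le> ?\<mu> A" for m c
      by (rule order_trans[OF half hausdorff_outer_measure_mono]) (auto simp: R_def)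
    have "(\<Sum>n<m. ?\<mu> (R n)) \<le> ?\<mu> A + ?\<mu> A" for m
    proof -
      have "(\<Sum>n<m. ?\<mu> (R n)) \<le> (\<Sum>n<2*m. ?\<mu> (R n))"
        by (intro sum_mono2) auto
      also have "\<dots> = (\<Sum>i<m. ?\<mu> (R (2 * i + 0))) + (\<Sum>i<m. ?\<mu> (R (2 * i + 1)))"
        by (induction m) (auto simp: ac_simps)
      also have "\<dots> \<le> ?\<mu> A + ?\<mu> A" by (intro add_mono half')
      finally show ?thesis .
    qed
    then have "(\<Sum>n. ?\<mu> (R n)) \<le> ?\<mu> A + ?\<mu> A"
      by (subst suminf_eq_SUP) (rule SUP_least)
    then have total: "(\<Sum>n. ?\<mu> (R n)) \<noteq> top"
      using fin by (auto simp: top_unique)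
    have step: "(\<Sum>j<n. ?\<mu> (R j)) + (?\<mu> (A \<inter> F) + ?\<mu> (A - F)) \<le> ?\<mu> A + (\<Sum>j. ?\<mu> (R j))" for n
    proof -
      have tail: "(\<Sum>j. ?\<mu> (R (j + n))) + (\<Sum>j<n. ?\<mu> (R j)) \<le> (\<Sum>j. ?\<mu> (R j))"
      proof (intro ennreal_suminf_bound_add)
        fix N
        have "(\<Sum>j<N. ?\<mu> (R (j + n))) + (\<Sum>j<n. ?\<mu> (R j)) = (\<Sum>j<N + n. ?\<mu> (R j))"
          by (induction N) (auto simp: ac_simps)
        also have "\<dots> \<le> (\<Sum>j. ?\<mu> (R j))" by (rule sum_le_suminf) auto
        finally show "(\<Sum>j<N. ?\<mu> (R (j + n))) + (\<Sum>j<n. ?\<mu> (R j)) \<le> (\<Sum>j. ?\<mu> (R j))" .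
      qed
      have "A - F \<subseteq> T n \<union> (\<Union>j. R (j + n))"
      proof
        fix x assume x: "x \<in> A - F"
        then have pos: "infdist x F > 0"
          using assms ne infdist_pos_not_in_closed[of F x] by auto
        then obtain p where p: "inverse (real (Suc p)) < infdist x F"
          using reals_Archimedean by blast
        show "x \<in> T n \<union> (\<Union>j. R (j + n))"
        proof (cases "x \<in> T n")
          case False
          define q where "q = (LEAST q. inverse (real (Suc q)) < infdist x F)"
          have q: "inverse (real (Suc q)) < infdist x F"
            unfolding q_def by (rule LeastI) (rule p)
          have nq: "\<not> inverse (real (Suc r)) < infdist x F" if "r < q" for r
            using not_less_Least that unfolding q_def by blast
          have "n < q"
          proof (rule ccontr)
            assume "\<not> n < q"
            then have "inverse (real (Suc n)) \<le> inverse (real (Suc q))"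
              by (intro le_imp_inverse_le) auto
            with q have "1 / (real n + 1) < infdist x F"
              by (simp add: inverse_eq_divide add.commute)
            with False x show False by (simp add: T_def)
          qed
          then obtain j where j: "q = Suc (j + n)"
            by (metis add.commute less_imp_Suc_add)
          then have "x \<in> R (j + n)"
            using q nq[of "j + n"] x by (auto simp: R_def inverse_eq_divide not_less ac_simps)
          then show ?thesis by auto
        qed simp
      qed
      then have "?\<mu> (A - F) \<le> ?\<mu> (T n \<union> (\<Union>j. R (j + n)))"
        by (rule hausdorff_outer_measure_mono)
      also have "\<dots> \<le> ?\<mu> (T n) + ?\<mu> (\<Union>j. R (j + n))"
        by (rule hausdorff_outer_measure_Un_le)
      also have "\<dots> \<le> ?\<mu> (T n) + (\<Sum>j. ?\<mu> (R (j + n)))"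
        by (intro add_left_mono hausdorff_outer_measure_UN_le)
      finally have 1: "?\<mu> (A - F) \<le> ?\<mu> (T n) + (\<Sum>j. ?\<mu> (R (j + n)))" .
      have "?\<mu> (A \<inter> F) + ?\<mu> (T n) \<le> ?\<mu> ((A \<inter> F) \<union> T n)"
      proof (rule hausdorff_outer_measure_separated)
        show "0 < 1 / (real n + 1)" by simp
        fix x y assume "x \<in> A \<inter> F" "y \<in> T n"
        then show "1 / (real n + 1) \<le> dist x y"
          using infdist_le[of x F y] by (auto simp: T_def dist_commute)
      qed
      also have "\<dots> \<le> ?\<mu> A"
        by (rule hausdorff_outer_measure_mono) (auto simp: T_def)
      finally have 2: "?\<mu> (A \<inter> F) + ?\<mu> (T n) \<le> ?\<mu> A" .
      have "(\<Sum>j<n. ?\<mu> (R j)) + (?\<mu> (A \<inter> F) + ?\<mu> (A - F))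
          \<le> (\<Sum>j<n. ?\<mu> (R j)) + (?\<mu> (A \<inter> F) + (?\<mu> (T n) + (\<Sum>j. ?\<mu> (R (j + n)))))"
        by (intro add_left_mono 1)
      also have "\<dots> = (?\<mu> (A \<inter> F) + ?\<mu> (T n)) + ((\<Sum>j. ?\<mu> (R (j + n))) + (\<Sum>j<n. ?\<mu> (R j)))"
        by (simp add: ac_simps)
      also have "\<dots> \<le> ?\<mu> A + (\<Sum>j. ?\<mu> (R j))" by (intro add_mono 2 tail)
      finally show ?thesis .
    qed
    have "(\<Sum>j. ?\<mu> (R j)) + (?\<mu> (A \<inter> F) + ?\<mu> (A - F)) \<le> ?\<mu> A + (\<Sum>j. ?\<mu> (R j))"
      by (rule ennreal_suminf_bound_add) (rule step)
    then have "(\<Sum>j. ?\<mu> (R j)) + (?\<mu> (A \<inter> F) + ?\<mu> (A - F)) \<le> (\<Sum>j. ?\<mu> (R j)) + ?\<mu> A"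
      by (simp only: add.commute)
    then show ?thesis
      using total by (simp add: ennreal_add_left_cancel_le)
  qed
  have "?\<mu> (F \<inter> A) + ?\<mu> ((UNIV - F) \<inter> A) = ?\<mu> A" for A
  proof (rule antisym)
    show "?\<mu> (F \<inter> A) + ?\<mu> ((UNIV - F) \<inter> A) \<le> ?\<mu> A"
    proof (cases "?\<mu> A = top \<or> F = {}")
      case True
      then show ?thesis by (auto simp: hausdorff_outer_measure_empty)
    next
      case False
      then show ?thesis using le[of A] by (simp add: Int_commute Diff_eq)
    qed
    have "A = (F \<inter> A) \<union> ((UNIV - F) \<inter> A)" by auto
    then show "?\<mu> A \<le> ?\<mu> (F \<inter> A) + ?\<mu> ((UNIV - F) \<inter> A)"
      using hausdorff_outer_measure_Un_le by metis
  qed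
  then show ?thesis by (simp add: lambda_system_def)
qed

lemma measure_space_hausdorff:
  "measure_space UNIV (sets (borel :: 'a::metric_space measure)) (hausdorff_outer_measure k)"
proof (rule measure_down)
  let ?L = "lambda_system UNIV (Pow UNIV) (hausdorff_outer_measure k :: 'a set \<Rightarrow> ennreal)"
  show L: "measure_space UNIV ?L (hausdorff_outer_measure k)"
    by (rule sigma_algebra.caratheodory_lemma[OF sigma_algebra_Pow outer_measure_space_hausdorff])
  show "sigma_algebra UNIV (sets (borel :: 'a measure))"
    using sets.sigma_algebra_axioms[of "borel :: 'a measure"] by simp
  have "sigma_sets UNIV (Collect closed) \<subseteq> ?L"
    using L closed_in_lambda_system_hausdorff
    by (intro sigma_algebra.sigma_sets_subset) (auto simp: measure_space_def)
  then show "sets (borel :: 'a measure) \<subseteq> ?L"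
    by (simp add: borel_eq_closed)
qed

lemma emeasure_hausdorff_measure:
  assumes "A \<in> sets borel"
  shows "emeasure (hausdorff_measure k) A = hausdorff_outer_measure k A"
  using measure_space_hausdorff[of k] assms unfolding hausdorff_measure_def
  by (intro emeasure_measure_of_sigma) (auto simp: measure_space_def)


section \<open>Distributional derivatives\<close>

definition partial_derivative :: "'n \<Rightarrow> (real ^ 'n::finite \<Rightarrow> real) \<Rightarrow> real ^ 'n \<Rightarrow> real" where
  "partial_derivative i f x = frechet_derivative f (at x) (axis i 1)"

fun Ck :: "nat \<Rightarrow> (real ^ 'n::finite \<Rightarrow> real) \<Rightarrow> bool" where
  "Ck 0 f \<longleftrightarrow> continuous_on UNIV f"
| "Ck (Suc k) f \<longleftrightarrow> f differentiable_on UNIV \<and> (\<forall>i. Ck k (partial_derivative i f))"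

text \<open>\<open>C\<^sub>c\<^sup>\<infinity>(\<Omega>)\<close>, whose elements are extended by zero to the whole space.\<close>

definition test_functions :: "(real ^ 'n::finite) set \<Rightarrow> (real ^ 'n \<Rightarrow> real) set" where
  "test_functions \<Omega> =
     {\<phi>. (\<forall>k. Ck k \<phi>) \<and> compact (closure {x. \<phi> x \<noteq> 0}) \<and> closure {x. \<phi> x \<noteq> 0} \<subseteq> \<Omega>}"

text \<open>The value at \<open>\<phi>\<close> of the distribution \<open>\<partial>\<^sub>i f\<close>, for \<open>f\<close> locally integrable in \<open>\<Omega>\<close>.\<close>

definition distr_partial ::
    "(real ^ 'n::finite) set \<Rightarrow> 'n \<Rightarrow> (real ^ 'n \<Rightarrow> real) \<Rightarrow> (real ^ 'n \<Rightarrow> real) \<Rightarrow> real" where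
  "distr_partial \<Omega> i f \<phi> = - (LINT x|lebesgue_on \<Omega>. f x * partial_derivative i \<phi> x)"

definition distr_curl_free :: "(real ^ 'n::finite) set \<Rightarrow> (real ^ 'n \<Rightarrow> real ^ 'n) \<Rightarrow> bool" where
  "distr_curl_free \<Omega> u \<longleftrightarrow>
     (\<forall>j k. \<forall>\<phi> \<in> test_functions \<Omega>.
        distr_partial \<Omega> j (\<lambda>x. u x $ k) \<phi> = distr_partial \<Omega> k (\<lambda>x. u x $ j) \<phi>)"


section \<open>The kinetic formulation\<close>

definition kinetic_chi :: "('a \<Rightarrow> real ^ 'n::finite) \<Rightarrow> 'a \<Rightarrow> real ^ 'n \<Rightarrow> real" where
  "kinetic_chi u x \<xi> = (if u x \<bullet> \<xi> > 0 then 1 else 0)"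

definition kinetic_formulation :: "(real ^ 'n::finite) set \<Rightarrow> (real ^ 'n \<Rightarrow> real ^ 'n) \<Rightarrow> bool" where
  "kinetic_formulation \<Omega> u \<longleftrightarrow>
     (\<forall>\<xi> \<in> sphere 0 1. \<forall>v. v \<bullet> \<xi> = 0 \<longrightarrow>
        (\<forall>\<phi> \<in> test_functions \<Omega>.
           (\<Sum>i\<in>UNIV. v $ i * distr_partial \<Omega> i (\<lambda>x. kinetic_chi u x \<xi>) \<phi>) = 0))"

end

theory Submission
  imports Defs
begin

text \<open>
  For a unit vector \<open>w\<close> put \<open>F w = \<integral> \<xi> d\<H>\<close>, the integral being over the open half sphere
  \<open>w \<bullet> \<xi> > 0\<close>. The orthogonal map \<open>x \<mapsto> 2 (w \<bullet> x) w - x\<close> sends this half sphere to itself, so \<open>F w\<close>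
  is a multiple of \<open>w\<close>, and the factor is \<open>\<integral> max 0 (w \<bullet> \<xi>) d\<H>\<close>, half of \<open>\<integral> \<bar>w \<bullet> \<xi>\<bar> d\<H>\<close>. The latter
  is the same for all unit vectors \<open>w\<close>; averaging it over \<open>w\<close> in the unit ball and exchanging the
  integrals (\<open>nn_integral_sphere_abs_inner\<close>) expresses it by the total area of the sphere and
  by Lebesgue integrals over the ball. So the first claim comes down to the orthogonal invariance
  of the Hausdorff measure and to one number: the area of the unit sphere is \<open>N V\<^sub>N\<close>.

  With the Hausdorff measure defined by coverings, this number has two halves, each of which
  compares a covering with the volume of the thin shell \<open>1 - \<eta> \<le> \<bar>x\<bar> \<le> 1\<close>, asymptotically \<open>N V\<^sub>N \<eta>\<close>.

  Lower bound: a covering of the sphere by sets \<open>C\<close> of diameter \<open>d\<close> thickens radially to a covering of the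
  shell. The thickened piece \<open>Z\<close> has at most the volume of \<open>(Z - Z) / 2\<close>, by the Prekopa-Leindler
  inequality, and \<open>(Z - Z) / 2\<close> lies in a cylinder of radius about \<open>d / 2\<close> and height about \<open>\<eta>\<close>. This is where
  the isodiametric nature of the normalisation is used.

  Upper bound: by Vitali's theorem, disjoint small balls fill the shell up to a null set. The
  caps that these balls cut out of the sphere of radius \<open>r\<close> cover it except for its points in that null
  set. A cap of
  flat radius \<open>s\<close> has diameter at most \<open>2 s\<close>, hence weight at most \<open>V\<^sub>k s\<^sup>k\<close> with \<open>k = N - 1\<close>, and in the variable
  \<open>q = r\<^sup>2 / 2\<close> the weights of the caps of one ball integrate exactly to \<open>\<bar>a\<bar>\<close> times the volume of the
  ball, \<open>a\<close> being its centre. The null set is absorbed by a second family of balls of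
  arbitrarily small total volume, whose enlargements are estimated crudely.

  The second claim is linear in \<open>\<chi>\<close>: inserting the representation of \<open>u\<close> and exchanging integrals, the
  curl of \<open>u\<close> in the \<open>j\<close>-\<open>k\<close>-plane becomes the integral over \<open>\<xi>\<close> of \<open>v \<bullet> \<nabla> \<chi>(\<cdot>, \<xi>)\<close> with
  \<open>v = \<xi>\<^sub>k e\<^sub>j - \<xi>\<^sub>j e\<^sub>k\<close>, which is orthogonal to \<open>\<xi>\<close>.\<close>


section \<open>The Prekopa-Leindler inequality\<close>

text \<open>One-dimensional Brunn-Minkowski: for compact sets, the translate of \<open>K\<close> by the least point of \<open>L\<close> and
  the translate of \<open>L\<close> by the greatest point of \<open>K\<close> both lie in \<open>K + L\<close> and share only one point. Inner
  regularity gives the general case; the midpoint set enters only through a measurable superset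
  because \<open>A + B\<close> itself need not be a Borel set.\<close>

lemma emeasure_midpoint_real:
  fixes A B C :: "real set"
  assumes A: "A \<in> sets borel" "A \<noteq> {}" and B: "B \<in> sets borel" "B \<noteq> {}" and C: "C \<in> sets borel"
    and mid: "\<And>x y. x \<in> A \<Longrightarrow> y \<in> B \<Longrightarrow> (x + y) / 2 \<in> C"
  shows "emeasure lborel A + emeasure lborel B \<le> 2 * emeasure lborel C"
proof -
  have compact_case: "emeasure lborel K + emeasure lborel L \<le> 2 * emeasure lborel C"
    if K: "compact K" "K \<noteq> {}" "K \<subseteq> A" and L: "compact L" "L \<noteq> {}" "L \<subseteq> B" for K L
  proof -
    obtain a where a: "a \<in> K" "\<And>x. x \<in> K \<Longrightarrow> x \<le> a" using compact_attains_sup[OF K(1,2)] by auto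
    obtain b where b: "b \<in> L" "\<And>x. x \<in> L \<Longrightarrow> b \<le> x" using compact_attains_inf[OF L(1,2)] by auto
    have [measurable]: "K \<in> sets borel" "L \<in> sets borel" using K L by (auto intro: borel_compact)
    note C[measurable]
    have "emeasure lborel K + emeasure lborel L
        = (\<integral>\<^sup>+x. indicator K x \<partial>lborel) + (\<integral>\<^sup>+x. indicator L x \<partial>lborel)" by simp
    also have "(\<integral>\<^sup>+x. indicator K x \<partial>lborel) = 2 * (\<integral>\<^sup>+x. indicator K (2 * x - b) \<partial>lborel)"
      by (subst nn_integral_real_affine[where c = 2 and t = "-b"]) simp_all
    also have "(\<integral>\<^sup>+x. indicator L x \<partial>lborel) = 2 * (\<integral>\<^sup>+x. indicator L (2 * x - a) \<partial>lborel)"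
      by (subst nn_integral_real_affine[where c = 2 and t = "-a"]) simp_all
    also have "2 * (\<integral>\<^sup>+x. indicator K (2 * x - b) \<partial>lborel) + 2 * (\<integral>\<^sup>+x. indicator L (2 * x - a) \<partial>lborel)
        = 2 * (\<integral>\<^sup>+x. indicator K (2 * x - b) + indicator L (2 * x - a) \<partial>lborel)"
      by (subst nn_integral_add) (auto simp: distrib_left)
    also have "(\<integral>\<^sup>+x. indicator K (2 * x - b) + indicator L (2 * x - a) \<partial>lborel) \<le> (\<integral>\<^sup>+x. indicator C x \<partial>lborel)"
    proof (intro nn_integral_mono_AE)
      \<comment> \<open>The half-translates of \<open>K\<close> by \<open>b\<close> and of \<open>L\<close> by \<open>a\<close> meet at most at \<open>(a + b)/2\<close>.\<close>
      show "AE x in lborel. indicator K (2 * x - b) + indicator L (2 * x - a) \<le> (indicator C x :: ennreal)"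
        using AE_lborel_singleton[of "(a + b) / 2"]
      proof eventually_elim
        case (elim x)
        have "x \<in> C" if "2 * x - b \<in> K" using mid[of "2 * x - b" b] that K L b by auto
        moreover have "x \<in> C" if "2 * x - a \<in> L" using mid[of a "2 * x - a"] that K L a by auto
        moreover have "\<not> (2 * x - b \<in> K \<and> 2 * x - a \<in> L)"
          using a(2)[of "2 * x - b"] b(2)[of "2 * x - a"] elim by auto
        ultimately show ?case by (auto simp: indicator_def)
      qed
    qed
    also have "(\<integral>\<^sup>+x. indicator C x \<partial>lborel) = emeasure lborel C" by simp
    finally show ?thesis by (simp add: mult_left_mono)
  qed
  have inner: "emeasure lborel S = (SUP K\<in>{K. K \<subseteq> S \<and> compact K \<and> K \<noteq> {}}. emeasure lborel K)"
    if S: "S \<in> sets borel" "S \<noteq> {}" for S :: "real set"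
  proof (rule antisym)
    obtain s where s: "s \<in> S" using S by auto
    have "emeasure lborel S = (SUP n. emeasure lborel (S \<inter> {- real n..real n}))"
    proof -
      have "(\<Union>n. S \<inter> {- real n..real n}) = S"
      proof (safe)
        fix x assume "x \<in> S"
        moreover obtain n where "\<bar>x\<bar> \<le> real n" using real_arch_simple by blast
        ultimately show "x \<in> (\<Union>n. S \<inter> {- real n..real n})" by (auto intro!: exI[of _ n])
      qed
      then show ?thesis using S
        by (subst SUP_emeasure_incseq) (auto simp: incseq_def)
    qed
    also have "\<dots> \<le> (SUP K\<in>{K. K \<subseteq> S \<and> compact K \<and> K \<noteq> {}}. emeasure lborel K)"
    proof (rule SUP_least)
      fix n :: nat
      define M where "M = density lborel (indicator {- real n..real n} :: real \<Rightarrow> ennreal)"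
      have M: "sets M = sets borel" by (simp add: M_def)
      have eM: "emeasure M X = emeasure lborel (X \<inter> {- real n..real n})" if "X \<in> sets borel" for X
        unfolding M_def using that by (subst emeasure_density) (auto simp: indicator_inter_arith[symmetric] Int_commute)
      have "emeasure M S = (SUP K\<in>{K. K \<subseteq> S \<and> compact K}. emeasure M K)"
      proof (rule inner_regular[OF M _ S(1)])
        have "emeasure M (space M) \<le> emeasure lborel {- real n..real n}"
          using sets_eq_imp_space_eq[OF M] by (subst eM) auto
        then show "emeasure M (space M) \<noteq> \<infinity>" by (auto simp: top_unique)
      qed
      also have "\<dots> \<le> (SUP K\<in>{K. K \<subseteq> S \<and> compact K \<and> K \<noteq> {}}. emeasure lborel K)"
      proof (rule SUP_least)
        fix K assume K: "K \<in> {K. K \<subseteq> S \<and> compact K}"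
        then have "emeasure M K \<le> emeasure lborel (insert s K)"
          by (subst eM) (auto intro!: emeasure_mono borel_compact)
        also have "\<dots> \<le> (SUP K\<in>{K. K \<subseteq> S \<and> compact K \<and> K \<noteq> {}}. emeasure lborel K)"
          using K s by (intro SUP_upper) auto
        finally show "emeasure M K \<le> \<dots>" .
      qed
      finally show "emeasure lborel (S \<inter> {- real n..real n}) \<le> \<dots>" using S by (simp add: eM)
    qed
    finally show "emeasure lborel S \<le> \<dots>" .
  qed (use S in \<open>auto intro!: SUP_least emeasure_mono\<close>)
  have neA: "{K. K \<subseteq> A \<and> compact K \<and> K \<noteq> {}} \<noteq> {}" using A by (auto intro!: exI[of _ "{SOME a. a \<in> A}"] simp: some_in_eq)
  have neB: "{K. K \<subseteq> B \<and> compact K \<and> K \<noteq> {}} \<noteq> {}" using B by (auto intro!: exI[of _ "{SOME a. a \<in> B}"] simp: some_in_eq)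
  show ?thesis
    unfolding inner[OF A] inner[OF B] ennreal_SUP_add_left[OF neA, symmetric]
    unfolding ennreal_SUP_add_right[OF neB]
    by (intro SUP_least compact_case) auto
qed

text \<open>Levels are scaled by \<open>c\<close> so that functions with different suprema can be compared level by level over
  the common range \<open>0 < t < 1\<close>.\<close>

lemma nn_integral_layer_cake_bounded:
  fixes f :: "real \<Rightarrow> ennreal"
  assumes f[measurable]: "f \<in> borel_measurable borel" and c: "c > 0"
  shows "(\<integral>\<^sup>+t. indicator {0<..<1} t * emeasure lborel {x. ennreal (c * t) < f x} \<partial>lborel) * ennreal c
    = (\<integral>\<^sup>+x. min (f x) (ennreal c) \<partial>lborel)"
proof -
  have inner: "(\<integral>\<^sup>+t. indicator {0<..<1} t * indicator {x. ennreal (c * t) < f x} x \<partial>lborel) * ennreal c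
      = min (f x) (ennreal c)" for x
  proof (cases "f x < ennreal c")
    case True
    then obtain r where r: "f x = ennreal r" "0 \<le> r" "r < c"
      using c by (cases "f x") (auto simp: ennreal_less_iff)
    have "(\<integral>\<^sup>+t. indicator {0<..<1} t * indicator {x. ennreal (c * t) < f x} x \<partial>lborel)
        = (\<integral>\<^sup>+t. indicator {0<..<r / c} t \<partial>lborel)"
    proof (rule nn_integral_cong)
      fix t
      show "indicator {0<..<1} t * indicator {x. ennreal (c * t) < f x} x = (indicator {0<..<r / c} t :: ennreal)"
      proof (cases "0 < t")
        case t: True
        have "t < 1" if "t < r / c" using that r c by (smt (verit) divide_less_eq_1)
        moreover have "ennreal (c * t) < f x \<longleftrightarrow> t < r / c"
          using r c t by (simp add: ennreal_less_iff field_simps)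
        ultimately show ?thesis using t by (auto simp: indicator_def)
      qed (auto simp: indicator_def)
    qed
    then show ?thesis using r c True by (simp add: ennreal_mult[symmetric] min_def)
  next
    case False
    have "(\<integral>\<^sup>+t. indicator {0<..<1} t * indicator {x. ennreal (c * t) < f x} x \<partial>lborel)
        = (\<integral>\<^sup>+t. indicator {0<..<1} (t::real) \<partial>lborel)"
    proof (rule nn_integral_cong)
      fix t :: real
      have "ennreal (c * t) < f x" if "0 < t" "t < 1"
      proof -
        have "ennreal (c * t) < ennreal c" using that c by (simp add: ennreal_less_iff)
        with False show ?thesis by auto
      qed
      then show "indicator {0<..<1} t * indicator {x. ennreal (c * t) < f x} x = (indicator {0<..<1} t :: ennreal)"
        by (auto simp: indicator_def)
    qed
    then show ?thesis using False by (auto simp: min_def)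
  qed
  have "(\<integral>\<^sup>+t. indicator {0<..<1} t * emeasure lborel {x. ennreal (c * t) < f x} \<partial>lborel)
      = (\<integral>\<^sup>+t. \<integral>\<^sup>+x. indicator {0<..<1} t * indicator {x. ennreal (c * t) < f x} x \<partial>lborel \<partial>lborel)"
    by (intro nn_integral_cong) (subst nn_integral_cmult, auto)
  also have "\<dots> = (\<integral>\<^sup>+x. \<integral>\<^sup>+t. indicator {0<..<1} t * indicator {x. ennreal (c * t) < f x} x \<partial>lborel \<partial>lborel)"
    by (rule lborel_pair.Fubini'[symmetric]) (simp add: indicator_def[of "{x. _ x}"] case_prod_beta)
  finally show ?thesis
    by (simp add: nn_integral_multc[symmetric] inner)
qed

lemma ennreal_mult_strict_mono:
  fixes a b c d :: ennreal
  assumes "a < b" "c < d"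
  shows "a * c < b * d"
proof (cases "b = top \<or> d = top")
  case True
  have "b \<noteq> 0" "d \<noteq> 0" using assms by auto
  then have "b * d = top" using True by (auto simp: ennreal_mult_top ennreal_top_mult)
  moreover have "a * c < top" using assms by (metis ennreal_mult_less_top less_top not_less_iff_gr_or_eq order.strict_trans top_greatest linorder_not_le)
  ultimately show ?thesis by simp
next
  case False
  with assms show ?thesis
    by (cases a; cases b; cases c; cases d)
       (auto simp: ennreal_mult[symmetric] ennreal_less_iff intro!: mult_strict_mono)
qed

lemma ennreal_amgm: "4 * (x * y) \<le> (x + y) ^ 2" for x y :: ennreal
proof (cases x; cases y)
  fix r s :: real assume "0 \<le> r" "x = ennreal r" "0 \<le> s" "y = ennreal s"
  moreover have "4 * (r * s) \<le> (r + s)\<^sup>2" using sum_squares_bound[of r s] by (simp add: power2_sum)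
  ultimately show ?thesis
    by (simp add: ennreal_mult[symmetric] ennreal_power ennreal_plus[symmetric] ennreal_numeral[symmetric] del: ennreal_numeral ennreal_plus)
qed (auto simp: power2_eq_square ennreal_mult_top ennreal_top_mult)

text \<open>After normalising both functions by their suprema \<open>a\<close> and \<open>b\<close>, superlevel sets at the same relative
  height are nonempty and \<open>emeasure_midpoint_real\<close> applies to them; the arithmetic mean that results is
  at least the geometric mean. Squaring the hypothesis and the conclusion avoids square roots of
  extended reals. Truncation reduces to the case of finite suprema.\<close>

lemma prekopa_leindler_real:
  fixes f g h :: "real \<Rightarrow> ennreal"
  assumes [measurable]: "f \<in> borel_measurable borel" "g \<in> borel_measurable borel" "h \<in> borel_measurable borel"
    and mid: "\<And>x y. f x * g y \<le> (h ((x + y) / 2))\<^sup>2"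
  shows "integral\<^sup>N lborel f * integral\<^sup>N lborel g \<le> (integral\<^sup>N lborel h)\<^sup>2"
proof -
  have bounded: "integral\<^sup>N lborel f * integral\<^sup>N lborel g \<le> (integral\<^sup>N lborel h)\<^sup>2"
    if [measurable]: "f \<in> borel_measurable borel" "g \<in> borel_measurable borel"
      and mid: "\<And>x y. f x * g y \<le> (h ((x + y) / 2))\<^sup>2"
      and fin: "(SUP x. f x) < top" "(SUP x. g x) < top" for f g :: "real \<Rightarrow> ennreal"
  proof (cases "(SUP x. f x) = 0 \<or> (SUP x. g x) = 0")
    case True
    then have "(\<forall>x. f x = 0) \<or> (\<forall>x. g x = 0)" by (auto simp: SUP_eq_iff)
    then have "f = (\<lambda>_. 0) \<or> g = (\<lambda>_. 0)" by auto
    then show ?thesis by (elim disjE) simp_all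
  next
    case False
    obtain a where a: "(SUP x. f x) = ennreal a" "a > 0"
      using False fin by (cases "SUP x. f x") auto
    obtain b where b: "(SUP x. g x) = ennreal b" "b > 0"
      using False fin by (cases "SUP x. g x") auto
    define c where "c = sqrt (a * b)"
    have c: "c > 0" "c * c = a * b" using a b by (auto simp: c_def)
    let ?X = "\<integral>\<^sup>+t. indicator {0<..<1} t * emeasure lborel {x. ennreal (a * t) < f x} \<partial>lborel"
    let ?Y = "\<integral>\<^sup>+t. indicator {0<..<1} t * emeasure lborel {x. ennreal (b * t) < g x} \<partial>lborel"
    let ?Z = "\<integral>\<^sup>+t. indicator {0<..<1} t * emeasure lborel {x. ennreal (c * t) < h x} \<partial>lborel"
    have "min (f x) (ennreal a) = f x" for x unfolding a(1)[symmetric] by (intro min_absorb1 SUP_upper) auto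
    then have F: "integral\<^sup>N lborel f = ?X * ennreal a"
      using nn_integral_layer_cake_bounded[of f a] a by simp
    have "min (g x) (ennreal b) = g x" for x unfolding b(1)[symmetric] by (intro min_absorb1 SUP_upper) auto
    then have G: "integral\<^sup>N lborel g = ?Y * ennreal b"
      using nn_integral_layer_cake_bounded[of g b] b by simp
    have "?Z * ennreal c = (\<integral>\<^sup>+x. min (h x) (ennreal c) \<partial>lborel)"
      by (rule nn_integral_layer_cake_bounded) (use c in auto)
    also have "\<dots> \<le> integral\<^sup>N lborel h" by (intro nn_integral_mono) auto
    finally have H: "?Z * ennreal c \<le> integral\<^sup>N lborel h" .
    have "?X + ?Y = (\<integral>\<^sup>+t. indicator {0<..<1} t * (emeasure lborel {x. ennreal (a * t) < f x} + emeasure lborel {x. ennreal (b * t) < g x}) \<partial>lborel)"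
      unfolding distrib_left by (rule nn_integral_add[symmetric]) (auto)
    also have "\<dots> \<le> (\<integral>\<^sup>+t. 2 * (indicator {0<..<1} t * emeasure lborel {x. ennreal (c * t) < h x}) \<partial>lborel)"
    proof (rule nn_integral_mono)
      fix t :: real
      have "emeasure lborel {x. ennreal (a * t) < f x} + emeasure lborel {x. ennreal (b * t) < g x}
          \<le> 2 * emeasure lborel {x. ennreal (c * t) < h x}" if t: "0 < t" "t < 1"
      proof (rule emeasure_midpoint_real)
        have "ennreal (a * t) < (SUP x. f x)" using a t by (simp add: ennreal_less_iff)
        then show "{x. ennreal (a * t) < f x} \<noteq> {}" by (auto simp: less_SUP_iff)
        have "ennreal (b * t) < (SUP x. g x)" using b t by (simp add: ennreal_less_iff)
        then show "{x. ennreal (b * t) < g x} \<noteq> {}" by (auto simp: less_SUP_iff)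
        fix x y assume "x \<in> {x. ennreal (a * t) < f x}" "y \<in> {x. ennreal (b * t) < g x}"
        then have "ennreal (a * t) * ennreal (b * t) < f x * g y"
          by (intro ennreal_mult_strict_mono) auto
        also have "\<dots> \<le> (h ((x + y) / 2))\<^sup>2" by (rule mid)
        also have "ennreal (a * t) * ennreal (b * t) = (ennreal (c * t))\<^sup>2"
          using c a b t by (simp add: ennreal_power ennreal_mult[symmetric] power2_eq_square algebra_simps)
        finally have "ennreal (c * t) < h ((x + y) / 2)"
          by (meson linorder_not_less power_mono zero_le)
        then show "(x + y) / 2 \<in> {x. ennreal (c * t) < h x}" by simp
      qed auto
      then show "indicator {0<..<1} t * (emeasure lborel {x. ennreal (a * t) < f x} + emeasure lborel {x. ennreal (b * t) < g x})
          \<le> 2 * (indicator {0<..<1} t * emeasure lborel {x. ennreal (c * t) < h x})"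
        by (auto simp: indicator_def)
    qed
    also have "\<dots> = 2 * ?Z" by (rule nn_integral_cmult) auto
    finally have XYZ: "?X + ?Y \<le> 2 * ?Z" .
    have "4 * (?X * ?Y) \<le> (?X + ?Y)\<^sup>2" by (rule ennreal_amgm)
    also have "\<dots> \<le> (2 * ?Z)\<^sup>2" by (intro power_mono XYZ) auto
    also have "\<dots> = 4 * ?Z\<^sup>2" by (simp add: power_mult_distrib)
    finally have "?X * ?Y \<le> ?Z\<^sup>2" by (simp add: ennreal_mult_le_mult_iff)
    then have "?X * ?Y * ennreal (a * b) \<le> ?Z\<^sup>2 * ennreal (c * c)" unfolding c(2) by (rule mult_right_mono) simp
    moreover have "ennreal (c * c) = ennreal c * ennreal c" "ennreal (a * b) = ennreal a * ennreal b"
      using a(2) b(2) c(1) by (simp_all add: ennreal_mult)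
    ultimately have "integral\<^sup>N lborel f * integral\<^sup>N lborel g \<le> (?Z * ennreal c)\<^sup>2"
      unfolding F G power2_eq_square by (simp only: mult_ac)
    also have "\<dots> \<le> (integral\<^sup>N lborel h)\<^sup>2" by (intro power_mono H) auto
    finally show ?thesis .
  qed
  have trunc: "integral\<^sup>N lborel f' = (SUP n. \<integral>\<^sup>+x. min (f' x) (of_nat n) \<partial>lborel)"
    if [measurable]: "f' \<in> borel_measurable borel" for f' :: "real \<Rightarrow> ennreal"
  proof -
    have "(SUP n. min y (of_nat n)) = y" for y :: ennreal
    proof (cases y)
      case (real r)
      obtain n where "r \<le> real n" using real_arch_simple by blast
      then have "y \<le> of_nat n" using real by (simp add: ennreal_of_nat_eq_real_of_nat ennreal_leI)
      then have "y \<le> (SUP n. min y (of_nat n))" by (intro SUP_upper2[of n]) auto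
      then show ?thesis by (intro antisym SUP_least) auto
    next
      case top
      then show ?thesis by (simp add: min_def top_unique ennreal_SUP_of_nat_eq_top)
    qed
    then have "integral\<^sup>N lborel f' = (\<integral>\<^sup>+x. (SUP n. min (f' x) (of_nat n)) \<partial>lborel)" by simp
    also have "\<dots> = (SUP n. \<integral>\<^sup>+x. min (f' x) (of_nat n) \<partial>lborel)"
      by (rule nn_integral_monotone_convergence_SUP) (auto simp: incseq_def le_fun_def intro: min.coboundedI2)
    finally show ?thesis .
  qed
  have "(\<integral>\<^sup>+x. min (f x) (of_nat n) \<partial>lborel) * (\<integral>\<^sup>+x. min (g x) (of_nat m) \<partial>lborel) \<le> (integral\<^sup>N lborel h)\<^sup>2" for n m
  proof (rule bounded)
    show "min (f x) (of_nat n) * min (g y) (of_nat m) \<le> (h ((x + y) / 2))\<^sup>2" for x y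
      by (rule order_trans[OF mult_mono mid]) auto
    have "(SUP x. min (f x) (of_nat n)) \<le> of_nat n" by (auto intro: SUP_least)
    also have "\<dots> < top" by (simp add: less_top[symmetric])
    finally show "(SUP x. min (f x) (of_nat n)) < top" .
    have "(SUP x. min (g x) (of_nat m)) \<le> of_nat m" by (auto intro: SUP_least)
    also have "\<dots> < top" by (simp add: less_top[symmetric])
    finally show "(SUP x. min (g x) (of_nat m)) < top" .
  qed auto
  then show ?thesis
    by (subst trunc[of f], simp, subst trunc[of g], simp)
       (auto simp: SUP_mult_left_ennreal SUP_mult_right_ennreal intro!: SUP_least)
qed

text \<open>Induction on the dimension: integrating out one coordinate preserves the hypothesis, by the
  one-dimensional case. Index sets instead of types make the induction possible.\<close>

lemma prekopa_leindler_PiM: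
  fixes f g h :: "('i \<Rightarrow> real) \<Rightarrow> ennreal"
  assumes "finite I"
    and "f \<in> borel_measurable (Pi\<^sub>M I (\<lambda>_. lborel))" "g \<in> borel_measurable (Pi\<^sub>M I (\<lambda>_. lborel))"
      "h \<in> borel_measurable (Pi\<^sub>M I (\<lambda>_. lborel))"
    and "\<And>x y. x \<in> extensional I \<Longrightarrow> y \<in> extensional I \<Longrightarrow> f x * g y \<le> (h (\<lambda>i\<in>I. (x i + y i) / 2))\<^sup>2"
  shows "integral\<^sup>N (Pi\<^sub>M I (\<lambda>_. lborel)) f * integral\<^sup>N (Pi\<^sub>M I (\<lambda>_. lborel)) g
    \<le> (integral\<^sup>N (Pi\<^sub>M I (\<lambda>_. lborel)) h)\<^sup>2"
  using assms
proof (induction arbitrary: f g h rule: finite_induct)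
  case empty
  interpret product_sigma_finite "\<lambda>_::'i. lborel :: real measure" by standard
  show ?case using empty(4)[of "\<lambda>_. undefined" "\<lambda>_. undefined"]
    by (simp add: nn_integral_empty restrict_def)
next
  case (insert i I)
  interpret product_sigma_finite "\<lambda>_::'i. lborel :: real measure" by standard
  note [measurable] = insert.prems(1-3)
  have slice: "(\<lambda>t. F (x(i := t))) \<in> borel_measurable borel"
    if [measurable]: "F \<in> borel_measurable (Pi\<^sub>M (insert i I) (\<lambda>_. lborel))" and x: "x \<in> extensional I"
    for F :: "('i \<Rightarrow> real) \<Rightarrow> ennreal" and x
  proof -
    have x': "x \<in> space (Pi\<^sub>M I (\<lambda>_. lborel :: real measure))"
      using x by (simp add: space_PiM PiE_def)
    show ?thesis
      using measurable_comp[OF measurable_component_update that(1), OF x' insert.hyps(2)]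
      by (simp add: comp_def fun_upd_def)
  qed
  have meas: "(\<lambda>x. \<integral>\<^sup>+t. F (x(i := t)) \<partial>lborel) \<in> borel_measurable (Pi\<^sub>M I (\<lambda>_. lborel))"
    if [measurable]: "F \<in> borel_measurable (Pi\<^sub>M (insert i I) (\<lambda>_. lborel))" for F :: "('i \<Rightarrow> real) \<Rightarrow> ennreal"
    by measurable
  show ?case
    unfolding product_nn_integral_insert[OF insert.hyps insert.prems(1)]
      product_nn_integral_insert[OF insert.hyps insert.prems(2)]
      product_nn_integral_insert[OF insert.hyps insert.prems(3)]
  proof (rule insert.IH)
    fix x y :: "'i \<Rightarrow> real" assume xy: "x \<in> extensional I" "y \<in> extensional I"
    show "(\<integral>\<^sup>+t. f (x(i := t)) \<partial>lborel) * (\<integral>\<^sup>+t. g (y(i := t)) \<partial>lborel)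
       \<le> (\<integral>\<^sup>+t. h ((\<lambda>i\<in>I. (x i + y i) / 2)(i := t)) \<partial>lborel)\<^sup>2"
    proof (rule prekopa_leindler_real)
      fix s t :: real
      have "f (x(i := s)) * g (y(i := t)) \<le> (h (\<lambda>j\<in>insert i I. ((x(i := s)) j + (y(i := t)) j) / 2))\<^sup>2"
        using xy by (intro insert.prems(4)) (auto simp: extensional_def)
      also have "(\<lambda>j\<in>insert i I. ((x(i := s)) j + (y(i := t)) j) / 2) = (\<lambda>i\<in>I. (x i + y i) / 2)(i := (s + t) / 2)"
        by (auto simp: fun_eq_iff)
      finally show "f (x(i := s)) * g (y(i := t)) \<le> (h ((\<lambda>i\<in>I. (x i + y i) / 2)(i := (s + t) / 2)))\<^sup>2" .
    qed (intro slice xy insert.prems; simp add: extensional_def)+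
  qed (intro meas insert.prems)+
qed

lemma lborel_distr_uminus_euclidean: "distr lborel borel (uminus :: 'a \<Rightarrow> 'a::euclidean_space) = lborel"
proof -
  have "lborel = density (distr lborel borel (\<lambda>x::'a. 0 + (-1) *\<^sub>R x)) (\<lambda>_. 1)"
    using lborel_affine[of "-1 :: real" "0 :: 'a"] by simp
  then show ?thesis by (simp add: density_1)
qed

text \<open>The Prekopa-Leindler inequality for the indicators of \<open>A\<close>, \<open>- A\<close> and \<open>W\<close>, where \<open>A\<close> and \<open>- A\<close> have the same
  volume.\<close>

lemma emeasure_le_difference_body:
  fixes A W :: "'a::euclidean_space set"
  assumes A[measurable]: "A \<in> sets borel" and W[measurable]: "W \<in> sets borel"
    and mid: "\<And>x y. x \<in> A \<Longrightarrow> y \<in> A \<Longrightarrow> (1/2) *\<^sub>R (x - y) \<in> W"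
    and fin: "emeasure lborel A < \<infinity>"
  shows "emeasure lborel A \<le> emeasure lborel W"
proof -
  let ?P = "Pi\<^sub>M Basis (\<lambda>_. lborel) :: ('a \<Rightarrow> real) measure"
  let ?s = "\<lambda>f. \<Sum>b\<in>Basis. f b *\<^sub>R b :: 'a"
  have tr: "integral\<^sup>N lborel F = (\<integral>\<^sup>+f. F (?s f) \<partial>?P)"
    if [measurable]: "F \<in> borel_measurable borel" for F :: "'a \<Rightarrow> ennreal"
    by (subst lborel_eq) (subst nn_integral_distr, auto)
  have uminus: "emeasure lborel (uminus -` A) = emeasure lborel A"
  proof -
    have "emeasure lborel A = emeasure (distr lborel borel (uminus :: 'a \<Rightarrow> 'a)) A"
      by (simp add: lborel_distr_uminus_euclidean)
    then show ?thesis by (simp add: emeasure_distr)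
  qed
  have "uminus -` A \<inter> space borel \<in> sets borel" by measurable
  then have [measurable]: "uminus -` A \<in> sets borel" by simp
  have "(\<integral>\<^sup>+f. indicator A (?s f) \<partial>?P) * (\<integral>\<^sup>+f. indicator (uminus -` A) (?s f) \<partial>?P) \<le> (\<integral>\<^sup>+f. indicator W (?s f) \<partial>?P)\<^sup>2"
  proof (rule prekopa_leindler_PiM)
    fix x y :: "'a \<Rightarrow> real"
    have "?s (\<lambda>i\<in>Basis. (x i + y i) / 2) = (1/2) *\<^sub>R (?s x - (- ?s y))"
      by (simp add: scaleR_sum_right sum.distrib[symmetric] scaleR_add_left[symmetric] add_divide_distrib)
    then show "indicator A (?s x) * indicator (uminus -` A) (?s y)
        \<le> (indicator W (?s (\<lambda>i\<in>Basis. (x i + y i) / 2)) :: ennreal)\<^sup>2"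
      using mid[of "?s x" "- ?s y"] by (auto simp: indicator_def)
  qed auto
  then have sq: "(emeasure lborel A)\<^sup>2 \<le> (emeasure lborel W)\<^sup>2"
    using tr[of "indicator A"] tr[of "indicator (uminus -` A)"] tr[of "indicator W"]
    by (simp add: uminus power2_eq_square)
  show ?thesis
  proof (rule ccontr)
    assume "\<not> ?thesis"
    then have "emeasure lborel W < emeasure lborel A" by simp
    then have "emeasure lborel W * emeasure lborel W < emeasure lborel A * emeasure lborel A"
      by (intro ennreal_mult_strict_mono)
    with sq show False by (simp add: power2_eq_square)
  qed
qed


section \<open>Slices of Lebesgue measure and orthogonal invariance\<close>

text \<open>Fubini's theorem for hyperplanes orthogonal to a coordinate vector. The hyperplane is
  parametrised by functions on the other basis vectors, which are a model of the space of
  dimension \<open>DIM('a) - 1\<close> that does not call for a new type.\<close>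

lemma nn_integral_lborel_slice:
  fixes F :: "'a::euclidean_space \<Rightarrow> ennreal"
  assumes e: "e \<in> Basis" and F[measurable]: "F \<in> borel_measurable borel"
  shows "integral\<^sup>N lborel F = (\<integral>\<^sup>+t. \<integral>\<^sup>+y. F (t *\<^sub>R e + (\<Sum>b\<in>Basis - {e}. y b *\<^sub>R b))
    \<partial>Pi\<^sub>M (Basis - {e}) (\<lambda>_. lborel) \<partial>lborel)"
proof -
  interpret product_sigma_finite "\<lambda>_::'a. lborel :: real measure" by standard
  have B: "Basis = insert e (Basis - {e})" using e by auto
  have "integral\<^sup>N lborel F = (\<integral>\<^sup>+f. F (\<Sum>b\<in>Basis. f b *\<^sub>R b) \<partial>Pi\<^sub>M Basis (\<lambda>_. lborel))"
    by (subst lborel_eq) (subst nn_integral_distr, auto)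
  also have "\<dots> = (\<integral>\<^sup>+f. F (\<Sum>b\<in>Basis. f b *\<^sub>R b) \<partial>Pi\<^sub>M (insert e (Basis - {e})) (\<lambda>_. lborel))"
    using B by simp
  also have "\<dots> = (\<integral>\<^sup>+t. \<integral>\<^sup>+y. F (\<Sum>b\<in>Basis. (y(e := t)) b *\<^sub>R b)
    \<partial>Pi\<^sub>M (Basis - {e}) (\<lambda>_. lborel) \<partial>lborel)"
    by (rule product_nn_integral_insert_rev) (use B in auto)
  finally have *: "integral\<^sup>N lborel F = \<dots>" .
  have "(\<Sum>b\<in>Basis. (y(e := t)) b *\<^sub>R b) = t *\<^sub>R e + (\<Sum>b\<in>Basis - {e}. y b *\<^sub>R b)" for y t
    using e by (subst sum.remove[of _ e]) auto
  then show ?thesis unfolding * by (simp only:)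
qed

lemma norm_slice_sum:
  assumes e: "e \<in> (Basis :: 'a::euclidean_space set)"
  shows "norm (\<Sum>b\<in>Basis - {e}. y b *\<^sub>R b) = sqrt (\<Sum>b\<in>Basis - {e}. (y b)\<^sup>2)"
  and "(\<Sum>b\<in>Basis - {e}. y b *\<^sub>R b) \<bullet> e = 0"
proof -
  let ?s = "\<Sum>b\<in>Basis - {e}. y b *\<^sub>R b"
  have c: "?s \<bullet> c = (if c = e then 0 else y c)" if "c \<in> Basis" for c
    using that e by (auto simp: inner_sum_left inner_Basis if_distrib sum.delta cong: if_cong)
  then show "?s \<bullet> e = 0" using e by simp
  have "norm ?s = sqrt (\<Sum>c\<in>Basis. (?s \<bullet> c)\<^sup>2)"
    unfolding norm_eq_sqrt_inner by (subst euclidean_inner) (simp only: power2_eq_square)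
  also have "(\<Sum>c\<in>Basis. (?s \<bullet> c)\<^sup>2) = (\<Sum>c\<in>Basis - {e}. (y c)\<^sup>2)"
    using e by (subst sum.remove[of _ e]) (auto simp: c)
  finally show "norm ?s = sqrt (\<Sum>b\<in>Basis - {e}. (y b)\<^sup>2)" .
qed

text \<open>The radius \<open>0\<close> is reached as a limit of positive radii.\<close>

lemma emeasure_slice_ball:
  fixes e :: "'a::euclidean_space"
  assumes e: "e \<in> Basis" and r: "r \<ge> 0" and D: "DIM('a) \<ge> 2"
  shows "(\<integral>\<^sup>+y. indicator {..r} (norm (\<Sum>b\<in>Basis - {e}. y b *\<^sub>R b)) \<partial>Pi\<^sub>M (Basis - {e}) (\<lambda>_. lborel))
    = ennreal (unit_ball_vol (real (DIM('a) - 1)) * r ^ (DIM('a) - 1))"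
proof -
  let ?M = "Pi\<^sub>M (Basis - {e}) (\<lambda>_. lborel :: real measure)"
  have card: "card (Basis - {e}) = DIM('a) - 1" using e by simp
  have eq: "(\<integral>\<^sup>+y. indicator {..s} (norm (\<Sum>b\<in>Basis - {e}. y b *\<^sub>R b)) \<partial>?M)
      = ennreal (unit_ball_vol (real (DIM('a) - 1)) * s ^ (DIM('a) - 1))" if "s > 0" for s
  proof -
    have "(\<integral>\<^sup>+y. indicator {..s} (norm (\<Sum>b\<in>Basis - {e}. y b *\<^sub>R b)) \<partial>?M)
      = (\<integral>\<^sup>+y. indicator ({f. sqrt (\<Sum>i\<in>Basis - {e}. (f i)\<^sup>2) \<le> s} \<inter> space ?M) y \<partial>?M)"
      by (intro nn_integral_cong) (auto simp: norm_slice_sum(1)[OF e] indicator_def)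
    also have "\<dots> = emeasure ?M ({f. sqrt (\<Sum>i\<in>Basis - {e}. (f i)\<^sup>2) \<le> s} \<inter> space ?M)"
      by (rule nn_integral_indicator) measurable
    finally show ?thesis using emeasure_cball_aux[of "Basis - {e}" s] that card by simp
  qed
  show ?thesis
  proof (cases "r = 0")
    case False
    then show ?thesis using eq[of r] r by simp
  next
    case True
    let ?c = "unit_ball_vol (real (DIM('a) - 1))"
    have c: "?c > 0" by simp
    have "(\<integral>\<^sup>+y. indicator {..0} (norm (\<Sum>b\<in>Basis - {e}. y b *\<^sub>R b)) \<partial>?M) \<le> 0"
    proof (rule ennreal_le_epsilon)
      fix x :: real assume x: "x > 0"
      define s where "s = min 1 (x / ?c)"
      have s: "s > 0" "s \<le> 1" "s \<le> x / ?c" using x c by (auto simp: s_def)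
      have "(\<integral>\<^sup>+y. indicator {..0} (norm (\<Sum>b\<in>Basis - {e}. y b *\<^sub>R b)) \<partial>?M)
        \<le> (\<integral>\<^sup>+y. indicator {..s} (norm (\<Sum>b\<in>Basis - {e}. y b *\<^sub>R b)) \<partial>?M)"
        using s by (intro nn_integral_mono) (auto simp: indicator_def)
      also have "\<dots> = ennreal (?c * s ^ (DIM('a) - 1))" by (rule eq) fact
      also have "?c * s ^ (DIM('a) - 1) \<le> ?c * s ^ 1"
        using s c D by (intro mult_left_mono power_decreasing) auto
      also have "?c * s ^ 1 \<le> x" using s c by (simp add: field_simps)
      finally show "(\<integral>\<^sup>+y. indicator {..0} (norm (\<Sum>b\<in>Basis - {e}. y b *\<^sub>R b)) \<partial>?M) \<le> 0 + ennreal x"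
        by (simp add: ennreal_leI)
    qed
    then show ?thesis using True D by simp
  qed
qed

lemma norm_add_slice:
  fixes e :: "'a::euclidean_space"
  assumes e: "e \<in> Basis"
  shows "(norm (t *\<^sub>R e + (\<Sum>b\<in>Basis - {e}. y b *\<^sub>R b)))\<^sup>2 = t\<^sup>2 + (norm (\<Sum>b\<in>Basis - {e}. y b *\<^sub>R b))\<^sup>2"
    "(t *\<^sub>R e + (\<Sum>b\<in>Basis - {e}. y b *\<^sub>R b)) \<bullet> e = t"
proof -
  show "(norm (t *\<^sub>R e + (\<Sum>b\<in>Basis - {e}. y b *\<^sub>R b)))\<^sup>2 = t\<^sup>2 + (norm (\<Sum>b\<in>Basis - {e}. y b *\<^sub>R b))\<^sup>2"
  proof -
    have 0: "e \<bullet> (\<Sum>b\<in>Basis - {e}. y b *\<^sub>R b) = 0"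
      using norm_slice_sum(2)[OF e, of y] by (simp only: inner_commute)
    show ?thesis using e
      unfolding power2_norm_eq_inner by (simp add: inner_add_left inner_add_right 0 norm_slice_sum(2)[OF e] power2_eq_square)
  qed
  show "(t *\<^sub>R e + (\<Sum>b\<in>Basis - {e}. y b *\<^sub>R b)) \<bullet> e = t"
    using e norm_slice_sum(2)[OF e, of y] by (simp add: inner_add_left)
qed

lemma le_iff_leg_le_sqrt:
  fixes n r t x :: real
  assumes "0 \<le> r" "t\<^sup>2 \<le> r\<^sup>2" "0 \<le> n" "0 \<le> x" "n\<^sup>2 = t\<^sup>2 + x\<^sup>2"
  shows "n \<le> r \<longleftrightarrow> x \<le> sqrt (r\<^sup>2 - t\<^sup>2)"
proof -
  have "n \<le> r \<longleftrightarrow> n\<^sup>2 \<le> r\<^sup>2" using power_mono_iff[of n r 2] assms(1,3) by simp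
  also have "\<dots> \<longleftrightarrow> x\<^sup>2 \<le> (sqrt (r\<^sup>2 - t\<^sup>2))\<^sup>2" using assms by auto
  also have "\<dots> \<longleftrightarrow> x \<le> sqrt (r\<^sup>2 - t\<^sup>2)" using assms by (subst power_mono_iff) auto
  finally show ?thesis .
qed

lemma nn_integral_axis_cball:
  fixes e :: "'a::euclidean_space"
  assumes e: "e \<in> Basis" and r: "r \<ge> 0" and D: "DIM('a) \<ge> 2" and g[measurable]: "g \<in> borel_measurable borel"
  shows "(\<integral>\<^sup>+x. g (x \<bullet> e) * indicator (cball 0 r) x \<partial>lborel)
    = (\<integral>\<^sup>+t. g t * (indicator {-r..r} t * ennreal (unit_ball_vol (real (DIM('a) - 1)) * sqrt (r\<^sup>2 - t\<^sup>2) ^ (DIM('a) - 1))) \<partial>lborel)"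
proof -
  have inner: "(\<integral>\<^sup>+y. g ((t *\<^sub>R e + (\<Sum>b\<in>Basis - {e}. y b *\<^sub>R b)) \<bullet> e)
      * indicator (cball 0 r) (t *\<^sub>R e + (\<Sum>b\<in>Basis - {e}. y b *\<^sub>R b)) \<partial>Pi\<^sub>M (Basis - {e}) (\<lambda>_. lborel))
    = g t * (indicator {-r..r} t * ennreal (unit_ball_vol (real (DIM('a) - 1)) * sqrt (r\<^sup>2 - t\<^sup>2) ^ (DIM('a) - 1)))" for t
  proof (cases "t \<in> {-r..r}")
    case True
    then have t: "t\<^sup>2 \<le> r\<^sup>2" by (simp add: abs_le_square_iff[symmetric] abs_le_iff)
    have "indicator (cball 0 r) (t *\<^sub>R e + (\<Sum>b\<in>Basis - {e}. y b *\<^sub>R b))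
        = (indicator {..sqrt (r\<^sup>2 - t\<^sup>2)} (norm (\<Sum>b\<in>Basis - {e}. y b *\<^sub>R b)) :: ennreal)" for y
      using le_iff_leg_le_sqrt[OF r t norm_ge_zero norm_ge_zero norm_add_slice(1)[OF e, of t y]]
      by (simp only: indicator_def mem_cball_0 atMost_iff)
    then show ?thesis using True
      by (simp add: norm_add_slice(2)[OF e] nn_integral_cmult emeasure_slice_ball[OF e _ D] t)
  next
    case False
    have "indicator (cball 0 r) (t *\<^sub>R e + (\<Sum>b\<in>Basis - {e}. y b *\<^sub>R b)) = (0::ennreal)" for y
    proof -
      have "\<bar>t\<bar> \<le> norm (t *\<^sub>R e + (\<Sum>b\<in>Basis - {e}. y b *\<^sub>R b))"
        using Basis_le_norm[OF e, of "t *\<^sub>R e + (\<Sum>b\<in>Basis - {e}. y b *\<^sub>R b)"] unfolding norm_add_slice(2)[OF e] .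
      then show ?thesis using False by (auto simp: indicator_def)
    qed
    then show ?thesis using False by simp
  qed
  have [measurable]: "(\<lambda>x. g (x \<bullet> e) * indicator (cball 0 r) x) \<in> borel_measurable borel"
    by (intro borel_measurable_times_ennreal borel_measurable_indicator borel_closed closed_cball) measurable
  show ?thesis
    by (subst nn_integral_lborel_slice[OF e]) (simp_all only: inner, measurable)
qed

lemma emeasure_axis_cylinder:
  fixes e :: "'a::euclidean_space"
  assumes e: "e \<in> Basis" and r: "r \<ge> 0" and a: "a \<ge> 0" and D: "DIM('a) \<ge> 2"
  shows "emeasure lborel {x. \<bar>x \<bullet> e\<bar> \<le> a \<and> norm (x - (x \<bullet> e) *\<^sub>R e) \<le> r}
    = ennreal (2 * a * unit_ball_vol (real (DIM('a) - 1)) * r ^ (DIM('a) - 1))"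
proof -
  let ?C = "{x. \<bar>x \<bullet> e\<bar> \<le> a \<and> norm (x - (x \<bullet> e) *\<^sub>R e) \<le> r}"
  have [measurable]: "?C \<in> sets borel" by measurable
  have ind: "indicator ?C (t *\<^sub>R e + (\<Sum>b\<in>Basis - {e}. y b *\<^sub>R b))
     = (indicator {-a..a} t * indicator {..r} (norm (\<Sum>b\<in>Basis - {e}. y b *\<^sub>R b)) :: ennreal)" for t y
    by (auto simp: norm_add_slice(2)[OF e] indicator_def)
  have "emeasure lborel ?C = (\<integral>\<^sup>+x. indicator ?C x \<partial>lborel)" by simp
  also have "\<dots> = (\<integral>\<^sup>+t. indicator {-a..a} t * ennreal (unit_ball_vol (real (DIM('a) - 1)) * r ^ (DIM('a) - 1)) \<partial>lborel)"
    by (subst nn_integral_lborel_slice[OF e]) (simp_all add: ind nn_integral_cmult emeasure_slice_ball[OF e r D])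
  also have "\<dots> = ennreal (2 * a * unit_ball_vol (real (DIM('a) - 1)) * r ^ (DIM('a) - 1))"
    using a r by (subst nn_integral_multc) (auto simp: ennreal_mult[symmetric] algebra_simps)
  finally show ?thesis .
qed

lemma borel_measurable_orthogonal:
  "orthogonal_transformation (T :: 'a::euclidean_space \<Rightarrow> 'a) \<Longrightarrow> T \<in> borel_measurable borel"
  by (intro borel_measurable_continuous_onI linear_continuous_on)
     (simp add: orthogonal_transformation_linear linear_conv_bounded_linear[symmetric])

lemma orthogonal_transformation_image_ball_euclidean:
  fixes T :: "'a::euclidean_space \<Rightarrow> 'a"
  assumes "orthogonal_transformation T"
  shows "T ` ball a r = ball (T a) r"
proof -
  have bij: "bij T" using assms by (rule orthogonal_transformation_bij)
  have iso: "dist (T x) (T y) = dist x y" for x y using assms by (simp add: orthogonal_transformation_isometry)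
  show ?thesis
  proof (rule set_eqI)
    fix y
    obtain x where "y = T x" using bij by (metis bij_pointE)
    then show "y \<in> T ` ball a r \<longleftrightarrow> y \<in> ball (T a) r"
      using bij by (simp add: iso inj_image_mem_iff bij_is_inj)
  qed
qed

text \<open>By Vitali's theorem an open set is, up to a null set, a disjoint union of balls, and orthogonal
  maps send balls to balls of the same radius.\<close>

lemma emeasure_open_orthogonal_image_ge:
  fixes T :: "'a::euclidean_space \<Rightarrow> 'a"
  assumes T: "orthogonal_transformation T" and U: "open U"
  shows "emeasure lborel U \<le> emeasure lborel (T ` U)"
proof -
  define K where "K = {(a, r). 0 < r \<and> ball a r \<subseteq> U}"
  have cov: "\<exists>i. i \<in> K \<and> x \<in> ball (fst i) (snd i) \<and> snd i < d" if "x \<in> U" "0 < d" for x d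
  proof -
    obtain e where e: "e > 0" "ball x e \<subseteq> U" using openE[OF U \<open>x \<in> U\<close>] by blast
    then have "ball x (min e (d / 2)) \<subseteq> U" by (intro order_trans[OF subset_ball e(2)]) simp
    then show ?thesis using e that by (intro exI[of _ "(x, min e (d / 2))"]) (auto simp: K_def)
  qed
  obtain C where C: "countable C" "C \<subseteq> K"
    "pairwise (\<lambda>i j. disjnt (ball (fst i) (snd i)) (ball (fst j) (snd j))) C"
    "negligible (U - (\<Union>i\<in>C. ball (fst i) (snd i)))"
    by (rule Vitali_covering_theorem_balls[of U K fst snd, OF cov])
  have disj: "disjoint_family_on (\<lambda>i. ball (fst i) (snd i)) C"
    using C(3) by (auto simp: disjoint_family_on_def pairwise_def disjnt_def)
  have inj: "inj T" using T by (simp add: orthogonal_transformation_inj)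
  have img: "T ` ball a r = ball (T a) r" for a r by (rule orthogonal_transformation_image_ball_euclidean[OF T])
  have "emeasure lborel U \<le> emeasure lborel (\<Union>i\<in>C. ball (fst i) (snd i))"
  proof (rule emeasure_mono_AE)
    show "AE x in lborel. x \<in> U \<longrightarrow> x \<in> (\<Union>i\<in>C. ball (fst i) (snd i))"
    proof (rule AE_I')
      have "U - (\<Union>i\<in>C. ball (fst i) (snd i)) \<in> sets borel" using U by (intro sets.Diff borel_open) auto
      then show "U - (\<Union>i\<in>C. ball (fst i) (snd i)) \<in> null_sets lborel"
        using C(4) by (auto simp: negligible_iff_null_sets null_sets_def)
    qed auto
  qed (auto intro!: borel_open open_UN)
  also have "\<dots> = (\<integral>\<^sup>+i. emeasure lborel (ball (fst i) (snd i)) \<partial>count_space C)"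
    by (rule emeasure_UN_countable) (auto simp: C disj)
  also have "\<dots> = (\<integral>\<^sup>+i. emeasure lborel (T ` ball (fst i) (snd i)) \<partial>count_space C)"
    using C(2) by (intro nn_integral_cong) (auto simp: img K_def emeasure_ball)
  also have "\<dots> = emeasure lborel (\<Union>i\<in>C. T ` ball (fst i) (snd i))"
  proof (intro emeasure_UN_countable[symmetric] C)
    show "disjoint_family_on (\<lambda>i. T ` ball (fst i) (snd i)) C"
      using disj by (auto simp: disjoint_family_on_def image_Int[OF inj, symmetric])
  qed (simp add: img)
  also have "\<dots> \<le> emeasure lborel (T ` U)"
  proof (rule emeasure_mono)
    show "(\<Union>i\<in>C. T ` ball (fst i) (snd i)) \<subseteq> T ` U" using C(2) by (fastforce simp: K_def)
    have "open (T ` U)"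
      using open_surjective_linear_image[OF U] orthogonal_transformation_linear[OF T] orthogonal_transformation_surj[OF T] by auto
    then show "T ` U \<in> sets lborel" by simp
  qed
  finally show ?thesis .
qed

lemma lborel_distr_orthogonal:
  fixes T :: "'a::euclidean_space \<Rightarrow> 'a"
  assumes T: "orthogonal_transformation T"
  shows "distr lborel borel T = lborel"
proof (rule lborel_eqI[symmetric])
  have T': "orthogonal_transformation (inv T)" by (rule orthogonal_transformation_inv[OF T])
  have cont: "continuous_on UNIV T"
    using T by (intro linear_continuous_on) (simp add: orthogonal_transformation_linear linear_conv_bounded_linear[symmetric])
  note [measurable] = borel_measurable_orthogonal[OF T]
  have bij: "bij T" using T by (rule orthogonal_transformation_bij)
  fix l u :: 'a assume lu: "\<And>b. b \<in> Basis \<Longrightarrow> l \<bullet> b \<le> u \<bullet> b"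
  have vim: "T -` box l u = inv T ` box l u" using bij by (simp add: bij_vimage_eq_inv_image)
  have op: "open (T -` box l u)" using cont by (intro open_vimage) (auto)
  have "emeasure (distr lborel borel T) (box l u) = emeasure lborel (T -` box l u)"
    by (simp add: emeasure_distr)
  also have "\<dots> = emeasure lborel (box l u)"
  proof (rule antisym)
    show "emeasure lborel (box l u) \<le> emeasure lborel (T -` box l u)"
      unfolding vim by (rule emeasure_open_orthogonal_image_ge[OF T' open_box])
    have "T ` (T -` box l u) = box l u" using bij by (simp add: surj_image_vimage_eq bij_is_surj)
    then show "emeasure lborel (T -` box l u) \<le> emeasure lborel (box l u)"
      using emeasure_open_orthogonal_image_ge[OF T op] by simp
  qed
  finally show "emeasure (distr lborel borel T) (box l u) = ennreal (\<Prod>b\<in>Basis. (u - l) \<bullet> b)"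
    using lu by (simp add: emeasure_lborel_box)
qed simp


section \<open>Hausdorff measure under Lipschitz maps\<close>

lemma hausdorff_content_single_le:
  assumes "bounded C" "diameter C \<le> \<delta>" "\<delta> \<ge> 0"
  shows "hausdorff_content k \<delta> C \<le> hausdorff_weight k C"
proof -
  have "hausdorff_content k \<delta> C \<le> (\<Sum>i::nat. hausdorff_weight k (if i = 0 then C else {}))"
    using assms by (intro hausdorff_content_le) (auto simp: diameter_empty)
  also have "\<dots> = (\<Sum>i\<in>{0::nat}. hausdorff_weight k (if i = 0 then C else {}))"
    by (rule suminf_finite) (auto simp: hausdorff_weight_def)
  finally show ?thesis by simp
qed

lemma hausdorff_content_UN_countable_le:
  assumes I: "countable I" and \<delta>: "\<delta> > 0"
  shows "hausdorff_content k \<delta> (\<Union>i\<in>I. A i) \<le> (\<integral>\<^sup>+i. hausdorff_content k \<delta> (A i) \<partial>count_space I)"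
proof -
  define J where "J = to_nat_on I ` I"
  have bij: "bij_betw (from_nat_into I) J I"
    unfolding J_def
    by (rule bij_betw_byWitness[where f' = "to_nat_on I"]) (auto simp: I)
  have "(\<Union>i\<in>I. A i) = (\<Union>n. if n \<in> J then A (from_nat_into I n) else {})"
    using bij_betw_imp_surj_on[OF bij] by (auto split: if_splits) (metis imageE)
  then have "hausdorff_content k \<delta> (\<Union>i\<in>I. A i) \<le> (\<Sum>n. hausdorff_content k \<delta> (if n \<in> J then A (from_nat_into I n) else {}))"
    using hausdorff_content_UN_le[OF \<delta>, of k "\<lambda>n. if n \<in> J then A (from_nat_into I n) else {}"] by simp
  also have "\<dots> = (\<integral>\<^sup>+n. hausdorff_content k \<delta> (if n \<in> J then A (from_nat_into I n) else {}) \<partial>count_space UNIV)"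
    by (rule nn_integral_count_space_nat[symmetric])
  also have "\<dots> = (\<integral>\<^sup>+n. hausdorff_content k \<delta> (A (from_nat_into I n)) \<partial>count_space J)"
    unfolding nn_integral_count_space_indicator[of J]
    by (subst nn_integral_count_space_indicator) (auto intro!: nn_integral_cong simp: hausdorff_content_empty[OF \<delta>] indicator_def)
  also have "\<dots> = (\<integral>\<^sup>+i. hausdorff_content k \<delta> (A i) \<partial>count_space I)"
    by (rule nn_integral_bij_count_space[OF bij])
  finally show ?thesis .
qed

lemma hausdorff_content_Un_le:
  assumes "\<delta> > 0"
  shows "hausdorff_content k \<delta> (A \<union> B) \<le> hausdorff_content k \<delta> A + hausdorff_content k \<delta> B"
proof -
  have "hausdorff_content k \<delta> (A \<union> B) = hausdorff_content k \<delta> (\<Union>n. binaryset A B n)"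
    by (simp add: UN_binaryset_eq)
  also have "\<dots> \<le> (\<Sum>n. hausdorff_content k \<delta> (binaryset A B n))"
    by (rule hausdorff_content_UN_le[OF assms])
  also have "\<dots> = hausdorff_content k \<delta> A + hausdorff_content k \<delta> B"
    by (rule suminf_binaryset_eq) (rule hausdorff_content_empty[OF assms])
  finally show ?thesis .
qed

lemma hausdorff_content_greatest:
  assumes c: "c > 0"
    and le: "\<And>C. A \<subseteq> (\<Union>i. C i) \<Longrightarrow> (\<And>i. bounded (C i)) \<Longrightarrow> (\<And>i. diameter (C i) \<le> \<delta>)
      \<Longrightarrow> x \<le> ennreal c * (\<Sum>i. hausdorff_weight k (C i))"
  shows "x \<le> ennreal c * hausdorff_content k \<delta> A"
proof -
  have inv: "ennreal (1 / c) * (ennreal c * y) = y" "ennreal c * (ennreal (1 / c) * y) = y" for y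
    using c by (auto simp: mult.assoc[symmetric] ennreal_mult[symmetric])
  have "ennreal (1 / c) * x \<le> hausdorff_content k \<delta> A"
    unfolding hausdorff_content_def[of k \<delta> A]
  proof (rule INF_greatest)
    fix C :: "nat \<Rightarrow> 'a set"
    assume "C \<in> {C. A \<subseteq> (\<Union>i. C i) \<and> (\<forall>i. bounded (C i) \<and> diameter (C i) \<le> \<delta>)}"
    then have "ennreal (1 / c) * x \<le> ennreal (1 / c) * (ennreal c * (\<Sum>i. hausdorff_weight k (C i)))"
      by (intro mult_left_mono le) auto
    then show "ennreal (1 / c) * x \<le> (\<Sum>i. hausdorff_weight k (C i))"
      by (simp only: inv)
  qed
  then have "ennreal c * (ennreal (1 / c) * x) \<le> ennreal c * hausdorff_content k \<delta> A"
    by (intro mult_left_mono) auto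
  then show ?thesis by (simp only: inv)
qed

lemma hausdorff_content_lipschitz_image:
  fixes f :: "'a::metric_space \<Rightarrow> 'b::metric_space"
  assumes L: "L > 0" and lip: "\<And>x y. x \<in> A \<Longrightarrow> y \<in> A \<Longrightarrow> dist (f x) (f y) \<le> L * dist x y"
  shows "hausdorff_content k (L * \<delta>) (f ` A) \<le> ennreal (L ^ k) * hausdorff_content k \<delta> A"
proof -
  have "hausdorff_content k (L * \<delta>) (f ` A) \<le> ennreal (L ^ k) * (\<Sum>i. hausdorff_weight k (C i))"
    if C: "A \<subseteq> (\<Union>i. C i)" "\<And>i. bounded (C i)" "\<And>i. diameter (C i) \<le> \<delta>" for C :: "nat \<Rightarrow> 'a set"
  proof -
    have d: "dist x y \<le> L * diameter (C i)" if xy: "x \<in> f ` (C i \<inter> A)" "y \<in> f ` (C i \<inter> A)" for x y i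
    proof -
      obtain x' y' where x': "x = f x'" "x' \<in> C i" "x' \<in> A" and y': "y = f y'" "y' \<in> C i" "y' \<in> A"
        using xy by auto
      have "dist x y \<le> L * dist x' y'" using lip x' y' by simp
      also have "\<dots> \<le> L * diameter (C i)"
        using L diameter_bounded_bound[OF C(2) x'(2) y'(2)] by (intro mult_left_mono) auto
      finally show ?thesis .
    qed
    have b: "bounded (f ` (C i \<inter> A))" for i
      using d unfolding bounded_two_points by blast
    have diam: "diameter (f ` (C i \<inter> A)) \<le> L * diameter (C i)" for i
      using d[of _ i] L diameter_ge_0[OF C(2), of i] unfolding diameter_def[of "f ` (C i \<inter> A)"]
      by (cases "C i \<inter> A = {}") (auto intro!: cSUP_least)
    have "hausdorff_content k (L * \<delta>) (f ` A) \<le> (\<Sum>i. hausdorff_weight k (f ` (C i \<inter> A)))"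
    proof (rule hausdorff_content_le)
      show "f ` A \<subseteq> (\<Union>i. f ` (C i \<inter> A))" using C(1) by blast
      show "diameter (f ` (C i \<inter> A)) \<le> L * \<delta>" for i
        using diam[of i] C(3)[of i] L by (meson mult_le_cancel_left_pos order_trans)
    qed (rule b)
    also have "\<dots> \<le> (\<Sum>i. ennreal (L ^ k) * hausdorff_weight k (C i))"
    proof (intro suminf_le)
      fix i
      show "hausdorff_weight k (f ` (C i \<inter> A)) \<le> ennreal (L ^ k) * hausdorff_weight k (C i)"
      proof (cases "C i \<inter> A = {}")
        case False
        have "(diameter (f ` (C i \<inter> A)) / 2) ^ k \<le> (L * diameter (C i) / 2) ^ k"
          using diam[of i] diameter_ge_0[OF b[of i]] by (intro power_mono) auto
        then have "unit_ball_vol (real k) * (diameter (f ` (C i \<inter> A)) / 2) ^ k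
            \<le> L ^ k * (unit_ball_vol (real k) * (diameter (C i) / 2) ^ k)"
          by (auto simp: power_mult_distrib power_divide ac_simps divide_simps)
        then show ?thesis using False L
          by (auto simp: hausdorff_weight_def ennreal_mult'[symmetric] intro!: ennreal_leI)
      qed (auto simp: hausdorff_weight_def)
    qed auto
    finally show ?thesis by simp
  qed
  note le = this
  show ?thesis
    by (rule hausdorff_content_greatest) (use L le in auto)
qed

lemma hausdorff_outer_measure_isometric_image:
  assumes "\<And>x y. x \<in> A \<Longrightarrow> y \<in> A \<Longrightarrow> dist (f x) (f y) \<le> dist x y"
  shows "hausdorff_outer_measure k (f ` A) \<le> hausdorff_outer_measure k A"
  unfolding hausdorff_outer_measure_def
  using hausdorff_content_lipschitz_image[of 1 A f k] assms
  by (intro SUP_mono) auto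

lemma hausdorff_measure_distr_orthogonal:
  fixes T :: "'a::euclidean_space \<Rightarrow> 'a"
  assumes T: "orthogonal_transformation T"
  shows "distr (hausdorff_measure k) (hausdorff_measure k) T = hausdorff_measure k"
proof (rule measure_eqI)
  have T': "orthogonal_transformation (inv T)" by (rule orthogonal_transformation_inv[OF T])
  note [measurable] = borel_measurable_orthogonal[OF T]
  have bij: "bij T" using T by (rule orthogonal_transformation_bij)
  fix A assume "A \<in> sets (distr (hausdorff_measure k) (hausdorff_measure k) T)"
  then have A[measurable]: "A \<in> sets borel" by simp
  have "T -` A \<inter> space borel \<in> sets borel" by measurable
  then have TA: "T -` A \<in> sets borel" by simp
  have "emeasure (distr (hausdorff_measure k) (hausdorff_measure k) T) A = hausdorff_outer_measure k (T -` A)"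
    using TA by (subst emeasure_distr) (auto simp: emeasure_hausdorff_measure)
  also have "\<dots> = hausdorff_outer_measure k A"
  proof (rule antisym)
    have "T -` A = inv T ` A" using bij by (simp add: bij_vimage_eq_inv_image)
    then show "hausdorff_outer_measure k (T -` A) \<le> hausdorff_outer_measure k A"
      using T' by (auto intro!: hausdorff_outer_measure_isometric_image simp: orthogonal_transformation_isometry)
    have "T ` (T -` A) = A" using bij by (simp add: surj_image_vimage_eq bij_is_surj)
    then show "hausdorff_outer_measure k A \<le> hausdorff_outer_measure k (T -` A)"
      using T hausdorff_outer_measure_isometric_image[of "T -` A" T k] by (auto simp: orthogonal_transformation_isometry)
  qed
  finally show "emeasure (distr (hausdorff_measure k) (hausdorff_measure k) T) A = emeasure (hausdorff_measure k) A"
    by (simp add: emeasure_hausdorff_measure)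
qed simp


section \<open>The area of the sphere, lower bound\<close>

lemma emeasure_cylinder:
  fixes w :: "real^'n"
  assumes w: "norm w = 1" and r: "r \<ge> 0" and a: "a \<ge> 0" and D: "CARD('n) \<ge> 2"
  shows "emeasure lborel {x. \<bar>x \<bullet> w\<bar> \<le> a \<and> norm (x - (x \<bullet> w) *\<^sub>R w) \<le> r}
    = ennreal (2 * a * unit_ball_vol (real (CARD('n) - 1)) * r ^ (CARD('n) - 1))"
proof -
  obtain e :: "real^'n" where e: "e \<in> Basis" using nonempty_Basis by blast
  obtain T where T: "orthogonal_transformation T" "T w = e"
    using orthogonal_transformation_exists[of w e] w e by auto
  note [measurable] = borel_measurable_orthogonal[OF T(1)]
  let ?C = "{x. \<bar>x \<bullet> e\<bar> \<le> a \<and> norm (x - (x \<bullet> e) *\<^sub>R e) \<le> r}"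
  have [measurable]: "?C \<in> sets borel" by measurable
  have ip: "T x \<bullet> e = x \<bullet> w" for x using T by (metis orthogonal_transformation_def)
  have "T x - (x \<bullet> w) *\<^sub>R e = T (x - (x \<bullet> w) *\<^sub>R w)" for x
    using T orthogonal_transformation_linear[OF T(1)] by (simp add: linear_diff linear_scale)
  then have nm: "norm (T x - (x \<bullet> w) *\<^sub>R e) = norm (x - (x \<bullet> w) *\<^sub>R w)" for x
    using T(1) by (simp add: orthogonal_transformation_norm)
  have "{x. \<bar>x \<bullet> w\<bar> \<le> a \<and> norm (x - (x \<bullet> w) *\<^sub>R w) \<le> r} = T -` ?C"
    by (auto simp: ip nm)
  then have "emeasure lborel {x. \<bar>x \<bullet> w\<bar> \<le> a \<and> norm (x - (x \<bullet> w) *\<^sub>R w) \<le> r} = emeasure (distr lborel borel T) ?C"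
    by (simp add: emeasure_distr)
  then show ?thesis
    unfolding lborel_distr_orthogonal[OF T(1)] using emeasure_axis_cylinder[OF e r a] D by simp
qed

definition radial_shell_over :: "real \<Rightarrow> 'a::real_normed_vector set \<Rightarrow> 'a set" where
  "radial_shell_over \<eta> C = (\<lambda>(t, x). t *\<^sub>R x) ` ({1 - \<eta>..1} \<times> C)"

text \<open>Fix a point \<open>w\<close> of \<open>C\<close>. Every point of \<open>C\<close> is within \<open>d\<close> of \<open>w\<close>, so its height \<open>z \<bullet> w = 1 - \<bar>z - w\<bar>\<^sup>2 / 2\<close> is nearly
  \<open>1\<close>. Differences of points of the thickened set therefore have a component along \<open>w\<close> of at most
  \<open>\<eta> + \<eta>\<^sup>2 / 2\<close> and a component orthogonal to \<open>w\<close> of at most \<open>(1 + \<eta>) d\<close>. Halving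
  these bounds gives a cylinder that contains half of each difference and whose volume is the
  right-hand side.\<close>

lemma emeasure_radial_shell_over_le:
  fixes C :: "(real^'n) set"
  assumes D: "CARD('n) \<ge> 2" and C: "compact C" "C \<subseteq> sphere 0 1" "C \<noteq> {}"
    and d: "\<And>x y. x \<in> C \<Longrightarrow> y \<in> C \<Longrightarrow> dist x y \<le> d" "d \<le> \<eta>" and \<eta>: "0 < \<eta>" "\<eta> < 1"
  shows "emeasure lborel (radial_shell_over \<eta> C)
    \<le> ennreal ((\<eta> + \<eta>\<^sup>2 / 2) * (1 + \<eta>) ^ (CARD('n) - 1))
      * ennreal (unit_ball_vol (real (CARD('n) - 1)) * (d / 2) ^ (CARD('n) - 1))"
proof -
  obtain w where w: "w \<in> C" using C(3) by auto
  have nw: "norm w = 1" using w C(2) by auto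
  have d0: "0 \<le> d" using d(1)[OF w w] by simp
  define a where "a = (\<eta> + \<eta>\<^sup>2 / 2) / 2"
  define r where "r = (1 + \<eta>) * d / 2"
  let ?W = "{x. \<bar>x \<bullet> w\<bar> \<le> a \<and> norm (x - (x \<bullet> w) *\<^sub>R w) \<le> r}"
  have cpt: "compact (radial_shell_over \<eta> C)"
    unfolding radial_shell_over_def
    by (intro compact_continuous_image compact_Times C) (auto simp: case_prod_beta intro!: continuous_intros)
  have "emeasure lborel (radial_shell_over \<eta> C) \<le> emeasure lborel ?W"
  proof (rule emeasure_le_difference_body)
    show "radial_shell_over \<eta> C \<in> sets borel" using cpt by (rule borel_compact)
    show "emeasure lborel (radial_shell_over \<eta> C) < \<infinity>"
      using emeasure_bounded_finite[OF compact_imp_bounded[OF cpt]] by simp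
    show "?W \<in> sets borel" by measurable
    fix x y assume "x \<in> radial_shell_over \<eta> C" "y \<in> radial_shell_over \<eta> C"
    then obtain s t p q where s: "s \<in> {1 - \<eta>..1}" "p \<in> C" "x = s *\<^sub>R p" and t: "t \<in> {1 - \<eta>..1}" "q \<in> C" "y = t *\<^sub>R q"
      by (auto simp: radial_shell_over_def)
    have height: "1 - \<eta>\<^sup>2 / 2 \<le> z \<bullet> w" "z \<bullet> w \<le> 1" if "z \<in> C" for z
    proof -
      have nz: "norm z = 1" using that C(2) by auto
      have "(dist z w)\<^sup>2 \<le> \<eta>\<^sup>2" using d(1)[OF that w] d(2) by (intro power_mono) auto
      moreover have "(dist z w)\<^sup>2 = 2 - 2 * (z \<bullet> w)"
        using nz nw by (simp add: dist_norm power2_norm_eq_inner inner_diff_left inner_diff_right inner_commute norm_eq_1)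
      ultimately show "1 - \<eta>\<^sup>2 / 2 \<le> z \<bullet> w" "z \<bullet> w \<le> 1" using zero_le_power2[of "dist z w"] by linarith+
    qed
    have h0: "0 \<le> 1 - \<eta>\<^sup>2 / 2" using \<eta> power_le_one[of \<eta> 2] by simp
    have abs_diff_le: "c \<le> u \<Longrightarrow> u \<le> 1 \<Longrightarrow> c \<le> v \<Longrightarrow> v \<le> 1 \<Longrightarrow> \<bar>u - v\<bar> \<le> 1 - c" for u v c :: real
      by linarith
    have sb: "(1 - \<eta>) * (1 - \<eta>\<^sup>2 / 2) \<le> s * (p \<bullet> w)" "s * (p \<bullet> w) \<le> 1"
      using s height[OF s(2)] h0 \<eta> by (auto intro!: mult_mono mult_le_one)
    have tb: "(1 - \<eta>) * (1 - \<eta>\<^sup>2 / 2) \<le> t * (q \<bullet> w)" "t * (q \<bullet> w) \<le> 1"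
      using t height[OF t(2)] h0 \<eta> by (auto intro!: mult_mono mult_le_one)
    have eb: "1 - (1 - \<eta>) * (1 - \<eta>\<^sup>2 / 2) \<le> \<eta> + \<eta>\<^sup>2 / 2" using \<eta> by (simp add: algebra_simps)
    have "\<bar>(x - y) \<bullet> w\<bar> \<le> 2 * a"
      unfolding s(3) t(3) a_def inner_diff_left inner_scaleR_left
      using order_trans[OF abs_diff_le[OF sb tb] eb] by simp
    then have A: "\<bar>((1/2) *\<^sub>R (x - y)) \<bullet> w\<bar> \<le> a" by simp
    define P where "P v = v - (v \<bullet> w) *\<^sub>R w" for v :: "real^'n"
    have Plin: "P (u + v) = P u + P v" "P (c *\<^sub>R v) = c *\<^sub>R P v" "P (u - v) = P u - P v" for u v c
      by (simp_all add: P_def algebra_simps inner_add_left inner_diff_left)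
    have Pw: "P w = 0" using nw by (simp add: P_def norm_eq_1)
    have Ple: "norm (P v) \<le> norm v" for v
    proof (rule power2_le_imp_le)
      have "(norm (P v))\<^sup>2 = (norm v)\<^sup>2 - (v \<bullet> w)\<^sup>2"
        using nw unfolding P_def power2_norm_eq_inner
        by (simp add: inner_diff_left inner_diff_right inner_commute norm_eq_1 power2_eq_square)
      then show "(norm (P v))\<^sup>2 \<le> (norm v)\<^sup>2" by simp
    qed simp
    have "P (x - y) = s *\<^sub>R P (p - q) + (s - t) *\<^sub>R P (q - w)"
      using s t by (simp add: Plin Pw algebra_simps)
    also have "norm \<dots> \<le> \<bar>s\<bar> * norm (P (p - q)) + \<bar>s - t\<bar> * norm (P (q - w))"
      by (rule order_trans[OF norm_triangle_ineq]) simp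
    also have "\<dots> \<le> 1 * d + \<eta> * d"
      using s t \<eta> d0 order_trans[OF Ple[of "p - q"]] order_trans[OF Ple[of "q - w"]] d(1)[OF s(2) t(2)] d(1)[OF t(2) w]
      by (intro add_mono mult_mono) (auto simp: dist_norm)
    finally have "norm (P (x - y)) \<le> 2 * r" by (simp add: r_def algebra_simps)
    then have "norm (P ((1/2) *\<^sub>R (x - y))) \<le> r" unfolding Plin(2) by simp
    with A show "(1/2) *\<^sub>R (x - y) \<in> ?W" by (simp only: P_def mem_Collect_eq)
  qed
  also have "\<dots> = ennreal (2 * a * unit_ball_vol (real (CARD('n) - 1)) * r ^ (CARD('n) - 1))"
    using \<eta> d0 by (intro emeasure_cylinder[OF nw _ _ D]) (auto simp: a_def r_def)
  also have "2 * a * unit_ball_vol (real (CARD('n) - 1)) * r ^ (CARD('n) - 1)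
     = ((\<eta> + \<eta>\<^sup>2 / 2) * (1 + \<eta>) ^ (CARD('n) - 1)) * (unit_ball_vol (real (CARD('n) - 1)) * (d / 2) ^ (CARD('n) - 1))"
  proof -
    have "2 * a = \<eta> + \<eta>\<^sup>2 / 2" "r = (1 + \<eta>) * (d / 2)" by (simp_all add: a_def r_def)
    then show ?thesis by (simp only: power_mult_distrib mult_ac)
  qed
  finally show ?thesis using \<eta> d0 by (simp add: ennreal_mult[symmetric])
qed

lemma emeasure_shell:
  assumes "0 < \<eta>" "\<eta> < 1"
  shows "emeasure lborel (cball 0 1 - ball 0 (1 - \<eta>) :: (real^'n) set)
    = ennreal (unit_ball_vol (real CARD('n)) * (1 - (1 - \<eta>) ^ CARD('n)))"
proof -
  have "emeasure lborel (cball 0 1 - ball 0 (1 - \<eta>) :: (real^'n) set)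
    = emeasure lborel (cball 0 1 :: (real^'n) set) - emeasure lborel (ball 0 (1 - \<eta>) :: (real^'n) set)"
    using assms emeasure_lborel_ball_finite by (intro emeasure_Diff) (auto simp: less_top[symmetric])
  also have "\<dots> = ennreal (unit_ball_vol (real CARD('n)) * (1 - (1 - \<eta>) ^ CARD('n)))"
    using assms by (simp add: emeasure_cball emeasure_ball ennreal_minus algebra_simps)
  finally show ?thesis .
qed

text \<open>Taking closures of the covering sets does not change their diameters and makes the thickened
  pieces compact.\<close>

lemma shell_le_hausdorff_content_sphere:
  fixes \<eta> :: real
  assumes D: "CARD('n) \<ge> 2" and \<eta>: "0 < \<eta>" "\<eta> < 1"
  shows "ennreal (unit_ball_vol (real CARD('n)) * (1 - (1 - \<eta>) ^ CARD('n)))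
     \<le> ennreal ((\<eta> + \<eta>\<^sup>2 / 2) * (1 + \<eta>) ^ (CARD('n) - 1))
       * hausdorff_content (CARD('n) - 1) \<eta> (sphere 0 1 :: (real^'n) set)"
proof (rule hausdorff_content_greatest)
  show "0 < (\<eta> + \<eta>\<^sup>2 / 2) * (1 + \<eta>) ^ (CARD('n) - 1)" using \<eta> by (intro mult_pos_pos add_pos_pos) auto
  fix C :: "nat \<Rightarrow> (real^'n) set"
  assume C: "sphere 0 1 \<subseteq> (\<Union>i. C i)" "\<And>i. bounded (C i)" "\<And>i. diameter (C i) \<le> \<eta>"
  define E where "E i = closure (C i) \<inter> sphere 0 1" for i
  have E: "compact (E i)" "E i \<subseteq> sphere 0 1" for i
    unfolding E_def using C(2) by (auto intro!: closed_Int_compact)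
  have cpt: "compact (radial_shell_over \<eta> (E i))" for i
    unfolding radial_shell_over_def
    by (intro compact_continuous_image compact_Times E) (auto simp: case_prod_beta intro!: continuous_intros)
  have "ennreal (unit_ball_vol (real CARD('n)) * (1 - (1 - \<eta>) ^ CARD('n)))
      = emeasure lborel (cball 0 1 - ball 0 (1 - \<eta>) :: (real^'n) set)"
    by (rule emeasure_shell[OF \<eta>, symmetric])
  also have "\<dots> \<le> emeasure lborel (\<Union>i. radial_shell_over \<eta> (E i))"
  proof (rule emeasure_mono)
    show "(\<Union>i. radial_shell_over \<eta> (E i)) \<in> sets lborel" using borel_compact[OF cpt] by auto
    show "cball 0 1 - ball 0 (1 - \<eta>) \<subseteq> (\<Union>i. radial_shell_over \<eta> (E i))"
    proof
      fix x :: "real^'n" assume x: "x \<in> cball 0 1 - ball 0 (1 - \<eta>)"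
      then have nx: "norm x \<in> {1 - \<eta>..1}" by auto
      then have "norm x > 0" using \<eta> by auto
      then have sp: "(1 / norm x) *\<^sub>R x \<in> sphere 0 1" "x = norm x *\<^sub>R ((1 / norm x) *\<^sub>R x)" by auto
      then obtain i where "(1 / norm x) *\<^sub>R x \<in> C i" using C(1) by blast
      then have "(1 / norm x) *\<^sub>R x \<in> E i" using sp(1) closure_subset by (auto simp: E_def)
      then have "(norm x, (1 / norm x) *\<^sub>R x) \<in> {1 - \<eta>..1} \<times> E i" using nx by simp
      then show "x \<in> (\<Union>i. radial_shell_over \<eta> (E i))"
        unfolding radial_shell_over_def using sp(2) by (intro UN_I[of i] rev_image_eqI[of "(norm x, (1 / norm x) *\<^sub>R x)"]) auto
    qed
  qed
  also have "\<dots> \<le> (\<Sum>i. emeasure lborel (radial_shell_over \<eta> (E i)))"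
    by (rule emeasure_subadditive_countably) (use cpt in \<open>auto intro!: borel_compact\<close>)
  also have "\<dots> \<le> (\<Sum>i. ennreal ((\<eta> + \<eta>\<^sup>2 / 2) * (1 + \<eta>) ^ (CARD('n) - 1)) * hausdorff_weight (CARD('n) - 1) (C i))"
  proof (rule suminf_le)
    fix i
    show "emeasure lborel (radial_shell_over \<eta> (E i))
      \<le> ennreal ((\<eta> + \<eta>\<^sup>2 / 2) * (1 + \<eta>) ^ (CARD('n) - 1)) * hausdorff_weight (CARD('n) - 1) (C i)"
    proof (cases "E i = {}")
      case True
      then show ?thesis by (simp add: radial_shell_over_def)
    next
      case False
      then have "C i \<noteq> {}" by (auto simp: E_def)
      moreover have "dist x y \<le> diameter (C i)" if "x \<in> E i" "y \<in> E i" for x y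
        using that diameter_bounded_bound[of "closure (C i)" x y] C(2)
        by (auto simp: E_def diameter_closure)
      ultimately show ?thesis
        using emeasure_radial_shell_over_le[OF D E False _ C(3) \<eta>] by (simp add: hausdorff_weight_def)
    qed
  qed auto
  also have "\<dots> = ennreal ((\<eta> + \<eta>\<^sup>2 / 2) * (1 + \<eta>) ^ (CARD('n) - 1)) * (\<Sum>i. hausdorff_weight (CARD('n) - 1) (C i))"
    by simp
  finally show "ennreal (unit_ball_vol (real CARD('n)) * (1 - (1 - \<eta>) ^ CARD('n))) \<le> \<dots>" .
qed

lemma tendsto_shell_ratio:
  "((\<lambda>\<eta>::real. (1 - (1 - \<eta>) ^ n) / \<eta>) \<longlongrightarrow> real n) (at_right 0)"
proof -
  have "((\<lambda>\<eta>::real. 1 - (1 - \<eta>) ^ n) has_real_derivative real n) (at 0)"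
    by (auto intro!: derivative_eq_intros)
  then have "((\<lambda>\<eta>::real. (1 - (1 - \<eta>) ^ n) / \<eta>) \<longlongrightarrow> real n) (at 0)"
    by (simp add: DERIV_def)
  then show ?thesis by (rule filterlim_at_split[THEN iffD1, THEN conjunct2])
qed

lemma hausdorff_outer_measure_sphere_ge:
  assumes D: "CARD('n) \<ge> 2"
  shows "ennreal (real CARD('n) * unit_ball_vol (real CARD('n)))
    \<le> hausdorff_outer_measure (CARD('n) - 1) (sphere 0 1 :: (real^'n) set)"
proof -
  define g where "g \<eta> = unit_ball_vol (real CARD('n)) * ((1 - (1 - \<eta>) ^ CARD('n)) / \<eta>) / ((1 + \<eta> / 2) * (1 + \<eta>) ^ (CARD('n) - 1))" for \<eta> :: real
  have "(g \<longlongrightarrow> unit_ball_vol (real CARD('n)) * real CARD('n) / ((1 + 0 / 2) * (1 + 0) ^ (CARD('n) - 1))) (at_right 0)"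
    unfolding g_def by (intro tendsto_intros tendsto_shell_ratio) auto
  then have lim: "((\<lambda>\<eta>. ennreal (g \<eta>)) \<longlongrightarrow> ennreal (real CARD('n) * unit_ball_vol (real CARD('n)))) (at_right 0)"
    by (intro tendsto_ennrealI) (simp add: mult.commute)
  have "eventually (\<lambda>\<eta>::real. 0 < \<eta> \<and> \<eta> < 1) (at_right 0)"
    unfolding eventually_at_right_field by (auto intro: exI[of _ 1])
  then have "eventually (\<lambda>\<eta>. ennreal (g \<eta>) \<le> hausdorff_outer_measure (CARD('n) - 1) (sphere 0 1 :: (real^'n) set)) (at_right 0)"
  proof eventually_elim
    case (elim \<eta>)
    define c where "c = (\<eta> + \<eta>\<^sup>2 / 2) * (1 + \<eta>) ^ (CARD('n) - 1)"
    have c: "c > 0" using elim unfolding c_def by (intro mult_pos_pos add_pos_pos) auto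
    have g: "g \<eta> = (1 / c) * (unit_ball_vol (real CARD('n)) * (1 - (1 - \<eta>) ^ CARD('n)))"
      using elim c unfolding g_def c_def by (simp add: power2_eq_square field_simps)
    have "ennreal (g \<eta>) = ennreal (1 / c) * ennreal (unit_ball_vol (real CARD('n)) * (1 - (1 - \<eta>) ^ CARD('n)))"
      unfolding g using c elim by (intro ennreal_mult) (auto intro!: mult_nonneg_nonneg power_le_one)
    also have "\<dots> \<le> ennreal (1 / c) * (ennreal c * hausdorff_content (CARD('n) - 1) \<eta> (sphere 0 1 :: (real^'n) set))"
      unfolding c_def using elim by (intro mult_left_mono shell_le_hausdorff_content_sphere D) auto
    also have "\<dots> = hausdorff_content (CARD('n) - 1) \<eta> (sphere 0 1 :: (real^'n) set)"
      using c by (simp add: mult.assoc[symmetric] ennreal_mult[symmetric])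
    also have "\<dots> \<le> hausdorff_outer_measure (CARD('n) - 1) (sphere 0 1 :: (real^'n) set)"
      unfolding hausdorff_outer_measure_def using elim by (intro SUP_upper) auto
    finally show ?case .
  qed
  then show ?thesis
    by (intro tendsto_upperbound[OF lim]) auto
qed


section \<open>The area of the sphere, upper bound\<close>

text \<open>The ball around \<open>a\<close> cuts the sphere of radius \<open>r\<close> in the cap on which the height \<open>x \<bullet> a / \<bar>a\<bar>\<close> is at least \<open>h\<close>,
  and \<open>h \<ge> 0\<close> because the ball does not reach the origin. By the parallelogram identity
  \<open>\<bar>x - y\<bar>\<^sup>2 = 4 r\<^sup>2 - \<bar>x + y\<bar>\<^sup>2 \<le> 4 (r\<^sup>2 - h\<^sup>2)\<close>: the diameter of the cap is at most that of its boundary.\<close>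

lemma dist_le_spherical_cap:
  fixes a x y :: "'a::real_inner"
  assumes x: "x \<in> cball a \<rho>" "norm x = r" and y: "y \<in> cball a \<rho>" "norm y = r" and a: "\<rho> < norm a" "0 \<le> \<rho>"
    and h: "h = (r\<^sup>2 + (norm a)\<^sup>2 - \<rho>\<^sup>2) / (2 * norm a)"
  shows "(dist x y)\<^sup>2 \<le> 4 * (\<rho>\<^sup>2 - (h - norm a)\<^sup>2)"
proof -
  have na: "norm a > 0" using a by linarith
  have ip: "norm a * h \<le> z \<bullet> a" if "z \<in> cball a \<rho>" "norm z = r" for z
  proof -
    have "(dist a z)\<^sup>2 \<le> \<rho>\<^sup>2" using that(1) by (intro power_mono) auto
    moreover have "(dist a z)\<^sup>2 = (norm a)\<^sup>2 + r\<^sup>2 - 2 * (z \<bullet> a)"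
      unfolding dist_norm that(2)[symmetric] power2_norm_eq_inner
      by (simp add: inner_diff_left inner_diff_right inner_commute)
    ultimately show ?thesis using na by (simp add: h)
  qed
  have "\<rho>\<^sup>2 \<le> (norm a)\<^sup>2" using a by (intro power_mono) auto
  then have "0 \<le> r\<^sup>2 + (norm a)\<^sup>2 - \<rho>\<^sup>2" using zero_le_power2[of r] by linarith
  then have h0: "0 \<le> h" using na unfolding h by (intro divide_nonneg_pos) auto
  have "norm a * (2 * h) \<le> (x + y) \<bullet> a" using ip[OF x] ip[OF y] by (simp add: inner_add_left)
  also have "\<dots> \<le> norm (x + y) * norm a" by (rule norm_cauchy_schwarz)
  finally have "2 * h \<le> norm (x + y)" using na by (simp add: mult.commute)
  then have "(2 * h)\<^sup>2 \<le> (norm (x + y))\<^sup>2" using h0 by (intro power_mono) auto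
  moreover have "(dist x y)\<^sup>2 + (norm (x + y))\<^sup>2 = 2 * (norm x)\<^sup>2 + 2 * (norm y)\<^sup>2"
    unfolding dist_norm power2_norm_eq_inner
    by (simp add: inner_diff_left inner_diff_right inner_add_left inner_add_right inner_commute)
  ultimately have "(dist x y)\<^sup>2 \<le> 4 * (r\<^sup>2 - h\<^sup>2)" using x(2) y(2) by (simp add: power_mult_distrib)
  also have "r\<^sup>2 - h\<^sup>2 = \<rho>\<^sup>2 - (h - norm a)\<^sup>2"
  proof -
    have "2 * norm a * h = r\<^sup>2 + (norm a)\<^sup>2 - \<rho>\<^sup>2" using na by (simp add: h)
    then show ?thesis by (simp add: power2_eq_square algebra_simps)
  qed
  finally show ?thesis .
qed

text \<open>The volume of the flat disc that spans the cap cut from the sphere of radius \<open>sqrt (2 * q)\<close> by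
  a ball of radius \<open>\<rho>\<close> with centre at distance \<open>A\<close> from the origin; \<open>\<tau>\<close> is the signed distance from the
  centre of the ball to the plane of this disc.\<close>

definition cap_weight :: "nat \<Rightarrow> real \<Rightarrow> real \<Rightarrow> real \<Rightarrow> ennreal" where
  "cap_weight k A \<rho> q = (let \<tau> = (2 * q + A\<^sup>2 - \<rho>\<^sup>2) / (2 * A) - A in
     indicator {-\<rho>..\<rho>} \<tau> * ennreal (unit_ball_vol (real k) * sqrt (\<rho>\<^sup>2 - \<tau>\<^sup>2) ^ k))"

lemma borel_measurable_cap_weight[measurable]: "cap_weight k A \<rho> \<in> borel_measurable borel"
  unfolding cap_weight_def[abs_def] Let_def by measurable

lemma hausdorff_content_spherical_cap_le:
  fixes a :: "'a::euclidean_space"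
  assumes r: "0 \<le> r" and a: "\<rho> < norm a" "0 < \<rho>" and \<delta>: "2 * \<rho> \<le> \<delta>"
  shows "hausdorff_content k \<delta> (cball a \<rho> \<inter> sphere 0 r) \<le> cap_weight k (norm a) \<rho> (r\<^sup>2 / 2)"
proof (cases "cball a \<rho> \<inter> sphere 0 r = {}")
  case True
  then show ?thesis using a \<delta> by (simp add: hausdorff_content_empty)
next
  case False
  define h where "h = (r\<^sup>2 + (norm a)\<^sup>2 - \<rho>\<^sup>2) / (2 * norm a)"
  define s where "s = sqrt (\<rho>\<^sup>2 - (h - norm a)\<^sup>2)"
  have le: "(dist x y)\<^sup>2 \<le> 4 * (\<rho>\<^sup>2 - (h - norm a)\<^sup>2)" if "x \<in> cball a \<rho> \<inter> sphere 0 r" "y \<in> cball a \<rho> \<inter> sphere 0 r" for x y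
    using that a by (intro dist_le_spherical_cap[OF _ _ _ _ a(1) _ h_def]) auto
  obtain z where "z \<in> cball a \<rho> \<inter> sphere 0 r" using False by blast
  from le[OF this this] have s2: "(h - norm a)\<^sup>2 \<le> \<rho>\<^sup>2" by simp
  then have "\<bar>h - norm a\<bar> \<le> \<rho>" using a by (simp add: abs_le_square_iff[symmetric])
  then have \<tau>: "h - norm a \<in> {-\<rho>..\<rho>}" by (simp add: abs_le_iff)
  have bdd: "bounded (cball a \<rho> \<inter> sphere 0 r)" by (intro bounded_Int) simp
  have d: "diameter (cball a \<rho> \<inter> sphere 0 r) \<le> 2 * s"
  proof (rule diameter_le)
    fix x y assume xy: "x \<in> cball a \<rho> \<inter> sphere 0 r" "y \<in> cball a \<rho> \<inter> sphere 0 r"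
    have "dist x y \<le> sqrt (4 * (\<rho>\<^sup>2 - (h - norm a)\<^sup>2))" using le[OF xy] by (rule real_le_rsqrt)
    also have "\<dots> = 2 * s" unfolding s_def real_sqrt_mult by simp
    finally show "norm (x - y) \<le> 2 * s" by (simp add: dist_norm)
  qed (use False in simp)
  have "s \<le> \<rho>" unfolding s_def using a by (intro real_le_lsqrt) auto
  with d \<delta> have "diameter (cball a \<rho> \<inter> sphere 0 r) \<le> \<delta>" by linarith
  then have "hausdorff_content k \<delta> (cball a \<rho> \<inter> sphere 0 r) \<le> hausdorff_weight k (cball a \<rho> \<inter> sphere 0 r)"
    using a \<delta> bdd by (intro hausdorff_content_single_le) auto
  also have "\<dots> \<le> ennreal (unit_ball_vol (real k) * s ^ k)"
    using False d diameter_ge_0[OF bdd]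
    by (auto simp: hausdorff_weight_def intro!: ennreal_leI mult_left_mono power_mono)
  also have "\<dots> = cap_weight k (norm a) \<rho> (r\<^sup>2 / 2)"
    using \<tau> by (simp add: cap_weight_def Let_def h_def s_def)
  finally show ?thesis .
qed

text \<open>In the variable \<open>q = r\<^sup>2 / 2\<close> the plane of the cap moves with constant speed \<open>1 / A\<close>, so the flat discs
  sweep out the ball as parallel slices do.\<close>

lemma nn_integral_cap_weight:
  fixes a :: "'a::euclidean_space"
  assumes D: "DIM('a) \<ge> 2" and A: "A > 0" and \<rho>: "\<rho> \<ge> 0"
  shows "(\<integral>\<^sup>+q. cap_weight (DIM('a) - 1) A \<rho> q \<partial>lborel) = ennreal A * emeasure lborel (cball a \<rho>)"
proof -
  obtain e :: 'a where e: "e \<in> Basis" using nonempty_Basis by blast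
  let ?G = "\<lambda>t. indicator {-\<rho>..\<rho>} t * ennreal (unit_ball_vol (real (DIM('a) - 1)) * sqrt (\<rho>\<^sup>2 - t\<^sup>2) ^ (DIM('a) - 1))"
  have "emeasure lborel (cball a \<rho>) = emeasure lborel (cball (0::'a) \<rho>)"
    using \<rho> by (simp add: emeasure_cball)
  also have "\<dots> = (\<integral>\<^sup>+x. 1 * indicator (cball (0::'a) \<rho>) x \<partial>lborel)" by simp
  also have "\<dots> = (\<integral>\<^sup>+t. ?G t \<partial>lborel)"
    using nn_integral_axis_cball[OF e \<rho> D, of "\<lambda>_. 1"] by simp
  also have "\<dots> = ennreal \<bar>1 / A\<bar> * (\<integral>\<^sup>+q. ?G (((A\<^sup>2 - \<rho>\<^sup>2) / (2 * A) - A) + (1 / A) * q) \<partial>lborel)"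
    using A by (intro nn_integral_real_affine) auto
  also have "(\<lambda>q. ?G (((A\<^sup>2 - \<rho>\<^sup>2) / (2 * A) - A) + (1 / A) * q)) = cap_weight (DIM('a) - 1) A \<rho>"
  proof
    fix q
    have "((A\<^sup>2 - \<rho>\<^sup>2) / (2 * A) - A) + (1 / A) * q = (2 * q + A\<^sup>2 - \<rho>\<^sup>2) / (2 * A) - A"
      using A by (simp add: field_simps)
    then show "?G (((A\<^sup>2 - \<rho>\<^sup>2) / (2 * A) - A) + (1 / A) * q) = cap_weight (DIM('a) - 1) A \<rho> q"
      by (simp only: cap_weight_def Let_def)
  qed
  finally have "ennreal A * emeasure lborel (cball a \<rho>) = ennreal A * ennreal \<bar>1 / A\<bar> * (\<integral>\<^sup>+q. cap_weight (DIM('a) - 1) A \<rho> q \<partial>lborel)"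
    by (simp add: mult.assoc)
  also have "ennreal A * ennreal \<bar>1 / A\<bar> = 1" using A by (simp add: ennreal_mult[symmetric])
  finally show ?thesis by simp
qed

text \<open>A crude estimate, sufficient for the balls around the null set that a Vitali family leaves
  uncovered.\<close>

lemma hausdorff_content_small_piece_le:
  fixes a :: "'a::euclidean_space"
  assumes r: "0 \<le> r" "r \<le> 1" and a: "norm a \<le> 1" "0 < \<rho>" and \<delta>: "2 * \<rho> \<le> \<delta>"
  shows "hausdorff_content k \<delta> (cball a \<rho> \<inter> sphere 0 r)
    \<le> ennreal (unit_ball_vol (real k) * \<rho> ^ k) * indicator {(norm a)\<^sup>2 / 2 - \<rho>..(norm a)\<^sup>2 / 2 + \<rho>} (r\<^sup>2 / 2)"
proof (cases "cball a \<rho> \<inter> sphere 0 r = {}")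
  case True
  then show ?thesis using a \<delta> by (simp add: hausdorff_content_empty)
next
  case False
  then obtain x where "x \<in> cball a \<rho> \<inter> sphere 0 r" by blast
  then have x: "dist a x \<le> \<rho>" "norm x = r" by auto
  have "\<bar>r - norm a\<bar> \<le> \<rho>" using x norm_triangle_ineq3[of x a] by (simp add: dist_norm norm_minus_commute)
  then have "\<bar>r - norm a\<bar> * ((r + norm a) / 2) \<le> \<rho> * 1"
    using r a by (intro mult_mono) auto
  moreover have "\<bar>r - norm a\<bar> * ((r + norm a) / 2) = \<bar>r\<^sup>2 / 2 - (norm a)\<^sup>2 / 2\<bar>"
  proof -
    have "r\<^sup>2 / 2 - (norm a)\<^sup>2 / 2 = (r - norm a) * ((r + norm a) / 2)" by (simp add: power2_eq_square field_simps)
    then show ?thesis using r by (simp only: abs_mult) simp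
  qed
  ultimately have q: "r\<^sup>2 / 2 \<in> {(norm a)\<^sup>2 / 2 - \<rho>..(norm a)\<^sup>2 / 2 + \<rho>}" by (auto simp: abs_le_iff)
  have "hausdorff_content k \<delta> (cball a \<rho> \<inter> sphere 0 r) \<le> hausdorff_content k \<delta> (cball a \<rho>)"
    by (intro hausdorff_content_mono) auto
  also have "\<dots> \<le> hausdorff_weight k (cball a \<rho>)"
    using a \<delta> by (intro hausdorff_content_single_le) auto
  also have "\<dots> = ennreal (unit_ball_vol (real k) * \<rho> ^ k)" using a by (simp add: hausdorff_weight_def)
  finally show ?thesis using q by simp
qed

lemma borel_measurable_nn_integral_countable:
  assumes I: "countable I" and f: "\<And>i. i \<in> I \<Longrightarrow> f i \<in> borel_measurable M"
  shows "(\<lambda>x. \<integral>\<^sup>+i. f i x \<partial>count_space I) \<in> borel_measurable M"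
proof -
  interpret sigma_finite_measure "count_space I"
    by (rule sigma_finite_measure_count_space_countable[OF I])
  have "(\<lambda>p. f (fst p) (snd p)) \<in> borel_measurable (count_space I \<Otimes>\<^sub>M M)"
    by (rule measurable_pair_measure_countable1) (use I f in auto)
  from measurable_pair_swap[OF this]
  have "(\<lambda>(x, i). f i x) \<in> borel_measurable (M \<Otimes>\<^sub>M count_space I)"
    by (simp add: split_def)
  then show ?thesis by (rule borel_measurable_nn_integral)
qed

lemma negligible_vitali_cover:
  fixes M U :: "'a::euclidean_space set"
  assumes M: "negligible M" "M \<subseteq> U" and U: "open U" and \<epsilon>: "\<epsilon> > 0" and B: "B > 0"
  obtains C where "countable C" "C \<subseteq> {(a, \<rho>). 0 < \<rho> \<and> \<rho> \<le> B \<and> cball a \<rho> \<subseteq> U}"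
    "M \<subseteq> (\<Union>(a, \<rho>)\<in>C. cball a (5 * \<rho>))"
    "(\<integral>\<^sup>+i. emeasure lborel (cball (fst i) (snd i)) \<partial>count_space C) \<le> ennreal \<epsilon>"
proof -
  have Ms: "M \<in> null_sets lebesgue" using M by (simp add: negligible_iff_null_sets)
  obtain T where T: "open T" "M \<subseteq> T" "T - M \<in> lmeasurable" "emeasure lebesgue (T - M) < ennreal \<epsilon>"
    using sets_lebesgue_outer_open[of M \<epsilon>] Ms \<epsilon> by blast
  have "emeasure lborel T = emeasure lebesgue T" using T(1) by simp
  also have "\<dots> = emeasure lebesgue (T - M)" using T(1) Ms by (subst emeasure_Diff_null_set) auto
  finally have LT: "emeasure lborel T < ennreal \<epsilon>" using T(4) by simp
  define K where "K = {(a, \<rho>). 0 < \<rho> \<and> \<rho> \<le> B \<and> cball a \<rho> \<subseteq> T \<inter> U}"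
  have cov: "M \<subseteq> (\<Union>i\<in>K. cball (fst i) (snd i))"
  proof
    fix x assume "x \<in> M"
    then have "x \<in> T \<inter> U" using T(2) M(2) by auto
    then obtain e where e: "e > 0" "cball x e \<subseteq> T \<inter> U" using T(1) U open_contains_cball[of "T \<inter> U"] by blast
    have "cball x (min e B) \<subseteq> T \<inter> U" by (rule order_trans[OF subset_cball e(2)]) simp
    then show "x \<in> (\<Union>i\<in>K. cball (fst i) (snd i))"
      using e B by (intro UN_I[of "(x, min e B)"]) (auto simp: K_def)
  qed
  have KD: "0 < snd i \<and> snd i \<le> B" and KT: "cball (fst i) (snd i) \<subseteq> T \<inter> U" if "i \<in> K" for i
    using that unfolding K_def split_def by blast+
  obtain C where C: "countable C" "C \<subseteq> K"
    "pairwise (\<lambda>i j. disjnt (cball (fst i) (snd i)) (cball (fst j) (snd j))) C"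
    "M \<subseteq> (\<Union>i\<in>C. cball (fst i) (5 * snd i))"
    by (rule Vitali_covering_lemma_cballs[where S = M and K = K and r = snd and B = B and a = fst, OF cov KD])
  have "(\<integral>\<^sup>+i. emeasure lborel (cball (fst i) (snd i)) \<partial>count_space C) = emeasure lborel (\<Union>i\<in>C. cball (fst i) (snd i))"
    using C(1,3) by (intro emeasure_UN_countable[symmetric]) (auto simp: disjoint_family_on_def pairwise_def disjnt_def)
  also have "\<dots> \<le> emeasure lborel T"
  proof (rule emeasure_mono)
    show "(\<Union>i\<in>C. cball (fst i) (snd i)) \<subseteq> T" using KT C(2) by blast
  qed (use T(1) in simp)
  finally have "(\<integral>\<^sup>+i. emeasure lborel (cball (fst i) (snd i)) \<partial>count_space C) \<le> ennreal \<epsilon>"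
    using LT by (meson less_imp_le order_trans)
  then show ?thesis
    using C by (intro that[of C]) (auto simp: K_def split_def)
qed

text \<open>Contents of spheres of different radii are compared with different bounds on the diameters, so
  that scaling is exact.\<close>

lemma hausdorff_content_sphere_scale:
  fixes r :: real
  assumes "r > 0"
  shows "ennreal (r ^ k) * hausdorff_content k \<delta> (sphere 0 1 :: 'a::euclidean_space set)
     \<le> hausdorff_content k (r * \<delta>) (sphere 0 r :: 'a set)"
proof -
  have img: "(\<lambda>x. (1 / r) *\<^sub>R x) ` sphere 0 r = (sphere 0 1 :: 'a set)"
    using assms by (subst sphere_scale) auto
  have "hausdorff_content k (1 / r * (r * \<delta>)) ((\<lambda>x. (1 / r) *\<^sub>R x) ` (sphere 0 r :: 'a set))
      \<le> ennreal ((1 / r) ^ k) * hausdorff_content k (r * \<delta>) (sphere 0 r :: 'a set)"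
    using assms by (intro hausdorff_content_lipschitz_image) (auto simp: dist_norm scaleR_diff_right[symmetric] norm_divide divide_simps)
  then have "ennreal (r ^ k) * hausdorff_content k \<delta> (sphere 0 1 :: 'a set)
    \<le> ennreal (r ^ k) * (ennreal ((1 / r) ^ k) * hausdorff_content k (r * \<delta>) (sphere 0 r :: 'a set))"
    using assms by (intro mult_left_mono) (auto simp: img)
  also have "\<dots> = hausdorff_content k (r * \<delta>) (sphere 0 r :: 'a set)"
    using assms by (simp add: mult.assoc[symmetric] ennreal_mult[symmetric] power_mult_distrib[symmetric])
  finally show ?thesis .
qed

text \<open>Let \<open>U\<close> be the open shell, \<open>C1\<close> a Vitali family filling it and \<open>C2\<close> a family of small total volume whose
  fivefold enlargements cover the rest. For each \<open>q\<close> the sphere of radius \<open>sqrt (2 * q)\<close> is covered by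
  its intersections with these balls. The resulting inequality for contents has explicit
  measurable functions of \<open>q\<close> on the right, so it can be integrated over the range of \<open>q\<close>, an interval
  of length \<open>\<eta> - \<eta>\<^sup>2 / 2\<close>. The balls of \<open>C1\<close> contribute at most the volume of the shell, those of \<open>C2\<close> at most
  a multiple of \<open>\<epsilon>\<close>.\<close>

lemma hausdorff_content_sphere_le_shell:
  fixes \<eta> \<delta> :: real
  assumes D: "DIM('a::euclidean_space) \<ge> 2" and \<eta>: "0 < \<eta>" "\<eta> < 1" and \<delta>: "\<delta> > 0"
  shows "ennreal ((\<eta> - \<eta>\<^sup>2 / 2) * (1 - \<eta>) ^ (DIM('a) - 1)) * hausdorff_content (DIM('a) - 1) \<delta> (sphere 0 1 :: 'a set)
    \<le> emeasure lborel (cball 0 1 - ball 0 (1 - \<eta>) :: 'a set)"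
proof (rule ennreal_le_epsilon)
  fix \<epsilon>' :: real assume \<epsilon>': "\<epsilon>' > 0"
  define k where "k = DIM('a) - 1"
  have Suck: "DIM('a) = Suc k" using D by (simp add: k_def)
  define V where "V = unit_ball_vol (real DIM('a))"
  have V: "V > 0" by (simp add: V_def)
  \<comment> \<open>A ball of radius \<open>\<rho>\<close>, enlarged to \<open>5 \<rho>\<close>, has weight \<open>V\<^sub>k (5 \<rho>)\<^sup>k\<close> and meets the spheres for \<open>q\<close> in an
    interval of length \<open>10 \<rho>\<close>; relative to its volume \<open>V \<rho>\<^sup>k\<^sup>+\<^sup>1\<close> this is the following factor.\<close>
  define const where "const = 10 * 5 ^ k * unit_ball_vol (real k) / V"
  have const: "const > 0" using V by (simp add: const_def)
  define \<epsilon> where "\<epsilon> = \<epsilon>' / const"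
  have \<epsilon>: "\<epsilon> > 0" using \<epsilon>' const by (simp add: \<epsilon>_def)
  define U where "U = ball (0::'a) 1 - cball 0 (1 - \<eta>)"
  have U: "open U" by (simp add: U_def open_Diff)
  \<comment> \<open>Even after enlargement by 5, the balls have diameter at most \<open>r \<delta>\<close> for every radius \<open>r\<close> in
    the shell.\<close>
  define B where "B = (1 - \<eta>) * \<delta> / 10"
  have B: "B > 0" using \<eta> \<delta> by (simp add: B_def)
  have Unorm: "1 - \<eta> < norm x" "norm x < 1" if "x \<in> U" for x using that by (auto simp: U_def)
  have ball_U: "\<rho> < norm a" "norm a \<le> 1" if "cball a \<rho> \<subseteq> U" "0 < \<rho>" for a :: 'a and \<rho>
  proof -
    have aU: "a \<in> U" using that by auto
    show "norm a \<le> 1" using Unorm[OF aU] by simp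
    have "0 \<notin> U" using Unorm(1)[of 0] \<eta> by auto
    then have "0 \<notin> cball a \<rho>" using that(1) by blast
    then show "\<rho> < norm a" by simp
  qed
  define K where "K = {(a, \<rho>). 0 < \<rho> \<and> \<rho> \<le> B \<and> cball a \<rho> \<subseteq> U}"
  have cov: "\<exists>i. i \<in> K \<and> x \<in> cball (fst i) (snd i) \<and> snd i < d" if "x \<in> U" "0 < d" for x d
  proof -
    obtain e where e: "e > 0" "cball x e \<subseteq> U" using U \<open>x \<in> U\<close> unfolding open_contains_cball by meson
    have "cball x (min e (min B (d / 2))) \<subseteq> U" by (rule order_trans[OF subset_cball e(2)]) simp
    then show ?thesis using e B that by (intro exI[of _ "(x, min e (min B (d / 2)))"]) (auto simp: K_def)
  qed
  have KD: "0 < snd i" "snd i \<le> B" "cball (fst i) (snd i) \<subseteq> U" if "i \<in> K" for i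
    using that unfolding K_def split_def by blast+
  obtain C1 where C1: "countable C1" "C1 \<subseteq> K"
    "pairwise (\<lambda>i j. disjnt (cball (fst i) (snd i)) (cball (fst j) (snd j))) C1"
    "negligible (U - (\<Union>i\<in>C1. cball (fst i) (snd i)))"
    by (rule Vitali_covering_theorem_cballs[where K = K and r = snd and S = U and a = fst, OF KD(1) cov])
  obtain C2 where C2: "countable C2" "C2 \<subseteq> K"
    "U - (\<Union>i\<in>C1. cball (fst i) (snd i)) \<subseteq> (\<Union>(a, \<rho>)\<in>C2. cball a (5 * \<rho>))"
    "(\<integral>\<^sup>+i. emeasure lborel (cball (fst i) (snd i)) \<partial>count_space C2) \<le> ennreal \<epsilon>"
    by (rule negligible_vitali_cover[OF C1(4) Diff_subset U \<epsilon> B, folded K_def])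
  define f1 where "f1 i q = cap_weight k (norm (fst i)) (snd i) q" for i :: "'a \<times> real" and q :: real
  define f2 where "f2 i q = ennreal (unit_ball_vol (real k) * (5 * snd i) ^ k)
    * indicator {(norm (fst i))\<^sup>2 / 2 - 5 * snd i..(norm (fst i))\<^sup>2 / 2 + 5 * snd i} q" for i :: "'a \<times> real" and q :: real
  define H where "H = ennreal ((1 - \<eta>) ^ k) * hausdorff_content k \<delta> (sphere 0 1 :: 'a set)"
  have key: "indicator {(1 - \<eta>)\<^sup>2 / 2<..<1 / 2} q * H
    \<le> (\<integral>\<^sup>+i. f1 i q \<partial>count_space C1) + (\<integral>\<^sup>+i. f2 i q \<partial>count_space C2)" for q
  proof (cases "q \<in> {(1 - \<eta>)\<^sup>2 / 2<..<1 / 2}")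
    case True
    define r where "r = sqrt (2 * q)"
    have q: "(1 - \<eta>)\<^sup>2 < 2 * q" "2 * q < 1" using True by auto
    have q0: "0 \<le> q" using q(1) zero_le_power2[of "1 - \<eta>"] by linarith
    have r2: "r\<^sup>2 / 2 = q" using q0 by (simp add: r_def)
    have r: "1 - \<eta> < r" "r < 1"
      unfolding r_def using real_less_rsqrt[OF q(1)] real_sqrt_less_mono[OF q(2)] by simp_all
    have r0: "0 < r" using r(1) \<eta>(2) by linarith
    have sph: "sphere 0 r \<subseteq> U" using r by (auto simp: U_def)
    have "(1 - \<eta>) * \<delta> \<le> r * \<delta>" using r \<delta> by (intro mult_right_mono) auto
    then have rB: "10 * B \<le> r * \<delta>" by (simp add: B_def)
    have rd: "r * \<delta> > 0" using r0 \<delta> by simp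
    have "H \<le> ennreal (r ^ k) * hausdorff_content k \<delta> (sphere 0 1 :: 'a set)"
      unfolding H_def using r \<eta> by (intro mult_right_mono ennreal_leI power_mono) auto
    also have "\<dots> \<le> hausdorff_content k (r * \<delta>) (sphere 0 r :: 'a set)"
      by (rule hausdorff_content_sphere_scale[OF r0])
    also have "\<dots> \<le> hausdorff_content k (r * \<delta>) ((\<Union>i\<in>C1. cball (fst i) (snd i) \<inter> sphere 0 r) \<union> (\<Union>i\<in>C2. cball (fst i) (5 * snd i) \<inter> sphere 0 r))"
      using C2(3) sph by (intro hausdorff_content_mono) (fastforce simp: split_def)
    also have "\<dots> \<le> hausdorff_content k (r * \<delta>) (\<Union>i\<in>C1. cball (fst i) (snd i) \<inter> sphere 0 r)
        + hausdorff_content k (r * \<delta>) (\<Union>i\<in>C2. cball (fst i) (5 * snd i) \<inter> sphere 0 r)"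
      by (rule hausdorff_content_Un_le[OF rd])
    also have "\<dots> \<le> (\<integral>\<^sup>+i. hausdorff_content k (r * \<delta>) (cball (fst i) (snd i) \<inter> sphere 0 r) \<partial>count_space C1)
        + (\<integral>\<^sup>+i. hausdorff_content k (r * \<delta>) (cball (fst i) (5 * snd i) \<inter> sphere 0 r) \<partial>count_space C2)"
      by (intro add_mono hausdorff_content_UN_countable_le C1 C2 rd)
    also have "\<dots> \<le> (\<integral>\<^sup>+i. f1 i q \<partial>count_space C1) + (\<integral>\<^sup>+i. f2 i q \<partial>count_space C2)"
    proof (intro add_mono nn_integral_mono)
      fix i assume "i \<in> space (count_space C1)"
      then have i: "0 < snd i" "snd i \<le> B" "cball (fst i) (snd i) \<subseteq> U" using KD[of i] C1(2) by auto
      then show "hausdorff_content k (r * \<delta>) (cball (fst i) (snd i) \<inter> sphere 0 r) \<le> f1 i q"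
        unfolding f1_def r2[symmetric] using r0 rB ball_U[OF i(3,1)]
        by (intro hausdorff_content_spherical_cap_le) auto
    next
      fix i assume "i \<in> space (count_space C2)"
      then have i: "0 < snd i" "snd i \<le> B" "cball (fst i) (snd i) \<subseteq> U" using KD[of i] C2(2) by auto
      then show "hausdorff_content k (r * \<delta>) (cball (fst i) (5 * snd i) \<inter> sphere 0 r) \<le> f2 i q"
        unfolding f2_def r2[symmetric] using r0 r rB ball_U[OF i(3,1)]
        by (intro hausdorff_content_small_piece_le) auto
    qed
    finally show ?thesis using True by simp
  qed simp
  have [measurable]: "f1 i \<in> borel_measurable borel" "f2 i \<in> borel_measurable borel" for i
    unfolding f1_def[abs_def] f2_def[abs_def] by measurable
  have int1: "(\<integral>\<^sup>+q. f1 i q \<partial>lborel) \<le> emeasure lborel (cball (fst i) (snd i))" if "i \<in> C1" for i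
  proof -
    have i: "0 < snd i" "cball (fst i) (snd i) \<subseteq> U" using KD[of i] C1(2) that by auto
    have "(\<integral>\<^sup>+q. f1 i q \<partial>lborel) = ennreal (norm (fst i)) * emeasure lborel (cball (fst i) (snd i))"
      unfolding f1_def k_def using ball_U[OF i(2,1)] i by (intro nn_integral_cap_weight[OF D]) auto
    also have "\<dots> \<le> 1 * emeasure lborel (cball (fst i) (snd i))"
      using ball_U[OF i(2,1)] by (intro mult_right_mono) auto
    finally show ?thesis by simp
  qed
  have int2: "(\<integral>\<^sup>+q. f2 i q \<partial>lborel) = ennreal const * emeasure lborel (cball (fst i) (snd i))" if "i \<in> C2" for i
  proof -
    have i: "0 < snd i" using KD[of i] C2(2) that by auto
    have "(\<integral>\<^sup>+q. f2 i q \<partial>lborel) = ennreal (unit_ball_vol (real k) * (5 * snd i) ^ k) * ennreal (10 * snd i)"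
      unfolding f2_def using i by (subst nn_integral_cmult) auto
    also have "\<dots> = ennreal (unit_ball_vol (real k) * (5 * snd i) ^ k * (10 * snd i))"
      using i by (intro ennreal_mult[symmetric]) auto
    also have "unit_ball_vol (real k) * (5 * snd i) ^ k * (10 * snd i) = const * (V * snd i ^ Suc k)"
      using V by (simp add: const_def power_mult_distrib)
    also have "ennreal \<dots> = ennreal const * ennreal (V * snd i ^ Suc k)"
      using const V i by (intro ennreal_mult) auto
    also have "ennreal (V * snd i ^ Suc k) = emeasure lborel (cball (fst i) (snd i))"
      using i by (simp only: emeasure_cball V_def Suck less_imp_le)
    finally show ?thesis .
  qed
  have len: "emeasure lborel {(1 - \<eta>)\<^sup>2 / 2<..<1 / 2} = ennreal (\<eta> - \<eta>\<^sup>2 / 2)"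
  proof -
    have "(1 - \<eta>)\<^sup>2 \<le> 1" using \<eta> by (intro power_le_one) auto
    then show ?thesis by (simp add: power2_diff field_simps)
  qed
  have "\<eta>\<^sup>2 \<le> \<eta>" using \<eta> by (simp add: power2_eq_square mult_left_le)
  then have "ennreal ((\<eta> - \<eta>\<^sup>2 / 2) * (1 - \<eta>) ^ k) * hausdorff_content k \<delta> (sphere 0 1 :: 'a set)
      = ennreal (\<eta> - \<eta>\<^sup>2 / 2) * H"
    unfolding H_def using \<eta> by (subst ennreal_mult) (auto simp: mult.assoc)
  also have "\<dots> = (\<integral>\<^sup>+q. indicator {(1 - \<eta>)\<^sup>2 / 2<..<1 / 2} q * H \<partial>lborel)"
    by (subst nn_integral_multc) (auto simp: len simp del: emeasure_lborel_Ioo)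
  also have "\<dots> \<le> (\<integral>\<^sup>+q. (\<integral>\<^sup>+i. f1 i q \<partial>count_space C1) + (\<integral>\<^sup>+i. f2 i q \<partial>count_space C2) \<partial>lborel)"
    by (intro nn_integral_mono key)
  also have "\<dots> = (\<integral>\<^sup>+q. (\<integral>\<^sup>+i. f1 i q \<partial>count_space C1) \<partial>lborel) + (\<integral>\<^sup>+q. (\<integral>\<^sup>+i. f2 i q \<partial>count_space C2) \<partial>lborel)"
    by (intro nn_integral_add borel_measurable_nn_integral_countable C1 C2) auto
  also have "(\<integral>\<^sup>+q. (\<integral>\<^sup>+i. f1 i q \<partial>count_space C1) \<partial>lborel) = (\<integral>\<^sup>+i. (\<integral>\<^sup>+q. f1 i q \<partial>lborel) \<partial>count_space C1)"
    by (intro nn_integral_count_space_nn_integral C1) auto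
  also have "(\<integral>\<^sup>+q. (\<integral>\<^sup>+i. f2 i q \<partial>count_space C2) \<partial>lborel) = (\<integral>\<^sup>+i. (\<integral>\<^sup>+q. f2 i q \<partial>lborel) \<partial>count_space C2)"
    by (intro nn_integral_count_space_nn_integral C2) auto
  also have "(\<integral>\<^sup>+i. (\<integral>\<^sup>+q. f1 i q \<partial>lborel) \<partial>count_space C1) \<le> (\<integral>\<^sup>+i. emeasure lborel (cball (fst i) (snd i)) \<partial>count_space C1)"
    by (intro nn_integral_mono int1) simp
  also have "\<dots> = emeasure lborel (\<Union>i\<in>C1. cball (fst i) (snd i))"
    using C1(1,3) by (intro emeasure_UN_countable[symmetric]) (auto simp: disjoint_family_on_def pairwise_def disjnt_def)
  also have "\<dots> \<le> emeasure lborel (cball 0 1 - ball 0 (1 - \<eta>) :: 'a set)"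
      proof (rule emeasure_mono)
    have "(\<Union>i\<in>C1. cball (fst i) (snd i)) \<subseteq> U" using KD(3) C1(2) by blast
    then show "(\<Union>i\<in>C1. cball (fst i) (snd i)) \<subseteq> cball 0 1 - ball 0 (1 - \<eta>)" by (auto simp: U_def dest!: subsetD)
  qed simp
  also have "(\<integral>\<^sup>+i. (\<integral>\<^sup>+q. f2 i q \<partial>lborel) \<partial>count_space C2) = (\<integral>\<^sup>+i. ennreal const * emeasure lborel (cball (fst i) (snd i)) \<partial>count_space C2)"
    by (intro nn_integral_cong int2) simp
  also have "\<dots> = ennreal const * (\<integral>\<^sup>+i. emeasure lborel (cball (fst i) (snd i)) \<partial>count_space C2)"
    by (rule nn_integral_cmult) simp
  also have "\<dots> \<le> ennreal const * ennreal \<epsilon>" by (intro mult_left_mono C2) simp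
  also have "\<dots> = ennreal \<epsilon>'" using const \<epsilon> by (simp add: ennreal_mult[symmetric] \<epsilon>_def)
  finally show "ennreal ((\<eta> - \<eta>\<^sup>2 / 2) * (1 - \<eta>) ^ (DIM('a) - 1)) * hausdorff_content (DIM('a) - 1) \<delta> (sphere 0 1 :: 'a set)
    \<le> emeasure lborel (cball 0 1 - ball 0 (1 - \<eta>) :: 'a set) + ennreal \<epsilon>'"
    by (simp add: k_def)
qed


section \<open>Integration over the sphere\<close>

text \<open>The shell estimate holds for every \<open>\<eta>\<close> while the content on the left does not depend on \<open>\<eta>\<close>, so \<open>\<eta>\<close> may
  tend to \<open>0\<close>.\<close>

lemma hausdorff_outer_measure_sphere_le:
  assumes D: "CARD('n) \<ge> 2"
  shows "hausdorff_outer_measure (CARD('n) - 1) (sphere 0 1 :: (real^'n) set)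
    \<le> ennreal (real CARD('n) * unit_ball_vol (real CARD('n)))"
  unfolding hausdorff_outer_measure_def
proof (rule SUP_least)
  fix \<delta> :: real assume "\<delta> \<in> {0<..}"
  then have \<delta>: "\<delta> > 0" by simp
  define g where "g \<eta> = unit_ball_vol (real CARD('n)) * ((1 - (1 - \<eta>) ^ CARD('n)) / \<eta>) / ((1 - \<eta> / 2) * (1 - \<eta>) ^ (CARD('n) - 1))" for \<eta> :: real
  have "(g \<longlongrightarrow> unit_ball_vol (real CARD('n)) * real CARD('n) / ((1 - 0 / 2) * (1 - 0) ^ (CARD('n) - 1))) (at_right 0)"
    unfolding g_def by (intro tendsto_intros tendsto_shell_ratio) auto
  then have lim: "((\<lambda>\<eta>. ennreal (g \<eta>)) \<longlongrightarrow> ennreal (real CARD('n) * unit_ball_vol (real CARD('n)))) (at_right 0)"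
    by (intro tendsto_ennrealI) (simp add: mult.commute)
  have "eventually (\<lambda>\<eta>::real. 0 < \<eta> \<and> \<eta> < 1) (at_right 0)"
    unfolding eventually_at_right_field by (auto intro: exI[of _ 1])
  then have "eventually (\<lambda>\<eta>. hausdorff_content (CARD('n) - 1) \<delta> (sphere 0 1 :: (real^'n) set) \<le> ennreal (g \<eta>)) (at_right 0)"
  proof eventually_elim
    case (elim \<eta>)
    define c where "c = (\<eta> - \<eta>\<^sup>2 / 2) * (1 - \<eta>) ^ (CARD('n) - 1)"
    have "\<eta> - \<eta>\<^sup>2 / 2 = \<eta> * (1 - \<eta> / 2)" by (simp add: power2_eq_square algebra_simps)
    then have c': "c = \<eta> * ((1 - \<eta> / 2) * (1 - \<eta>) ^ (CARD('n) - 1))" by (simp add: c_def)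
    have c: "c > 0" using elim unfolding c' by (intro mult_pos_pos zero_less_power) auto
    have g: "g \<eta> = (1 / c) * (unit_ball_vol (real CARD('n)) * (1 - (1 - \<eta>) ^ CARD('n)))"
    proof -
      have "V * (X / \<eta>) / E = (1 / (\<eta> * E)) * (V * X)" for V X E :: real by simp
      then show ?thesis unfolding g_def c' .
    qed
    have "hausdorff_content (CARD('n) - 1) \<delta> (sphere 0 1 :: (real^'n) set)
      = ennreal (1 / c) * (ennreal c * hausdorff_content (CARD('n) - 1) \<delta> (sphere 0 1 :: (real^'n) set))"
      using c by (simp add: mult.assoc[symmetric] ennreal_mult[symmetric])
    also have "\<dots> \<le> ennreal (1 / c) * ennreal (unit_ball_vol (real CARD('n)) * (1 - (1 - \<eta>) ^ CARD('n)))"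
      using hausdorff_content_sphere_le_shell[where 'a = "real^'n" and \<eta> = \<eta> and \<delta> = \<delta>] elim D \<delta>
      by (intro mult_left_mono) (auto simp: c_def emeasure_shell)
    also have "\<dots> = ennreal (g \<eta>)"
      unfolding g using c elim by (intro ennreal_mult[symmetric]) (auto intro!: mult_nonneg_nonneg power_le_one)
    finally show ?case .
  qed
  then show "hausdorff_content (CARD('n) - 1) \<delta> (sphere 0 1 :: (real^'n) set)
     \<le> ennreal (real CARD('n) * unit_ball_vol (real CARD('n)))"
    by (intro tendsto_lowerbound[OF lim]) auto
qed

lemma emeasure_hausdorff_sphere:
  assumes D: "CARD('n) \<ge> 2"
  shows "emeasure (hausdorff_measure (CARD('n) - 1)) (sphere 0 1 :: (real^'n) set)
    = ennreal (real CARD('n) * unit_ball_vol (real CARD('n)))"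
  using hausdorff_outer_measure_sphere_le[OF D] hausdorff_outer_measure_sphere_ge[OF D]
  by (subst emeasure_hausdorff_measure) (auto intro!: borel_closed antisym)

definition sphere_measure :: "(real^'n) measure" where
  "sphere_measure = restrict_space (hausdorff_measure (CARD('n) - 1)) (sphere 0 1)"

lemma sphere_in_borel[measurable]: "sphere (a::'a::euclidean_space) r \<in> sets borel"
  by (rule borel_closed) simp

lemma space_sphere_measure[simp]: "space sphere_measure = sphere 0 1"
  by (simp add: sphere_measure_def space_restrict_space)

lemma sets_sphere_measure[measurable_cong]: "sets (sphere_measure :: (real^'n) measure) = sets (restrict_space borel (sphere 0 1))"
  unfolding sphere_measure_def by (rule sets_restrict_space_cong) simp

lemma measurable_ident_sphere_measure[measurable]:
  "(\<lambda>x. x) \<in> measurable sphere_measure (borel :: (real^'n) measure)"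
  by (subst measurable_cong_sets[OF sets_sphere_measure refl])
     (rule measurable_restrict_space1, rule measurable_ident_sets, rule refl)

lemma emeasure_space_sphere_measure:
  assumes D: "CARD('n) \<ge> 2"
  shows "emeasure (sphere_measure :: (real^'n) measure) (sphere 0 1) = ennreal (real CARD('n) * unit_ball_vol (real CARD('n)))"
proof -
  have "emeasure (sphere_measure :: (real^'n) measure) (sphere 0 1) = emeasure (hausdorff_measure (CARD('n) - 1)) (sphere 0 1 :: (real^'n) set)"
    unfolding sphere_measure_def by (subst emeasure_restrict_space) auto
  then show ?thesis unfolding emeasure_hausdorff_sphere[OF D] .
qed

lemma finite_measure_sphere_measure:
  assumes "CARD('n) \<ge> 2"
  shows "finite_measure (sphere_measure :: (real^'n) measure)"
  by standard (simp add: emeasure_space_sphere_measure[OF assms])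

lemma orthogonal_measurable_sphere_measure:
  fixes T :: "real^'n \<Rightarrow> real^'n"
  assumes T: "orthogonal_transformation T"
  shows "T \<in> measurable sphere_measure sphere_measure"
  using T borel_measurable_orthogonal[OF T]
  by (subst measurable_cong_sets[OF sets_sphere_measure sets_sphere_measure])
     (auto intro!: measurable_restrict_space3 simp: orthogonal_transformation_norm)

lemma sphere_measure_distr_orthogonal:
  fixes T :: "real^'n \<Rightarrow> real^'n"
  assumes T: "orthogonal_transformation T"
  shows "distr sphere_measure sphere_measure T = sphere_measure"
proof (rule measure_eqI)
  note [measurable] = borel_measurable_orthogonal[OF T] orthogonal_measurable_sphere_measure[OF T]
  fix A assume "A \<in> sets (distr sphere_measure sphere_measure T)"
  then have A: "A \<in> sets sphere_measure" by simp
  then have A': "A \<in> sets borel" "A \<subseteq> sphere 0 1"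
    by (auto simp: sets_sphere_measure sets_restrict_space)
  have ve: "T -` A \<inter> space sphere_measure = T -` A"
    using A'(2) T by (auto simp: orthogonal_transformation_norm subset_iff)
  have "T -` A \<inter> space borel \<in> sets borel" using A'(1) by measurable
  then have TA: "T -` A \<in> sets borel" "T -` A \<subseteq> sphere 0 1" using ve by auto
  have "emeasure (distr sphere_measure sphere_measure T) A = emeasure sphere_measure (T -` A)"
    using A ve by (simp add: emeasure_distr)
  also have "\<dots> = emeasure (hausdorff_measure (CARD('n) - 1)) (T -` A)"
    unfolding sphere_measure_def using TA by (subst emeasure_restrict_space) auto
  also have "\<dots> = emeasure (distr (hausdorff_measure (CARD('n) - 1)) (hausdorff_measure (CARD('n) - 1)) T) A"
    using A' by (subst emeasure_distr) (auto intro: measurable_cong_sets[THEN equalityD2, THEN subsetD])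
  also have "\<dots> = emeasure sphere_measure A"
    unfolding hausdorff_measure_distr_orthogonal[OF T] unfolding sphere_measure_def
    using A' by (subst emeasure_restrict_space) auto
  finally show "emeasure (distr sphere_measure sphere_measure T) A = emeasure sphere_measure A" .
qed simp

lemma nn_integral_sphere_orthogonal:
  fixes T :: "real^'n \<Rightarrow> real^'n"
  assumes T: "orthogonal_transformation T" and f[measurable]: "f \<in> borel_measurable sphere_measure"
  shows "(\<integral>\<^sup>+x. f (T x) \<partial>sphere_measure) = integral\<^sup>N sphere_measure f"
  using orthogonal_measurable_sphere_measure[OF T]
  by (subst (2) sphere_measure_distr_orthogonal[OF T, symmetric]) (auto simp: nn_integral_distr)

lemma nn_integral_norm_cball:
  "(\<integral>\<^sup>+x. ennreal (norm x) * indicator (cball (0::'a::euclidean_space) 1) x \<partial>lborel)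
    = ennreal (real DIM('a) * unit_ball_vol (real DIM('a)) / real (DIM('a) + 1))"
proof -
  let ?N = "DIM('a)" and ?V = "unit_ball_vol (real DIM('a))"
  have "(\<integral>\<^sup>+x. ennreal (norm x) * indicator (cball (0::'a) 1) x \<partial>lborel)
     = (\<integral>\<^sup>+x. (\<integral>\<^sup>+t. indicator {0..1} t * indicator (cball (0::'a) 1 - cball 0 t) x \<partial>lborel) \<partial>lborel)"
  proof (intro nn_integral_cong)
    fix x :: 'a
    have "(\<integral>\<^sup>+t. indicator {0..1} t * indicator (cball (0::'a) 1 - cball 0 t) x \<partial>lborel)
      = (\<integral>\<^sup>+t. indicator (cball 0 1) x * indicator {0..<norm x} t \<partial>lborel)"
      by (intro nn_integral_cong) (auto simp: indicator_def)
    also have "\<dots> = ennreal (norm x) * indicator (cball (0::'a) 1) x"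
      by (subst nn_integral_cmult) (auto simp: mult.commute)
    finally show "ennreal (norm x) * indicator (cball (0::'a) 1) x
      = (\<integral>\<^sup>+t. indicator {0..1} t * indicator (cball (0::'a) 1 - cball 0 t) x \<partial>lborel)" by simp
  qed
  also have "\<dots> = (\<integral>\<^sup>+t. (\<integral>\<^sup>+x. indicator {0..1} t * indicator (cball (0::'a) 1 - cball 0 t) x \<partial>lborel) \<partial>lborel)"
  proof (rule lborel_pair.Fubini')
    have "(\<lambda>(t, x). indicator {0..1} t * indicator (cball (0::'a) 1 - cball 0 t) x :: ennreal)
      = (\<lambda>p. indicator {p. 0 \<le> fst p \<and> fst p \<le> 1 \<and> norm (snd p) \<le> 1 \<and> fst p < norm (snd p)} p)"
      by (auto simp: indicator_def fun_eq_iff)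
    also have "\<dots> \<in> borel_measurable (lborel \<Otimes>\<^sub>M lborel)" by measurable
    finally show "(\<lambda>(t, x). indicator {0..1} t * indicator (cball (0::'a) 1 - cball 0 t) x :: ennreal) \<in> borel_measurable (lborel \<Otimes>\<^sub>M lborel)" .
  qed
  also have "\<dots> = (\<integral>\<^sup>+t. ennreal (?V * (1 - t ^ ?N)) * indicator {0..1} t \<partial>lborel)"
  proof (intro nn_integral_cong)
    fix t :: real
    show "(\<integral>\<^sup>+x. indicator {0..1} t * indicator (cball (0::'a) 1 - cball 0 t) x \<partial>lborel) = ennreal (?V * (1 - t ^ ?N)) * indicator {0..1} t"
    proof (cases "t \<in> {0..1}")
      case True
      have "emeasure lborel (cball (0::'a) 1 - cball 0 t) = emeasure lborel (cball (0::'a) 1) - emeasure lborel (cball (0::'a) t)"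
        using True emeasure_lborel_cball_finite by (intro emeasure_Diff) (auto simp: less_top[symmetric])
      also have "\<dots> = ennreal (?V * (1 - t ^ ?N))"
        using True by (simp add: emeasure_cball ennreal_minus algebra_simps)
      finally show ?thesis using True by simp
    qed simp
  qed
  also have "\<dots> = ennreal (?V * (1 - 1 ^ (?N + 1) / real (?N + 1)) - ?V * (0 - 0 ^ (?N + 1) / real (?N + 1)))"
  proof (rule nn_integral_FTC_Icc)
    fix t :: real assume t: "t \<in> {0..1}"
    show "((\<lambda>t. ?V * (t - t ^ (?N + 1) / real (?N + 1))) has_real_derivative ?V * (1 - t ^ ?N)) (at t)"
      using DERIV_cmult[OF DERIV_diff[OF DERIV_ident DERIV_cdivide[OF DERIV_pow[of "?N + 1" t], of "real (?N + 1)"]], of ?V]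
      by simp
    show "0 \<le> ?V * (1 - t ^ ?N)" using t by (intro mult_nonneg_nonneg) (auto intro!: power_le_one)
  qed auto
  also have "?V * (1 - 1 ^ (?N + 1) / real (?N + 1)) - ?V * (0 - 0 ^ (?N + 1) / real (?N + 1)) = real ?N * ?V / real (?N + 1)"
    by (simp add: field_simps)
  finally show ?thesis .
qed

text \<open>The fundamental theorem in its interior form, because the square root is not differentiable
  at \<open>0\<close>, which is the value of \<open>1 - t\<^sup>2\<close> at the endpoint \<open>t = 1\<close>.\<close>

lemma nn_integral_half_cap: 
  "(\<integral>\<^sup>+t. indicator {0..1} t * ennreal (t * sqrt (1 - t\<^sup>2) ^ k) \<partial>lborel) = ennreal (1 / real (k + 2))"
proof -
  define F where "F t = - (sqrt (1 - t\<^sup>2) ^ (k + 2) / real (k + 2))" for t :: real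
  have "((\<lambda>t. t * sqrt (1 - t\<^sup>2) ^ k) has_integral (F 1 - F 0)) {0..1}"
  proof (rule fundamental_theorem_of_calculus_interior)
    show "continuous_on {0..1} F" unfolding F_def by (intro continuous_intros) auto
    fix t :: real assume t: "t \<in> {0<..<1}"
    then have "t\<^sup>2 < 1" by (simp add: power_less_one_iff abs_square_less_1)
    then have s: "sqrt (1 - t\<^sup>2) > 0" by simp
    have "((\<lambda>t. sqrt (1 - t\<^sup>2)) has_real_derivative - t / sqrt (1 - t\<^sup>2)) (at t)"
      using s by (auto intro!: derivative_eq_intros simp: field_simps)
    from DERIV_minus[OF DERIV_cdivide[OF DERIV_power[OF this, of "k + 2"], of "real (k + 2)"]]
    have "(F has_real_derivative - (real (k + 2) * (- t / sqrt (1 - t\<^sup>2) * sqrt (1 - t\<^sup>2) ^ (k + 2 - Suc 0)) / real (k + 2))) (at t)"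
      by (simp only: F_def[abs_def])
    also have "- (real (k + 2) * (- t / sqrt (1 - t\<^sup>2) * sqrt (1 - t\<^sup>2) ^ (k + 2 - Suc 0)) / real (k + 2)) = t * sqrt (1 - t\<^sup>2) ^ k"
      using s by simp
    finally have "(F has_real_derivative t * sqrt (1 - t\<^sup>2) ^ k) (at t)" .
    then show "(F has_vector_derivative t * sqrt (1 - t\<^sup>2) ^ k) (at t)"
      by (simp add: has_real_derivative_iff_has_vector_derivative)
  qed simp
  moreover have "F 1 - F 0 = 1 / real (k + 2)" by (simp add: F_def)
  ultimately have I: "((\<lambda>t. t * sqrt (1 - t\<^sup>2) ^ k) has_integral 1 / real (k + 2)) {0..1}" by simp
  have "(\<integral>\<^sup>+t. ennreal (indicator {0..1} t * (t * sqrt (1 - t\<^sup>2) ^ k)) \<partial>lborel) = ennreal (1 / real (k + 2))"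
  proof (rule nn_integral_has_integral_lebesgue[OF _ I])
    fix t :: real assume "t \<in> {0..1}"
    then show "0 \<le> t * sqrt (1 - t\<^sup>2) ^ k" by (auto intro!: mult_nonneg_nonneg simp: power_le_one)
  qed
  moreover have "ennreal (indicator {0..1} t * (t * sqrt (1 - t\<^sup>2) ^ k)) = indicator {0..1} t * ennreal (t * sqrt (1 - t\<^sup>2) ^ k)" for t :: real
    by (auto simp: indicator_def)
  ultimately show ?thesis by simp
qed

lemma nn_integral_abs_inner_cball:
  fixes w :: "real^'n"
  assumes w: "norm w = 1" and D: "CARD('n) \<ge> 2"
  shows "(\<integral>\<^sup>+x. ennreal \<bar>x \<bullet> w\<bar> * indicator (cball 0 1) x \<partial>lborel)
    = ennreal (2 * unit_ball_vol (real (CARD('n) - 1)) / real (CARD('n) + 1))"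
proof -
  let ?k = "CARD('n) - 1"
  let ?V = "unit_ball_vol (real ?k)"
  obtain e :: "real^'n" where e: "e \<in> Basis" using nonempty_Basis by blast
  obtain T where T: "orthogonal_transformation T" "T w = e"
    using orthogonal_transformation_exists[of w e] w e by auto
  note [measurable] = borel_measurable_orthogonal[OF T(1)]
  have ip: "T x \<bullet> e = x \<bullet> w" for x using T by (metis orthogonal_transformation_def)
  have nT: "norm (T x) = norm x" for x using T(1) by (simp add: orthogonal_transformation_norm)
  have cb[measurable]: "cball 0 1 \<in> sets (borel :: (real^'n) measure)" by simp
  have "(\<integral>\<^sup>+x. ennreal \<bar>x \<bullet> w\<bar> * indicator (cball 0 1) x \<partial>lborel)
    = (\<integral>\<^sup>+x. ennreal \<bar>T x \<bullet> e\<bar> * indicator (cball 0 1) (T x) \<partial>lborel)"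
    by (intro nn_integral_cong) (auto simp: ip nT indicator_def)
  also have "\<dots> = (\<integral>\<^sup>+x. ennreal \<bar>x \<bullet> e\<bar> * indicator (cball 0 1) x \<partial>distr lborel borel T)"
    by (subst nn_integral_distr) auto
  also have "\<dots> = (\<integral>\<^sup>+x. ennreal \<bar>x \<bullet> e\<bar> * indicator (cball 0 1) x \<partial>lborel)"
    unfolding lborel_distr_orthogonal[OF T(1)] ..
  also have "\<dots> = (\<integral>\<^sup>+t. ennreal \<bar>t\<bar> * (indicator {-1..1} t * ennreal (?V * sqrt (1 - t\<^sup>2) ^ ?k)) \<partial>lborel)"
    using nn_integral_axis_cball[OF e, of 1 "\<lambda>t. ennreal \<bar>t\<bar>"] D by simp
  also have "\<dots> = (\<integral>\<^sup>+t. ennreal ?V * (indicator {0..1} t * ennreal (t * sqrt (1 - t\<^sup>2) ^ ?k))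
      + ennreal ?V * (indicator {0..1} (- t) * ennreal ((- t) * sqrt (1 - (- t)\<^sup>2) ^ ?k)) \<partial>lborel)"
  proof (rule nn_integral_cong)
    fix t :: real
    have sq: "0 \<le> 1 - t\<^sup>2" if "-1 \<le> t" "t \<le> 1" using that by (simp add: abs_square_le_1 abs_le_iff)
    have h: "ennreal \<bar>t\<bar> * ennreal (?V * p) = ennreal ?V * ennreal (\<bar>t\<bar> * p)" if "0 \<le> p" for p
      using that by (simp add: ennreal_mult[symmetric] mult_ac)
    consider "t = 0" | "0 < t" "t \<le> 1" | "t < 0" "-1 \<le> t" | "t > 1" | "t < -1" by linarith
    then show "ennreal \<bar>t\<bar> * (indicator {-1..1} t * ennreal (?V * sqrt (1 - t\<^sup>2) ^ ?k))
      = ennreal ?V * (indicator {0..1} t * ennreal (t * sqrt (1 - t\<^sup>2) ^ ?k))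
      + ennreal ?V * (indicator {0..1} (- t) * ennreal ((- t) * sqrt (1 - (- t)\<^sup>2) ^ ?k))"
    proof cases
      case 2
      then show ?thesis using h[of "sqrt (1 - t\<^sup>2) ^ ?k"] sq by simp
    next
      case 3
      then show ?thesis using h[of "sqrt (1 - t\<^sup>2) ^ ?k"] sq by simp
    qed auto
  qed
  also have "\<dots> = (\<integral>\<^sup>+t. ennreal ?V * (indicator {0..1} t * ennreal (t * sqrt (1 - t\<^sup>2) ^ ?k)) \<partial>lborel)
      + (\<integral>\<^sup>+t. ennreal ?V * (indicator {0..1} (- t) * ennreal ((- t) * sqrt (1 - (- t)\<^sup>2) ^ ?k)) \<partial>lborel)"
    by (rule nn_integral_add) measurable
  also have "(\<integral>\<^sup>+t. ennreal ?V * (indicator {0..1} (- t) * ennreal ((- t) * sqrt (1 - (- t)\<^sup>2) ^ ?k)) \<partial>lborel)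
      = (\<integral>\<^sup>+t. ennreal ?V * (indicator {0..1} t * ennreal (t * sqrt (1 - t\<^sup>2) ^ ?k)) \<partial>lborel)"
    using nn_integral_real_affine[of "\<lambda>t. ennreal ?V * (indicator {0..1} t * ennreal (t * sqrt (1 - t\<^sup>2) ^ ?k))" "-1" 0]
    by (simp del: minus_mult_minus mult_minus_left)
  also have "(\<integral>\<^sup>+t. ennreal ?V * (indicator {0..1} t * ennreal (t * sqrt (1 - t\<^sup>2) ^ ?k)) \<partial>lborel)
      = ennreal ?V * ennreal (1 / real (?k + 2))"
    by (subst nn_integral_cmult) (simp_all add: nn_integral_half_cap)
  also have "ennreal ?V * ennreal (1 / real (?k + 2)) + ennreal ?V * ennreal (1 / real (?k + 2))
      = ennreal (2 * ?V / real (CARD('n) + 1))"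
    using D by (simp add: ennreal_mult[symmetric] ennreal_plus[symmetric] del: ennreal_plus)
  finally show ?thesis .
qed

text \<open>By rotation invariance the integral is \<open>c\<close> for every unit vector and \<open>\<bar>x\<bar> c\<close> for every vector \<open>x\<close>. Integrate
  over \<open>x\<close> in the unit ball and exchange the order: on one side appears \<open>c \<integral> \<bar>x\<bar> dx\<close>, on the other the
  area of the sphere times \<open>\<integral> \<bar>x \<bullet> \<xi>\<bar> dx\<close>, which does not depend on \<open>\<xi>\<close>.\<close>

lemma nn_integral_sphere_abs_inner:
  fixes w :: "real^'n"
  assumes w: "norm w = 1" and D: "CARD('n) \<ge> 2"
  shows "(\<integral>\<^sup>+\<xi>. ennreal \<bar>w \<bullet> \<xi>\<bar> \<partial>sphere_measure) = ennreal (2 * unit_ball_vol (real (CARD('n) - 1)))"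
proof -
  let ?N = "CARD('n)" and ?V = "unit_ball_vol (real CARD('n))" and ?W = "unit_ball_vol (real (CARD('n) - 1))"
  interpret S: finite_measure "sphere_measure :: (real^'n) measure" by (rule finite_measure_sphere_measure[OF D])
  interpret P: pair_sigma_finite "sphere_measure :: (real^'n) measure" "lborel :: (real^'n) measure" ..
  define c where "c = (\<integral>\<^sup>+\<xi>. ennreal \<bar>w \<bullet> \<xi>\<bar> \<partial>sphere_measure)"
  have dir: "(\<integral>\<^sup>+\<xi>. ennreal \<bar>x \<bullet> \<xi>\<bar> \<partial>sphere_measure) = ennreal (norm x) * c" for x :: "real^'n"
  proof -
    obtain T where T: "orthogonal_transformation T" "T (norm x *\<^sub>R w) = x"
      using orthogonal_transformation_exists[of "norm x *\<^sub>R w" x] w by auto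
    have "x \<bullet> T \<xi> = norm x * (w \<bullet> \<xi>)" for \<xi>
    proof -
      have "x \<bullet> T \<xi> = T (norm x *\<^sub>R w) \<bullet> T \<xi>" using T(2) by simp
      also have "\<dots> = norm x * (w \<bullet> \<xi>)" using T(1) unfolding orthogonal_transformation_def by simp
      finally show ?thesis .
    qed
    then have "(\<integral>\<^sup>+\<xi>. ennreal \<bar>x \<bullet> T \<xi>\<bar> \<partial>sphere_measure) = (\<integral>\<^sup>+\<xi>. ennreal (norm x) * ennreal \<bar>w \<bullet> \<xi>\<bar> \<partial>sphere_measure)"
      by (intro nn_integral_cong) (simp add: abs_mult ennreal_mult)
    also have "\<dots> = ennreal (norm x) * c" unfolding c_def by (rule nn_integral_cmult) measurable
    finally show ?thesis using nn_integral_sphere_orthogonal[OF T(1), of "\<lambda>\<xi>. ennreal \<bar>x \<bullet> \<xi>\<bar>"] by simp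
  qed
  have cb[measurable]: "cball 0 1 \<in> sets (borel :: (real^'n) measure)" by simp
  have "c * ennreal (real ?N * ?V / real (?N + 1))
      = (\<integral>\<^sup>+x. c * (ennreal (norm x) * indicator (cball (0 :: real^'n) 1) x) \<partial>lborel)"
    using nn_integral_norm_cball[where 'a = "real^'n"] by (subst nn_integral_cmult) auto
  also have "\<dots> = (\<integral>\<^sup>+x. (\<integral>\<^sup>+\<xi>. ennreal \<bar>x \<bullet> \<xi>\<bar> * indicator (cball (0::real^'n) 1) x \<partial>sphere_measure) \<partial>lborel)"
  proof (rule nn_integral_cong)
    fix x :: "real^'n"
    have "(\<integral>\<^sup>+\<xi>. ennreal \<bar>x \<bullet> \<xi>\<bar> * indicator (cball 0 1) x \<partial>sphere_measure)
      = (\<integral>\<^sup>+\<xi>. ennreal \<bar>x \<bullet> \<xi>\<bar> \<partial>sphere_measure) * indicator (cball 0 1) x"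
      by (rule nn_integral_multc) measurable
    then show "c * (ennreal (norm x) * indicator (cball 0 1) x)
      = (\<integral>\<^sup>+\<xi>. ennreal \<bar>x \<bullet> \<xi>\<bar> * indicator (cball 0 1) x \<partial>sphere_measure)"
      by (simp only: dir mult_ac)
  qed
  also have "\<dots> = (\<integral>\<^sup>+\<xi>. (\<integral>\<^sup>+x. ennreal \<bar>x \<bullet> \<xi>\<bar> * indicator (cball (0::real^'n) 1) x \<partial>lborel) \<partial>sphere_measure)"
    by (rule P.Fubini') measurable
  also have "\<dots> = (\<integral>\<^sup>+\<xi>. ennreal (2 * ?W / real (?N + 1)) \<partial>(sphere_measure :: (real^'n) measure))"
    by (intro nn_integral_cong nn_integral_abs_inner_cball D) simp
  also have "\<dots> = ennreal (2 * ?W / real (?N + 1)) * ennreal (real ?N * ?V)"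
    by (simp add: emeasure_space_sphere_measure[OF D])
  also have "\<dots> = ennreal (2 * ?W) * ennreal (real ?N * ?V / real (?N + 1))"
    by (simp add: ennreal_mult[symmetric])
  finally have "c * ennreal (real ?N * ?V / real (?N + 1)) = ennreal (2 * ?W) * ennreal (real ?N * ?V / real (?N + 1))" .
  then have "ennreal (real ?N * ?V / real (?N + 1)) * c = ennreal (real ?N * ?V / real (?N + 1)) * ennreal (2 * ?W)"
    by (simp only: mult.commute)
  moreover have "?V \<noteq> 0" using unit_ball_vol_pos[of "real ?N"] by linarith
  then have "ennreal (real ?N * ?V / real (?N + 1)) \<noteq> 0" by simp
  ultimately have "c = ennreal (2 * ?W)"
    by (simp only: ennreal_mult_cancel_left) simp
  then show ?thesis by (simp add: c_def)
qed

text \<open>The point reflection exchanges the positive and the negative part of \<open>w \<bullet> \<xi>\<close>.\<close>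

lemma nn_integral_hemisphere:
  fixes w :: "real^'n"
  assumes w: "norm w = 1" and D: "CARD('n) \<ge> 2"
  shows "(\<integral>\<^sup>+\<xi>. ennreal (max 0 (w \<bullet> \<xi>)) \<partial>sphere_measure) = ennreal (unit_ball_vol (real (CARD('n) - 1)))"
proof -
  let ?A = "\<integral>\<^sup>+\<xi>. ennreal (max 0 (w \<bullet> \<xi>)) \<partial>sphere_measure"
  have neg: "orthogonal_transformation (\<lambda>x::real^'n. - x)"
    using orthogonal_transformation_neg[of "\<lambda>x::real^'n. x"] orthogonal_transformation_id by (simp add: id_def)
  have "ennreal (2 * unit_ball_vol (real (CARD('n) - 1))) = (\<integral>\<^sup>+\<xi>. ennreal \<bar>w \<bullet> \<xi>\<bar> \<partial>sphere_measure)"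
    by (rule nn_integral_sphere_abs_inner[OF w D, symmetric])
  also have "\<dots> = (\<integral>\<^sup>+\<xi>. ennreal (max 0 (w \<bullet> \<xi>)) + ennreal (max 0 (w \<bullet> (- \<xi>))) \<partial>sphere_measure)"
    by (intro nn_integral_cong) (auto simp: max_def)
  also have "\<dots> = ?A + (\<integral>\<^sup>+\<xi>. ennreal (max 0 (w \<bullet> (- \<xi>))) \<partial>sphere_measure)"
    by (rule nn_integral_add) measurable
  also have "(\<integral>\<^sup>+\<xi>. ennreal (max 0 (w \<bullet> (- \<xi>))) \<partial>sphere_measure) = ?A"
    by (rule nn_integral_sphere_orthogonal[OF neg]) measurable
  also have "?A + ?A = 2 * ?A" by (simp add: mult_2)
  finally have "2 * ?A = 2 * ennreal (unit_ball_vol (real (CARD('n) - 1)))" by (simp add: ennreal_mult)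
  then show ?thesis by (subst (asm) ennreal_mult_cancel_left) auto
qed

text \<open>The half turn \<open>T\<close> about the axis \<open>w\<close> maps the half sphere to itself. So \<open>T\<close> fixes the integral, which
  is therefore parallel to \<open>w\<close>.\<close>

lemma integral_hemisphere:
  fixes w :: "real^'n"
  assumes w: "norm w = 1" and D: "CARD('n) \<ge> 2"
  shows "(LINT \<xi>|sphere_measure. (if w \<bullet> \<xi> > 0 then 1 else 0 :: real) *\<^sub>R \<xi>) = unit_ball_vol (real (CARD('n) - 1)) *\<^sub>R w"
proof -
  interpret S: finite_measure "sphere_measure :: (real^'n) measure" by (rule finite_measure_sphere_measure[OF D])
  define f where "f \<xi> = (if w \<bullet> \<xi> > 0 then 1 else 0 :: real) *\<^sub>R \<xi>" for \<xi> :: "real^'n"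
  have [measurable]: "f \<in> borel_measurable sphere_measure" unfolding f_def[abs_def] by measurable
  have int: "integrable sphere_measure f"
    by (rule S.integrable_const_bound[where B = 1]) (auto simp: f_def)
  define F where "F = integral\<^sup>L sphere_measure f"
  have "F \<bullet> w = (LINT \<xi>|sphere_measure. f \<xi> \<bullet> w)"
    unfolding F_def by (rule integral_inner_left[symmetric]) (use int in simp)
  also have "\<dots> = (LINT \<xi>|sphere_measure. max 0 (w \<bullet> \<xi>))"
    by (intro Bochner_Integration.integral_cong) (auto simp: f_def max_def inner_commute)
  also have "\<dots> = unit_ball_vol (real (CARD('n) - 1))"
    by (subst integral_eq_nn_integral) (auto simp: nn_integral_hemisphere[OF w D])
  finally have Fw: "F \<bullet> w = unit_ball_vol (real (CARD('n) - 1))" .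
  \<comment> \<open>Identity along \<open>w\<close>, minus the identity on the orthogonal complement of \<open>w\<close>.\<close>
  define T where "T x = (2 * (x \<bullet> w)) *\<^sub>R w - x" for x :: "real^'n"
  have linT: "linear T" unfolding T_def by (intro linearI) (simp_all add: inner_add_left algebra_simps)
  have "T x \<bullet> T y = x \<bullet> y" for x y
    using w by (simp add: T_def inner_diff_left inner_diff_right inner_commute norm_eq_1)
  then have T: "orthogonal_transformation T" using linT by (simp add: orthogonal_transformation_def)
  have "T F = (LINT \<xi>|sphere_measure. T (f \<xi>))"
    unfolding F_def using linT int by (intro integral_bounded_linear[symmetric]) (auto simp: linear_conv_bounded_linear)
  also have "\<dots> = (LINT \<xi>|sphere_measure. f (T \<xi>))"
  proof (rule Bochner_Integration.integral_cong)
    fix \<xi>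
    have "w \<bullet> T \<xi> = w \<bullet> \<xi>" using w by (simp add: T_def inner_diff_right inner_commute norm_eq_1)
    moreover have "T 0 = 0" by (simp add: T_def)
    ultimately show "T (f \<xi>) = f (T \<xi>)" by (simp add: f_def)
  qed simp
  also have "\<dots> = integral\<^sup>L (distr sphere_measure sphere_measure T) f"
    by (rule integral_distr[symmetric]) (use orthogonal_measurable_sphere_measure[OF T] in auto)
  also have "\<dots> = F" unfolding sphere_measure_distr_orthogonal[OF T] F_def ..
  finally have "2 *\<^sub>R F = 2 *\<^sub>R ((F \<bullet> w) *\<^sub>R w)" by (simp add: T_def algebra_simps scaleR_2)
  then have "F = (F \<bullet> w) *\<^sub>R w" by (rule real_vector.scale_left_imp_eq[rotated]) simp
  then show ?thesis using Fw by (simp add: F_def f_def[abs_def])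
qed


section \<open>The kinetic formulation\<close>

lemma partial_derivative_continuous:
  assumes "\<phi> \<in> test_functions \<Omega>"
  shows "continuous_on UNIV (partial_derivative i \<phi>)"
proof -
  have "Ck (Suc 0) \<phi>" using assms by (simp only: test_functions_def mem_Collect_eq)
  then show ?thesis by simp
qed

lemma partial_derivative_eq_0:
  assumes "x \<notin> closure {x. \<phi> x \<noteq> 0}"
  shows "partial_derivative i \<phi> x = 0"
proof -
  have "(\<phi> has_derivative (\<lambda>_. 0)) (at x)"
  proof (rule has_derivative_transform_within_open[OF has_derivative_const])
    show "x \<in> - closure {x. \<phi> x \<noteq> 0}" using assms by simp
    show "0 = \<phi> y" if "y \<in> - closure {x. \<phi> x \<noteq> 0}" for y
      using that closure_subset[of "{x. \<phi> x \<noteq> 0}"] by auto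
  qed (simp add: open_Compl)
  then have "frechet_derivative \<phi> (at x) = (\<lambda>_. 0)" by (rule frechet_derivative_at[symmetric])
  then show ?thesis by (simp add: partial_derivative_def)
qed

lemma partial_derivative_integrable:
  assumes \<phi>: "\<phi> \<in> test_functions \<Omega>" and \<Omega>: "open \<Omega>"
  shows "integrable (lebesgue_on \<Omega>) (partial_derivative i \<phi>)"
proof -
  let ?K = "closure {x. \<phi> x \<noteq> 0}"
  have K: "compact ?K" "?K \<subseteq> \<Omega>" using \<phi> by (auto simp: test_functions_def)
  have "integrable lborel (\<lambda>x. indicator ?K x *\<^sub>R partial_derivative i \<phi> x)"
    using partial_derivative_continuous[OF \<phi>] by (intro borel_integrable_compact K) (auto intro: continuous_on_subset)
  also have "(\<lambda>x. indicator ?K x *\<^sub>R partial_derivative i \<phi> x) = (\<lambda>x. indicator \<Omega> x *\<^sub>R partial_derivative i \<phi> x)"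
    using K(2) partial_derivative_eq_0[of _ \<phi> i] by (force simp: indicator_def fun_eq_iff)
  finally have int: "integrable lborel (\<lambda>x. indicator \<Omega> x *\<^sub>R partial_derivative i \<phi> x)" .
  then have "integrable lebesgue (\<lambda>x. indicator \<Omega> x *\<^sub>R partial_derivative i \<phi> x)"
    by (subst integrable_completion[OF borel_measurable_integrable[OF int]])
  then show ?thesis using \<Omega> by (subst integrable_restrict_space) auto
qed

lemma sigma_finite_lebesgue_on:
  fixes \<Omega> :: "'a::euclidean_space set"
  assumes "open \<Omega>"
  shows "sigma_finite_measure (lebesgue_on \<Omega>)"
proof (rule sigma_finite_measure_restrict_space)
  show "sigma_finite_measure (lebesgue :: 'a measure)"
  proof
    show "\<exists>A::'a set set. countable A \<and> A \<subseteq> sets lebesgue \<and> \<Union>A = space lebesgue \<and> (\<forall>a\<in>A. emeasure lebesgue a \<noteq> \<infinity>)"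
    proof (intro exI[of _ "range (\<lambda>n::nat. ball 0 (real n))"] conjI)
      show "(\<Union>n::nat. ball 0 (real n)) = space (lebesgue :: 'a measure)"
        using reals_Archimedean2 by auto
      show "\<forall>a\<in>range (\<lambda>n::nat. ball 0 (real n)). emeasure lebesgue (a :: 'a set) \<noteq> \<infinity>"
        using emeasure_lborel_ball_finite by (auto simp: less_top[symmetric])
    qed auto
  qed
qed (use assms in auto)

lemma integral_hemisphere_component:
  fixes w :: "real^'n"
  assumes w: "norm w = 1" and D: "CARD('n) \<ge> 2"
  shows "unit_ball_vol (real (CARD('n) - 1)) * w $ k
    = (LINT \<xi>|sphere_measure. (if w \<bullet> \<xi> > 0 then 1 else 0) * \<xi> $ k)"
proof -
  interpret S: finite_measure "sphere_measure :: (real^'n) measure" by (rule finite_measure_sphere_measure[OF D])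
  have int: "integrable sphere_measure (\<lambda>\<xi>. (if w \<bullet> \<xi> > 0 then 1 else 0 :: real) *\<^sub>R \<xi>)"
    by (rule S.integrable_const_bound[where B = 1]) auto
  have "(LINT \<xi>|sphere_measure. (if w \<bullet> \<xi> > 0 then 1 else 0 :: real) *\<^sub>R \<xi>) $ k
    = (LINT \<xi>|sphere_measure. ((if w \<bullet> \<xi> > 0 then 1 else 0 :: real) *\<^sub>R \<xi>) $ k)"
    using integral_bounded_linear[OF bounded_linear_vec_nth int, of k] by simp
  then show ?thesis unfolding integral_hemisphere[OF w D] by simp
qed

text \<open>The representation of \<open>u\<close> tested against an integrable function, with the integrals exchanged. The
  double integral converges absolutely since \<open>\<bar>\<xi>\<^sub>k \<chi>\<bar> \<le> 1\<close> and the sphere has finite area.\<close>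

lemma integral_component_kinetic:
  fixes u :: "real^'n \<Rightarrow> real^'n"
  assumes D: "CARD('n) \<ge> 2" and \<Omega>: "open \<Omega>"
    and u[measurable]: "u \<in> borel_measurable (lebesgue_on \<Omega>)"
    and unit: "AE x in lebesgue_on \<Omega>. norm (u x) = 1"
    and g: "integrable (lebesgue_on \<Omega>) g"
  shows "unit_ball_vol (real (CARD('n) - 1)) * (LINT x|lebesgue_on \<Omega>. u x $ k * g x)
    = (LINT \<xi>|sphere_measure. \<xi> $ k * (LINT x|lebesgue_on \<Omega>. kinetic_chi u x \<xi> * g x))"
proof -
  let ?S = "sphere_measure :: (real^'n) measure" and ?\<mu> = "lebesgue_on \<Omega>"
  interpret S: finite_measure ?S by (rule finite_measure_sphere_measure[OF D])
  interpret L: sigma_finite_measure ?\<mu> by (rule sigma_finite_lebesgue_on[OF \<Omega>])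
  interpret P: pair_sigma_finite ?\<mu> ?S ..
  have [measurable]: "g \<in> borel_measurable ?\<mu>" using g by simp
  have nth: "(\<lambda>\<xi>::real^'n. \<xi> $ k) \<in> borel_measurable borel"
    by (intro borel_measurable_continuous_onI continuous_intros)
  have [measurable]: "(\<lambda>\<xi>. \<xi> $ k) \<in> borel_measurable ?S"
    by (rule measurable_compose[OF measurable_ident_sphere_measure nth])
  define f where "f x \<xi> = \<xi> $ k * (kinetic_chi u x \<xi> * g x)" for x \<xi>
  have mf[measurable]: "case_prod f \<in> borel_measurable (?\<mu> \<Otimes>\<^sub>M ?S)"
    unfolding f_def[abs_def] kinetic_chi_def by measurable
  have comp: "\<bar>\<xi> $ k\<bar> \<le> 1" if "\<xi> \<in> space ?S" for \<xi>
    using component_le_norm_cart[of \<xi> k] that by simp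
  have bnd: "\<bar>f x \<xi>\<bar> \<le> \<bar>g x\<bar>" if "\<xi> \<in> space ?S" for x \<xi>
    using comp[OF that] by (auto simp: f_def kinetic_chi_def abs_mult intro: mult_left_le_one_le)
  have intx: "integrable ?S (f x)" if "x \<in> space ?\<mu>" for x
    by (rule S.integrable_const_bound[where B = "\<bar>g x\<bar>"]) (use bnd mf that in \<open>auto intro: measurable_Pair2[of "case_prod f", simplified]\<close>)
  have int: "integrable (?\<mu> \<Otimes>\<^sub>M ?S) (case_prod f)"
  proof (rule P.Fubini_integrable[OF mf])
    show "integrable ?\<mu> (\<lambda>x. LINT \<xi>|?S. norm (case_prod f (x, \<xi>)))"
    proof (rule Bochner_Integration.integrable_bound)
      show "integrable ?\<mu> (\<lambda>x. measure ?S (space ?S) * g x)" using g by simp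
      show "AE x in ?\<mu>. norm (LINT \<xi>|?S. norm (case_prod f (x, \<xi>))) \<le> norm (measure ?S (space ?S) * g x)"
      proof (rule AE_I2)
        fix x assume x: "x \<in> space ?\<mu>"
        have "(LINT \<xi>|?S. norm (f x \<xi>)) \<le> (LINT \<xi>|?S. \<bar>g x\<bar>)"
          using intx[OF x] bnd by (intro integral_mono) auto
        then show "norm (LINT \<xi>|?S. norm (case_prod f (x, \<xi>))) \<le> norm (measure ?S (space ?S) * g x)"
          by (simp add: abs_mult)
      qed
    qed measurable
    show "AE x in ?\<mu>. integrable ?S (\<lambda>\<xi>. case_prod f (x, \<xi>))"
      using intx by (intro AE_I2) simp
  qed
  have inner: "(LINT x|?\<mu>. f x \<xi>) = \<xi> $ k * (LINT x|?\<mu>. kinetic_chi u x \<xi> * g x)" for \<xi>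
    unfolding f_def by (rule integral_mult_right_zero)
  have "unit_ball_vol (real (CARD('n) - 1)) * (LINT x|?\<mu>. u x $ k * g x)
    = (LINT x|?\<mu>. unit_ball_vol (real (CARD('n) - 1)) * (u x $ k * g x))"
    by (rule integral_mult_right_zero[symmetric])
  also have "\<dots> = (LINT x|?\<mu>. LINT \<xi>|?S. f x \<xi>)"
  proof (rule integral_cong_AE)
    have "(\<lambda>x. u x $ k) \<in> borel_measurable ?\<mu>"
      by (rule measurable_compose[OF u nth])
    then show "(\<lambda>x. unit_ball_vol (real (CARD('n) - 1)) * (u x $ k * g x)) \<in> borel_measurable ?\<mu>" by measurable
    show "(\<lambda>x. LINT \<xi>|?S. f x \<xi>) \<in> borel_measurable ?\<mu>" by measurable
    show "AE x in ?\<mu>. unit_ball_vol (real (CARD('n) - 1)) * (u x $ k * g x) = (LINT \<xi>|?S. f x \<xi>)"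
      using unit
    proof eventually_elim
      case (elim x)
      have "unit_ball_vol (real (CARD('n) - 1)) * (u x $ k * g x)
        = (LINT \<xi>|?S. (if u x \<bullet> \<xi> > 0 then 1 else 0) * \<xi> $ k) * g x"
        unfolding integral_hemisphere_component[OF elim D, symmetric] by simp
      also have "\<dots> = (LINT \<xi>|?S. (if u x \<bullet> \<xi> > 0 then 1 else 0) * \<xi> $ k * g x)"
        by (rule integral_mult_left_zero[symmetric])
      finally show ?case by (simp add: f_def kinetic_chi_def mult_ac)
    qed
  qed
  also have "\<dots> = (LINT \<xi>|?S. LINT x|?\<mu>. f x \<xi>)"
    by (rule P.Fubini_integral[OF int, symmetric])
  finally show "unit_ball_vol (real (CARD('n) - 1)) * (LINT x|?\<mu>. u x $ k * g x)
    = (LINT \<xi>|?S. \<xi> $ k * (LINT x|?\<mu>. kinetic_chi u x \<xi> * g x))" unfolding inner .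
qed

theorem proposition5:
  fixes \<Omega> :: "(real ^ 'n::finite) set" and u :: "real ^ 'n \<Rightarrow> real ^ 'n"
  assumes "CARD('n) \<ge> 2"
    and "open \<Omega>"
    and "u \<in> borel_measurable (lebesgue_on \<Omega>)"
    and "AE x in lebesgue_on \<Omega>. norm (u x) = 1"
  shows "(AE x in lebesgue_on \<Omega>.
            u x = (1 / unit_ball_vol (real (CARD('n) - 1))) *\<^sub>R
              (LINT \<xi>:sphere 0 1|hausdorff_measure (CARD('n) - 1). kinetic_chi u x \<xi> *\<^sub>R \<xi>))
       \<and> (kinetic_formulation \<Omega> u \<longrightarrow> distr_curl_free \<Omega> u)"
proof (intro conjI impI)
  let ?V = "unit_ball_vol (real (CARD('n) - 1))"
  have V: "?V > 0" by simp
  have inv: "1 / ?V * ?V = 1" using less_imp_neq[OF V] by (simp only: divide_self_if times_divide_eq_left mult_1) simp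
  show "AE x in lebesgue_on \<Omega>. u x = (1 / ?V) *\<^sub>R
      (LINT \<xi>:sphere 0 1|hausdorff_measure (CARD('n) - 1). kinetic_chi u x \<xi> *\<^sub>R \<xi>)"
    using assms(4)
  proof eventually_elim
    case (elim x)
    have "(LINT \<xi>:sphere 0 1|hausdorff_measure (CARD('n) - 1). kinetic_chi u x \<xi> *\<^sub>R \<xi>)
      = (LINT \<xi>|sphere_measure. kinetic_chi u x \<xi> *\<^sub>R \<xi>)"
      unfolding sphere_measure_def set_lebesgue_integral_def
      by (rule integral_restrict_space[symmetric]) simp
    also have "\<dots> = ?V *\<^sub>R u x"
      unfolding kinetic_chi_def by (rule integral_hemisphere[OF elim assms(1)])
    finally show ?case using inv by (simp only: scaleR_scaleR scaleR_one)
  qed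
  assume kin: "kinetic_formulation \<Omega> u"
  show "distr_curl_free \<Omega> u"
    unfolding distr_curl_free_def
  proof (intro allI ballI)
    fix j k :: 'n and \<phi> assume \<phi>: "\<phi> \<in> test_functions \<Omega>"
    show "distr_partial \<Omega> j (\<lambda>x. u x $ k) \<phi> = distr_partial \<Omega> k (\<lambda>x. u x $ j) \<phi>"
    proof (cases "j = k")
      case False
      let ?G = "\<lambda>i \<xi>. LINT x|lebesgue_on \<Omega>. kinetic_chi u x \<xi> * partial_derivative i \<phi> x"
      have rep: "?V * (LINT x|lebesgue_on \<Omega>. u x $ l * partial_derivative i \<phi> x)
          = (LINT \<xi>|sphere_measure. \<xi> $ l * ?G i \<xi>)" for i l
        by (rule integral_component_kinetic[OF assms partial_derivative_integrable[OF \<phi> assms(2)]])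
      have "\<xi> $ k * ?G j \<xi> = \<xi> $ j * ?G k \<xi>" if "\<xi> \<in> space sphere_measure" for \<xi>
      proof -
        \<comment> \<open>The projection of \<open>\<xi>\<close> to the \<open>j\<close>-\<open>k\<close>-plane, turned by a right angle.\<close>
        define v where "v = \<xi> $ k *\<^sub>R axis j 1 - \<xi> $ j *\<^sub>R axis k (1::real)"
        have "v \<bullet> \<xi> = 0" by (simp add: v_def inner_diff_left inner_axis')
        moreover have "\<xi> \<in> sphere 0 1" using that by simp
        ultimately have "(\<Sum>i\<in>UNIV. v $ i * distr_partial \<Omega> i (\<lambda>x. kinetic_chi u x \<xi>) \<phi>) = 0"
          using kin \<phi> unfolding kinetic_formulation_def by blast
        moreover have "v $ i * distr_partial \<Omega> i (\<lambda>x. kinetic_chi u x \<xi>) \<phi>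
            = (if i = j then - (\<xi> $ k * ?G j \<xi>) else 0) + (if i = k then \<xi> $ j * ?G k \<xi> else 0)" for i
          using False by (simp add: v_def axis_def distr_partial_def)
        ultimately show ?thesis by (simp add: sum.distrib)
      qed
      then have "(LINT \<xi>|sphere_measure. \<xi> $ k * ?G j \<xi>) = (LINT \<xi>|sphere_measure. \<xi> $ j * ?G k \<xi>)"
        by (intro Bochner_Integration.integral_cong) auto
      then have "?V * (LINT x|lebesgue_on \<Omega>. u x $ k * partial_derivative j \<phi> x)
          = ?V * (LINT x|lebesgue_on \<Omega>. u x $ j * partial_derivative k \<phi> x)"
        unfolding rep .
      then show ?thesis unfolding mult_left_cancel[OF less_imp_neq[OF V, symmetric]] by (simp add: distr_partial_def)
    qed simp
  qed
qed

end
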